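(* Let $F$ be a number field. There exists a Zariski-dense subset of $F$-rational points in $V=H^0(\mathbb{P}^1,\mathcal{O}_{\mathbb{P}^1}(8))\times H^0(\mathbb{P}^1,\mathcal{O}_{\mathbb{P}^1}(12))$ such that every point of the subset corresponds to an elliptic K3 surface over $F$ having $24$ nodal rational curves as singular fibers, and each of these $24$ nodal rational curves is defined over a degree $24$ non-Galois field extension of $F$.
   Context: $V$ is regarded as an affine space over $F$. A point $(A,B)\in V(F)$ corresponds to the elliptic surface over $\mathbb{P}^1$ with Weierstrass equation $y^2z=x^3+Axz^2+Bz^3$. For generic $(A,B)$ this is an elliptic K3 surface with section and the discriminant $4A^3+27B^2\in H^0(\mathbb{P}^1,\mathcal{O}_{\mathbb{P}^1}(24))$ has $24$ distinct zeros over $\overline{F}$. The fibers over these zeros are the $24$ nodal rational curves (in the linear system of a fiber). The field of definition of the fiber over a zero $t$ is the residue field $F(t)$. *)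

theory Defs
  imports
    "HOL-Library.Poly_Mapping"
    "HOL-Computational_Algebra.Computational_Algebra"
    "HOL-Algebra.Algebraic_Closure_Type"
    "HOL-Algebra.Generated_Fields"
begin

section \<open>Multivariate polynomials\<close>

text \<open>Polynomials in variables indexed by \<open>'v\<close>: finitely supported functions from
  exponent vectors to coefficients, with the convolution product of \<^theory>\<open>HOL-Library.Poly_Mapping\<close>.\<close>

type_synonym ('v, 'a) mpoly = "('v \<Rightarrow>\<^sub>0 nat) \<Rightarrow>\<^sub>0 'a"

definition mvar :: "'v \<Rightarrow> ('v, 'a::comm_ring_1) mpoly" where
  "mvar i = Poly_Mapping.single (Poly_Mapping.single i 1) 1"

definition mconst :: "'a \<Rightarrow> ('v, 'a::comm_ring_1) mpoly" where
  "mconst c = Poly_Mapping.single 0 c"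

definition meval :: "('v \<Rightarrow> 'a::comm_ring_1) \<Rightarrow> ('v, 'a) mpoly \<Rightarrow> 'a" where
  "meval p P = (\<Sum>m\<in>Poly_Mapping.keys P. Poly_Mapping.lookup P m *
     (\<Prod>i\<in>Poly_Mapping.keys m. p i ^ Poly_Mapping.lookup m i))"

text \<open>Formal partial derivative. The truncated subtraction of exponents is harmless, since the
  coefficient vanishes when the exponent of \<open>i\<close> is zero.\<close>

definition mpderiv :: "'v \<Rightarrow> ('v, 'a::comm_ring_1) mpoly \<Rightarrow> ('v, 'a) mpoly" where
  "mpderiv i P = (\<Sum>m\<in>Poly_Mapping.keys P.
     Poly_Mapping.single (m - Poly_Mapping.single i 1)
       (of_nat (Poly_Mapping.lookup m i) * Poly_Mapping.lookup P m))"

definition mvars :: "('v, 'a::zero) mpoly \<Rightarrow> 'v set" where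
  "mvars P = (\<Union>m\<in>Poly_Mapping.keys P. Poly_Mapping.keys m)"

definition proj_class :: "('v \<Rightarrow> 'a::field) \<Rightarrow> ('v \<Rightarrow> 'a) set" where
  "proj_class p = {(\<lambda>i. c * p i) | c. c \<noteq> 0}"


section \<open>Field extensions\<close>

definition number_field :: "'f::field_char_0 itself \<Rightarrow> bool" where
  "number_field _ \<longleftrightarrow>
     (\<exists>B::'f set. finite B \<and> module.span (\<lambda>(q::rat) x. of_rat q * x) B = UNIV)"

text \<open>Subextensions of the algebraic closure of \<open>'f\<close>, over (the image of) \<open>'f\<close>.\<close>

definition adjoin :: "'f::field alg_closure set \<Rightarrow> 'f alg_closure set" where
  "adjoin S = generate_field ring_of_type_algebra (range to_ac \<union> S)"

definition ext_degree :: "'f::field alg_closure set \<Rightarrow> nat" where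
  "ext_degree E = vector_space.dim (\<lambda>(c::'f) x. to_ac c * x) E"

text \<open>Normal and separable: an irreducible polynomial over the base field with a root in \<open>E\<close> is,
  up to a constant, a product of pairwise distinct linear factors over \<open>E\<close>.\<close>

definition galois_ext :: "'f::field alg_closure set \<Rightarrow> bool" where
  "galois_ext E \<longleftrightarrow>
     (\<forall>p::'f poly. irreducible p \<and> (\<exists>\<alpha>\<in>E. poly (map_poly to_ac p) \<alpha> = 0) \<longrightarrow>
        (\<exists>R. finite R \<and> R \<subseteq> E \<and>
           map_poly to_ac p = smult (to_ac (lead_coeff p)) (\<Prod>r\<in>R. [:- r, 1:])))"


section \<open>Plane curves\<close>

text \<open>In this section \<open>g\<close> is a homogeneous polynomial over an algebraically closed field,
  regarded as the plane curve \<open>g = 0\<close>.\<close>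

datatype pvar = pX | pY | pZ

definition curve_point :: "(pvar, 'k::field) mpoly \<Rightarrow> (pvar \<Rightarrow> 'k) \<Rightarrow> bool" where
  "curve_point g p \<longleftrightarrow> (\<exists>i. p i \<noteq> 0) \<and> meval p g = 0"

definition singular_point :: "(pvar, 'k::field) mpoly \<Rightarrow> (pvar \<Rightarrow> 'k) \<Rightarrow> bool" where
  "singular_point g p \<longleftrightarrow> curve_point g p \<and> (\<forall>i. meval p (mpderiv i g) = 0)"

text \<open>A singular point is a node (ordinary double point) if its tangent cone, given by the second
  order part of \<open>g\<close> at \<open>p\<close>, is a pair of distinct lines.\<close>

definition node :: "(pvar, 'k::field) mpoly \<Rightarrow> (pvar \<Rightarrow> 'k) \<Rightarrow> bool" where
  "node g p \<longleftrightarrow> singular_point g p \<and>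
     (\<exists>l1 l2 :: pvar \<Rightarrow> 'k.
        (\<forall>c d. (\<forall>i. c * l1 i + d * l2 i = 0) \<longrightarrow> c = 0 \<and> d = 0) \<and>
        (\<forall>v. (\<Sum>i\<in>UNIV. \<Sum>j\<in>UNIV. meval p (mpderiv i (mpderiv j g)) * v i * v j)
              = (\<Sum>i\<in>UNIV. l1 i * v i) * (\<Sum>i\<in>UNIV. l2 i * v i)))"

text \<open>Birational to the projective line: a parametrization
  \<open>\<phi>\<close> by polynomials in the affine parameter \<open>u\<close>, and a rational function \<open>P/Q\<close> on the plane
  (\<open>P\<close> and \<open>Q\<close> homogeneous of the same degree), that are inverse to each other
  away from finitely many points on both sides.\<close>

definition rational_curve :: "(pvar, 'k::field) mpoly \<Rightarrow> bool" where
  "rational_curve g \<longleftrightarrow>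
     (\<exists>(\<phi> :: pvar \<Rightarrow> 'k poly) P Q d.
        (\<forall>m \<in> Poly_Mapping.keys P \<union> Poly_Mapping.keys Q.
            (\<Sum>i\<in>UNIV. Poly_Mapping.lookup m i) = d) \<and>
        finite {u. \<not> (let q = (\<lambda>i. poly (\<phi> i) u) in
                        curve_point g q \<and> meval q Q \<noteq> 0 \<and> meval q P / meval q Q = u)} \<and>
        finite {proj_class q | q. curve_point g q \<and>
                  \<not> (meval q Q \<noteq> 0 \<and>
                     (\<lambda>i. poly (\<phi> i) (meval q P / meval q Q)) \<in> proj_class q)})"

definition nodal_rational_curve :: "(pvar, 'k::field) mpoly \<Rightarrow> bool" where
  "nodal_rational_curve g \<longleftrightarrow>
     irreducible g \<and> rational_curve g \<and>
     (\<exists>p. singular_point g p) \<and> (\<forall>p. singular_point g p \<longrightarrow> node g p)"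


section \<open>Weierstrass surfaces\<close>

text \<open>The surface \<open>y\<^sup>2z = x\<^sup>3 + A(s,t)xz\<^sup>2 + B(s,t)z\<^sup>3\<close> lies in the bundle of projective planes
  \<open>\<bbbP>(\<O>(4) \<oplus> \<O>(6) \<oplus> \<O>)\<close> over the projective line, with fiber coordinates \<open>x\<close>, \<open>y\<close>, \<open>z\<close>. This
  is a smooth projective toric variety: it is the quotient of
  \<open>{(s,t) \<noteq> 0, (x,y,z) \<noteq> 0}\<close> by the free action of the torus
  \<open>(\<lambda>,\<mu>)\<cdot>(s,t,x,y,z) = (\<lambda>s, \<lambda>t, \<lambda>\<^sup>4\<mu>x, \<lambda>\<^sup>6\<mu>y, \<mu>z)\<close>, and its homogeneous coordinate ring is the
  polynomial ring in \<open>s,t,x,y,z\<close> with the bigrading \<open>bidegree\<close> below.\<close>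

datatype svar = cS | cT | cX | cY | cZ

definition bidegree :: "(svar \<Rightarrow>\<^sub>0 nat) \<Rightarrow> nat \<times> nat" where
  "bidegree m = (let e = Poly_Mapping.lookup m in
     (e cS + e cT + 4 * e cX + 6 * e cY, e cX + e cY + e cZ))"

definition bihomogeneous :: "nat \<times> nat \<Rightarrow> (svar, 'k::zero) mpoly \<Rightarrow> bool" where
  "bihomogeneous d P \<longleftrightarrow> (\<forall>m\<in>Poly_Mapping.keys P. bidegree m = d)"

text \<open>Global sections of \<open>\<O>(n)\<close> on the projective line: binary forms of degree \<open>n\<close> in \<open>s\<close>, \<open>t\<close>.\<close>

definition sections :: "nat \<Rightarrow> (svar, 'k::zero) mpoly set" where
  "sections n = {A. \<forall>m\<in>Poly_Mapping.keys A. Poly_Mapping.keys m \<subseteq> {cS, cT} \<and>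
                      Poly_Mapping.lookup m cS + Poly_Mapping.lookup m cT = n}"

definition weierstrass ::
    "(svar, 'k::comm_ring_1) mpoly \<Rightarrow> (svar, 'k) mpoly \<Rightarrow> (svar, 'k) mpoly" where
  "weierstrass A B =
     mvar cY ^ 2 * mvar cZ - (mvar cX ^ 3 + A * mvar cX * mvar cZ ^ 2 + B * mvar cZ ^ 3)"

text \<open>Points of the torus-invariant cone over the surface \<open>G = 0\<close>, where \<open>G\<close> is a Weierstrass
  polynomial.\<close>

definition cone :: "(svar, 'k::field) mpoly \<Rightarrow> (svar \<Rightarrow> 'k) set" where
  "cone G = {p. (p cS \<noteq> 0 \<or> p cT \<noteq> 0) \<and> (p cX \<noteq> 0 \<or> p cY \<noteq> 0 \<or> p cZ \<noteq> 0) \<and> meval p G = 0}"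

text \<open>The cone is open in an affine hypersurface and is a torus bundle over the surface, so
  the Jacobian criterion on the cone decides smoothness of the surface.\<close>

definition smooth_surface :: "(svar, 'k::field) mpoly \<Rightarrow> bool" where
  "smooth_surface G \<longleftrightarrow> (\<forall>p\<in>cone G. \<exists>i. meval p (mpderiv i G) \<noteq> 0)"

definition irreducible_surface :: "(svar, 'k::field) mpoly \<Rightarrow> bool" where
  "irreducible_surface G \<longleftrightarrow> cone G \<noteq> {} \<and>
     (\<forall>P Q d e. bihomogeneous d P \<and> bihomogeneous e Q \<and>
        (\<forall>p\<in>cone G. meval p P * meval p Q = 0) \<longrightarrow>
        (\<forall>p\<in>cone G. meval p P = 0) \<or> (\<forall>p\<in>cone G. meval p Q = 0))"


subsection \<open>Regular functions and the first cohomology of the structure sheaf\<close>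

text \<open>For a monomial \<open>m\<close> let \<open>D(m)\<close> be the locus \<open>m \<noteq> 0\<close>. Pairs \<open>(P, Q)\<close> stand
  for fractions \<open>P/Q\<close> of degree zero whose denominator is a power of \<open>m\<close>.\<close>

definition fractions :: "(svar \<Rightarrow>\<^sub>0 nat) \<Rightarrow> ((svar, 'k::field) mpoly \<times> (svar, 'k) mpoly) set" where
  "fractions m = {(P, Poly_Mapping.single m 1 ^ k) | P k.
     bihomogeneous (k * fst (bidegree m), k * snd (bidegree m)) P}"

definition frac_eval :: "(svar, 'k::field) mpoly \<times> (svar, 'k) mpoly \<Rightarrow> (svar \<Rightarrow> 'k) \<Rightarrow> 'k" where
  "frac_eval f p = meval p (fst f) / meval p (snd f)"

definition locus :: "(svar, 'k::field) mpoly \<Rightarrow> (svar \<Rightarrow>\<^sub>0 nat) \<Rightarrow> (svar \<Rightarrow> 'k) set" where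
  "locus G m = {p\<in>cone G. meval p (Poly_Mapping.single m 1) \<noteq> 0}"

definition regular_on ::
    "(svar, 'k::field) mpoly \<Rightarrow> (svar \<Rightarrow>\<^sub>0 nat) \<Rightarrow> ((svar \<Rightarrow> 'k) \<Rightarrow> 'k) \<Rightarrow> bool" where
  "regular_on G m f \<longleftrightarrow> (\<exists>r\<in>fractions m. \<forall>p\<in>locus G m. f p = frac_eval r p)"

text \<open>The loci \<open>sz \<noteq> 0\<close>, \<open>tz \<noteq> 0\<close>, \<open>sy \<noteq> 0\<close>, \<open>ty \<noteq> 0\<close> form an affine open cover of a Weierstrass
  surface (\<open>y = z = 0\<close> would force \<open>x = 0\<close>), and \<open>D(m) \<inter> D(n) = D(m + n)\<close> in
  terms of exponent vectors.\<close>

definition charts :: "(svar \<Rightarrow>\<^sub>0 nat) set" where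
  "charts = {Poly_Mapping.single i 1 + Poly_Mapping.single j 1 | i j. i \<in> {cS, cT} \<and> j \<in> {cZ, cY}}"

text \<open>\<open>H\<^sup>1(X, \<O>\<^sub>X) = 0\<close>: every Cech 1-cocycle with respect to this affine cover is a coboundary.\<close>

definition H1_structure_sheaf_vanishes :: "(svar, 'k::field) mpoly \<Rightarrow> bool" where
  "H1_structure_sheaf_vanishes G \<longleftrightarrow>
     (\<forall>g. (\<forall>a\<in>charts. \<forall>b\<in>charts. regular_on G (a + b) (g a b)) \<and>
          (\<forall>a\<in>charts. \<forall>b\<in>charts. \<forall>c\<in>charts. \<forall>p\<in>locus G (a + b + c).
              g a c p = g a b p + g b c p) \<longrightarrow>
        (\<exists>h. (\<forall>a\<in>charts. regular_on G a (h a)) \<and>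
             (\<forall>a\<in>charts. \<forall>b\<in>charts. \<forall>p\<in>locus G (a + b). g a b p = h b p - h a p)))"


subsection \<open>Regular 2-forms\<close>

definition dir_deriv :: "(svar, 'k::field) mpoly \<Rightarrow> (svar \<Rightarrow> 'k) \<Rightarrow> (svar \<Rightarrow> 'k) \<Rightarrow> 'k" where
  "dir_deriv P p u = (\<Sum>i\<in>UNIV. meval p (mpderiv i P) * u i)"

definition frac_diff ::
    "(svar, 'k::field) mpoly \<times> (svar, 'k) mpoly \<Rightarrow> (svar \<Rightarrow> 'k) \<Rightarrow> (svar \<Rightarrow> 'k) \<Rightarrow> 'k" where
  "frac_diff f p u =
     (dir_deriv (fst f) p u * meval p (snd f) - meval p (fst f) * dir_deriv (snd f) p u)
       / (meval p (snd f)) ^ 2"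

definition tangent :: "(svar, 'k::field) mpoly \<Rightarrow> (svar \<Rightarrow> 'k) \<Rightarrow> (svar \<Rightarrow> 'k) set" where
  "tangent G p = {u. dir_deriv G p u = 0}"

text \<open>On a smooth surface a 2-form is represented by its values on pairs of tangent vectors
  of the cone. On each affine chart it must be a finite sum of terms \<open>f dg \<and> dh\<close> with \<open>f\<close>, \<open>g\<close>, \<open>h\<close>
  regular. Such forms are torus-invariant and kill the tangent vectors along the orbits, so
  they are exactly the regular 2-forms of the surface.\<close>

definition regular_2form ::
    "(svar, 'k::field) mpoly \<Rightarrow> ((svar \<Rightarrow> 'k) \<Rightarrow> (svar \<Rightarrow> 'k) \<Rightarrow> (svar \<Rightarrow> 'k) \<Rightarrow> 'k) \<Rightarrow> bool" where
  "regular_2form G \<omega> \<longleftrightarrow>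
     (\<forall>a\<in>charts. \<exists>L. set L \<subseteq> fractions a \<times> fractions a \<times> fractions a \<and>
        (\<forall>p\<in>locus G a. \<forall>u\<in>tangent G p. \<forall>v\<in>tangent G p.
           \<omega> p u v = (\<Sum>(f, g, h)\<leftarrow>L. frac_eval f p *
              (frac_diff g p u * frac_diff h p v - frac_diff g p v * frac_diff h p u))))"

definition canonical_bundle_trivial :: "(svar, 'k::field) mpoly \<Rightarrow> bool" where
  "canonical_bundle_trivial G \<longleftrightarrow>
     (\<exists>\<omega>. regular_2form G \<omega> \<and> (\<forall>p\<in>cone G. \<exists>u\<in>tangent G p. \<exists>v\<in>tangent G p. \<omega> p u v \<noteq> 0))"

text \<open>The surface is projective by construction.\<close>

definition K3_surface :: "(svar, 'k::field) mpoly \<Rightarrow> bool" where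
  "K3_surface G \<longleftrightarrow> smooth_surface G \<and> irreducible_surface G \<and>
     canonical_bundle_trivial G \<and> H1_structure_sheaf_vanishes G"


subsection \<open>The elliptic fibration\<close>

text \<open>The point \<open>(a : b)\<close> of the projective line, and the fiber over it as a plane cubic. Another
  choice of homogeneous coordinates gives an isomorphic cubic.\<close>

definition st_point :: "'k \<Rightarrow> 'k \<Rightarrow> svar \<Rightarrow> 'k::zero" where
  "st_point a b = (\<lambda>_. 0)(cS := a, cT := b)"

definition fiber ::
    "(svar, 'k::field) mpoly \<Rightarrow> (svar, 'k) mpoly \<Rightarrow> 'k \<Rightarrow> 'k \<Rightarrow> (pvar, 'k) mpoly" where
  "fiber A B a b =
     mvar pY ^ 2 * mvar pZ -
       (mvar pX ^ 3 + mconst (meval (st_point a b) A) * mvar pX * mvar pZ ^ 2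
          + mconst (meval (st_point a b) B) * mvar pZ ^ 3)"

definition singular_fiber_at :: "(svar, 'k::field) mpoly \<Rightarrow> (svar, 'k) mpoly \<Rightarrow> 'k \<Rightarrow> 'k \<Rightarrow> bool" where
  "singular_fiber_at A B a b \<longleftrightarrow> (a \<noteq> 0 \<or> b \<noteq> 0) \<and> (\<exists>p. singular_point (fiber A B a b) p)"

definition singular_fiber_points ::
    "(svar, 'k::field) mpoly \<Rightarrow> (svar, 'k) mpoly \<Rightarrow> (svar \<Rightarrow> 'k) set set" where
  "singular_fiber_points A B = {proj_class (st_point a b) | a b. singular_fiber_at A B a b}"

text \<open>All but finitely many fibers are smooth plane cubics; the section is \<open>(0 : 1 : 0)\<close>.\<close>

definition elliptic_K3 :: "(svar, 'k::field) mpoly \<Rightarrow> (svar, 'k) mpoly \<Rightarrow> bool" where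
  "elliptic_K3 A B \<longleftrightarrow> K3_surface (weierstrass A B) \<and> finite (singular_fiber_points A B)"


section \<open>Rational points of the parameter space\<close>

text \<open>The \<open>F\<close>-points of \<open>V = H\<^sup>0(\<O>(8)) \<times> H\<^sup>0(\<O>(12))\<close>, an affine space of dimension 22 with
  coordinates the coefficients of the two forms.\<close>

definition V :: "((svar, 'f::field) mpoly \<times> (svar, 'f) mpoly) set" where
  "V = sections 8 \<times> sections 12"

definition form_coeff :: "nat \<Rightarrow> (svar, 'f::zero) mpoly \<Rightarrow> nat \<Rightarrow> 'f" where
  "form_coeff n A i =
     Poly_Mapping.lookup A (Poly_Mapping.single cS (n - i) + Poly_Mapping.single cT i)"

definition V_coordinates :: "(svar, 'f::field) mpoly \<times> (svar, 'f) mpoly \<Rightarrow> nat + nat \<Rightarrow> 'f" where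
  "V_coordinates AB = case_sum (form_coeff 8 (fst AB)) (form_coeff 12 (snd AB))"

text \<open>A set of \<open>F\<close>-points is Zariski-dense in the affine space \<open>V\<close> iff the only
  polynomial in the coordinate ring \<open>F[V]\<close> vanishing on it is the zero polynomial.\<close>

definition zariski_dense_in_V :: "((svar, 'f::field) mpoly \<times> (svar, 'f) mpoly) set \<Rightarrow> bool" where
  "zariski_dense_in_V T \<longleftrightarrow>
     (\<forall>\<Phi> :: (nat + nat, 'f) mpoly. mvars \<Phi> \<subseteq> Inl ` {..8} \<union> Inr ` {..12} \<and>
        (\<forall>AB\<in>T. meval (V_coordinates AB) \<Phi> = 0) \<longrightarrow> \<Phi> = 0)"

text \<open>Base change to the algebraic closure. A surface over \<open>F\<close> is a K3 surface iff its base change is: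
  geometric integrality is part of the definition, and smoothness, triviality of the
  canonical bundle and the dimension of \<open>H\<^sup>1(\<O>)\<close> are invariant under field extension.\<close>

definition base_change :: "('v, 'f::field) mpoly \<Rightarrow> ('v, 'f alg_closure) mpoly" where
  "base_change = Poly_Mapping.map to_ac"

text \<open>Residue field of the (closed point underlying the) geometric point \<open>(a : b)\<close>. Division by zero
  contributes only \<open>0\<close>.\<close>

definition residue_field :: "'f::field alg_closure \<Rightarrow> 'f alg_closure \<Rightarrow> 'f alg_closure set" where
  "residue_field a b = adjoin {a / b, b / a}"

end

theory Submission
  imports Defs
begin

text \<open>
The arithmetic rests on wild ramification at 2. Choose a valuation \<open>v\<close> above 2 on the algebraic closure of
\<open>F\<close>, normalized so that a uniformizer \<open>\<pi>\<close> of \<open>F\<close> has value 1. If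
\<open>4A \<equiv> -3 + \<pi>(1 + x)\<close> and \<open>4B \<equiv> 1 + x\<^bsup>12\<^esup>\<close> modulo \<open>\<pi>\<^sup>2\<close>, then \<open>16(4A\<^sup>3 + 27B\<^sup>2) = (4A)\<^sup>3 + 27(4B)\<^sup>2\<close> is congruent to
\<open>27x\<^bsup>24\<^esup> + 54x\<^bsup>12\<^esup> + 27\<pi>(1 + x)\<close>. This is an Eisenstein polynomial of degree 24, so a root \<open>\<alpha>\<close> has
\<open>v(\<alpha>) = 1/24\<close>, generates an extension of degree 24, and all values of that extension lie in \<open>(1/24)\<int>\<close>. The
derivative of the polynomial at \<open>\<alpha>\<close> has value 1, because of the linear coefficient. If the extension were Galois it
would contain all the differences of roots. Each of them has value at least \<open>1/24\<close>, and less than \<open>2/24\<close>, because a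
closer root would make the linear term dominate the Taylor expansion at \<open>\<alpha>\<close> (\<open>roots_not_close\<close>). So each
difference would have value \<open>1/24\<close>, and the derivative, a unit times a product of 23 of them, would have value
\<open>23/24\<close> (\<open>not_galois_residue_field\<close>). The existence of a discrete \<open>v\<close> is \<open>dyadic_valuation_exists\<close>: a subring
of the algebraic closure that is maximal among those without \<open>1/2\<close> is a valuation ring, and algebraic relations
of bounded degree over \<open>\<rat>\<close> bound the denominators of the values on \<open>F\<close>.

The congruences let every coefficient of \<open>A\<close> and \<open>B\<close> run independently through an infinite set. A polynomial
vanishing on a product of infinite sets is zero, so these pairs are Zariski-dense (\<open>zariski_dense_family\<close>).

The geometry rests on the 24 simple zeros of the discriminant, through one identity: the
discriminant and its derivative generate the unit ideal, and both lie in the ideal generated by the equation of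
the surface and its partial derivatives (\<open>affine_unit\<close>, and \<open>infinity_unit\<close> near the section). This gives
smoothness, and it also writes the Poincare residue of \<open>dt dx dy / G\<close>, where \<open>G\<close> is the Weierstrass polynomial, as a
sum of regular forms \<open>f dg \<and> dh\<close>; that residue is the nowhere vanishing 2-form. Irreducibility and the vanishing
of the first cohomology come from normal forms: every bihomogeneous function on the surface is given by a unique polynomial of
degree at most two in \<open>x\<close> (\<open>reduce\<close>, \<open>reduced_zero_if_vanishing\<close>), so a Cech cocycle can be split by
distributing monomials. The monomials that cannot be distributed on the fibers form sections of \<open>\<O>(-2)\<close> on
the base, and there are none (\<open>cocycle_splits\<close>). Finally, a fiber over a simple zero of the discriminant is
\<open>y\<^sup>2z = (x - rz)\<^sup>2(x + 2rz)\<close> with \<open>r \<noteq> 0\<close>, which the lines through the node parametrize.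
\<close>

section \<open>Evaluating multivariate polynomials\<close>

definition monval :: "('v \<Rightarrow> 'b::comm_ring_1) \<Rightarrow> ('v \<Rightarrow>\<^sub>0 nat) \<Rightarrow> 'b" where
  "monval p m = (\<Prod>i\<in>Poly_Mapping.keys m. p i ^ Poly_Mapping.lookup m i)"

text \<open>Evaluation after mapping the coefficients along a ring homomorphism. Ordinary evaluation, restriction to a line and
  the passage to nested univariate polynomials are all of this form.\<close>

definition mev :: "('a::comm_ring_1 \<Rightarrow> 'b::comm_ring_1) \<Rightarrow> ('v \<Rightarrow> 'b) \<Rightarrow> ('v, 'a) mpoly \<Rightarrow> 'b" where
  "mev \<phi> p P = (\<Sum>m\<in>Poly_Mapping.keys P. \<phi> (Poly_Mapping.lookup P m) * monval p m)"

lemma meval_eq_mev: "meval p = mev (\<lambda>c. c) p"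
  by (rule ext) (simp add: meval_def mev_def monval_def)

lemma monval_superset:
  assumes "finite S" "Poly_Mapping.keys m \<subseteq> S"
  shows "monval p m = (\<Prod>i\<in>S. p i ^ Poly_Mapping.lookup m i)"
  unfolding monval_def using assms
  by (intro prod.mono_neutral_left) (auto simp: in_keys_iff)

lemma monval_0 [simp]: "monval p 0 = 1"
  by (simp add: monval_def)

lemma monval_add: "monval p (m + n) = monval p m * monval p n"
proof -
  let ?S = "Poly_Mapping.keys m \<union> Poly_Mapping.keys n"
  have "Poly_Mapping.keys (m + n) \<subseteq> ?S" by (rule keys_add)
  then show ?thesis
    by (subst (1 2 3) monval_superset[of ?S])
       (auto simp: lookup_add power_add prod.distrib)
qed

lemma monval_single [simp]: "monval p (Poly_Mapping.single i n) = p i ^ n"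
  by (subst monval_superset[of "{i}"]) auto

lemma monval_fun_upd:
  "monval (p(v := a)) m = a ^ Poly_Mapping.lookup m v * monval (p(v := 1)) m"
proof -
  let ?S = "insert v (Poly_Mapping.keys m)"
  have *: "monval (p(v := c)) m = c ^ Poly_Mapping.lookup m v *
      (\<Prod>i\<in>Poly_Mapping.keys m - {v}. p i ^ Poly_Mapping.lookup m i)" for c
    by (subst monval_superset[of ?S])
       (auto simp: prod.insert_remove intro!: arg_cong2[of _ _ _ _ "(*)"] prod.cong)
  show ?thesis by (simp add: *[of a] *[of 1])
qed

lemma mpoly_expand:
  fixes P :: "('v, 'a::comm_monoid_add) mpoly"
  shows "P = (\<Sum>m\<in>Poly_Mapping.keys P. Poly_Mapping.single m (Poly_Mapping.lookup P m))"
  by (rule poly_mapping_eqI)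
     (auto simp: lookup_sum lookup_single when_def not_in_keys_iff_lookup_eq_zero sum.delta)

lemma mpoly_induct [case_names single add]:
  fixes P :: "('v, 'a::comm_monoid_add) mpoly"
  assumes "\<And>m c. R (Poly_Mapping.single m c)" "\<And>P Q. R P \<Longrightarrow> R Q \<Longrightarrow> R (P + Q)"
  shows "R P"
proof -
  have "R (\<Sum>m\<in>S. Poly_Mapping.single m (Poly_Mapping.lookup P m))" if "finite S" for S
    using that
  proof induction
    case empty
    then show ?case using assms(1)[of 0 0] by simp
  qed (auto intro: assms)
  then show ?thesis by (subst mpoly_expand) simp
qed

locale coeff_hom =
  fixes \<phi> :: "'a::comm_ring_1 \<Rightarrow> 'b::comm_ring_1"
  assumes hom_add: "\<phi> (x + y) = \<phi> x + \<phi> y"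
    and hom_mult: "\<phi> (x * y) = \<phi> x * \<phi> y"
    and hom_1: "\<phi> 1 = 1"
begin

lemma hom_0: "\<phi> 0 = 0"
  using hom_add[of 0 0] by simp

lemma mev_superset:
  assumes "finite S" "Poly_Mapping.keys P \<subseteq> S"
  shows "mev \<phi> p P = (\<Sum>m\<in>S. \<phi> (Poly_Mapping.lookup P m) * monval p m)"
  unfolding mev_def using assms
  by (intro sum.mono_neutral_left) (auto simp: in_keys_iff hom_0)

lemma mev_0: "mev \<phi> p 0 = 0"
  by (simp add: mev_def)

lemma mev_single: "mev \<phi> p (Poly_Mapping.single m c) = \<phi> c * monval p m"
  by (subst mev_superset[of "{m}"]) auto

lemma mev_add: "mev \<phi> p (P + Q) = mev \<phi> p P + mev \<phi> p Q"
proof -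
  let ?S = "Poly_Mapping.keys P \<union> Poly_Mapping.keys Q"
  have "Poly_Mapping.keys (P + Q) \<subseteq> ?S" by (rule keys_add)
  then show ?thesis
    by (subst (1 2 3) mev_superset[of ?S])
       (auto simp: lookup_add hom_add distrib_right sum.distrib)
qed

lemma mev_uminus: "mev \<phi> p (- P) = - mev \<phi> p P"
  using mev_add[of p P "- P"] by (simp add: mev_0 eq_neg_iff_add_eq_0 add.commute)

lemma mev_diff: "mev \<phi> p (P - Q) = mev \<phi> p P - mev \<phi> p Q"
  using mev_add[of p P "- Q"] by (simp add: mev_uminus)

lemma mev_1: "mev \<phi> p 1 = 1"
  using mev_single[of p 0 1] by (simp add: hom_1)

lemma mev_mult: "mev \<phi> p (P * Q) = mev \<phi> p P * mev \<phi> p Q"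
proof (induction P rule: mpoly_induct)
  case (single m c)
  show ?case
  proof (induction Q rule: mpoly_induct)
    case (single n d)
    then show ?case by (simp add: mult_single mev_single hom_mult monval_add ac_simps)
  qed (simp add: distrib_left mev_add)
qed (simp add: distrib_right mev_add)

lemma mev_power: "mev \<phi> p (P ^ n) = mev \<phi> p P ^ n"
  by (induction n) (simp_all add: mev_1 mev_mult)

lemma mev_sum: "mev \<phi> p (sum f S) = (\<Sum>x\<in>S. mev \<phi> p (f x))"
  by (induction S rule: infinite_finite_induct) (simp_all add: mev_0 mev_add)

lemma mev_mvar: "mev \<phi> p (mvar i) = p i"
  by (simp add: mvar_def mev_single hom_1)

lemma mev_mconst: "mev \<phi> p (mconst c) = \<phi> c"
  by (simp add: mconst_def mev_single)

lemmas mev_simps = mev_0 mev_1 mev_single mev_add mev_uminus mev_diff mev_mult mev_power mev_mvar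
  mev_mconst

lemma hom_sum: "\<phi> (sum f S) = (\<Sum>x\<in>S. \<phi> (f x))"
  by (induction S rule: infinite_finite_induct) (simp_all add: hom_0 hom_add)

lemma hom_power: "\<phi> (x ^ n) = \<phi> x ^ n"
  by (induction n) (simp_all add: hom_1 hom_mult)

lemma hom_prod: "\<phi> (prod f S) = (\<Prod>x\<in>S. \<phi> (f x))"
  by (induction S rule: infinite_finite_induct) (simp_all add: hom_1 hom_mult)

lemma hom_mev: "\<phi> (mev \<psi> p P) = mev (\<lambda>c. \<phi> (\<psi> c)) (\<lambda>i. \<phi> (p i)) P"
  by (simp add: mev_def monval_def hom_sum hom_mult hom_prod hom_power)

end

interpretation id_hom: coeff_hom "\<lambda>c. c"
  by unfold_locales auto

interpretation pconst_hom: coeff_hom "\<lambda>c. [:c:]"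
  by unfold_locales (auto simp: one_pCons)

interpretation peval_hom: coeff_hom "\<lambda>P. poly P a" for a
  by unfold_locales auto

lemmas meval_simps = id_hom.mev_simps[folded meval_eq_mev]
lemmas meval_sum = id_hom.mev_sum[folded meval_eq_mev]

text \<open>The restriction of a polynomial to a line parallel to a coordinate axis. Most facts
  about vanishing below reduce along such lines to univariate polynomials having finitely many roots.\<close>

definition line :: "('v \<Rightarrow> 'a::comm_ring_1) \<Rightarrow> 'v \<Rightarrow> ('v, 'a) mpoly \<Rightarrow> 'a poly" where
  "line p v = mev (\<lambda>c. [:c:]) (\<lambda>i. if i = v then [:0, 1:] else [:p i:])"

lemma poly_line [simp]: "poly (line p v P) a = meval (p(v := a)) P"
proof -
  have "poly (line p v P) a = mev (\<lambda>c. poly [:c:] a) (\<lambda>i. poly (if i = v then [:0, 1:] else [:p i:]) a) P"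
    unfolding line_def by (rule peval_hom.hom_mev)
  also have "(\<lambda>i. poly (if i = v then [:0, 1:] else [:p i:]) a) = p(v := a)" by auto
  finally show ?thesis by (simp add: meval_eq_mev fun_upd_def)
qed

lemma line_monomials:
  "line p v P = (\<Sum>m\<in>Poly_Mapping.keys P.
     monom (Poly_Mapping.lookup P m * monval (p(v := 1)) m) (Poly_Mapping.lookup m v))"
proof -
  have "monval (\<lambda>i. if i = v then [:0, 1:] else [:p i:]) m = [:monval (p(v := 1)) m:] * monom 1 (Poly_Mapping.lookup m v)"
    for m
  proof -
    have "monval (\<lambda>i. if i = v then [:0, 1:] else [:p i:]) m = monval ((\<lambda>i. [:p i:])(v := [:0, 1:])) m"
      by (rule arg_cong[of _ _ "\<lambda>f. monval f m"]) auto
    also have "\<dots> = [:0, 1:] ^ Poly_Mapping.lookup m v * monval ((\<lambda>i. [:p i:])(v := 1)) m"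
      by (rule monval_fun_upd)
    also have "(\<lambda>i. [:p i:])(v := 1) = (\<lambda>i. [:(p(v := 1)) i:])" by (auto simp: one_pCons)
    also have "monval \<dots> m = [:monval (p(v := 1)) m:]"
      by (simp add: monval_def pconst_hom.hom_prod pconst_hom.hom_power)
    finally show ?thesis by (simp add: monom_altdef mult.commute)
  qed
  then show ?thesis
    by (simp add: line_def mev_def smult_monom)
qed

lemma degree_line_le:
  assumes "\<And>m. m \<in> Poly_Mapping.keys P \<Longrightarrow> Poly_Mapping.lookup m v \<le> d"
  shows "Polynomial.degree (line p v P) \<le> d"
  unfolding line_monomials
  by (rule degree_sum_le) (auto intro: order.trans[OF degree_monom_le] assms)

lemma meval_zero_on_line:
  fixes P :: "('v, 'a::idom) mpoly"
  assumes "infinite S" "\<And>a. a \<in> S \<Longrightarrow> meval (p(v := a)) P = 0"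
  shows "meval p P = 0"
proof -
  have "S \<subseteq> {a. poly (line p v P) a = 0}" using assms(2) by auto
  then have "line p v P = 0"
    using assms(1) by (metis finite_subset poly_roots_finite)
  then have "poly (line p v P) (p v) = 0" by simp
  then show ?thesis by simp
qed

lemma meval_zero_on_grid:
  fixes P :: "('v, 'a::idom) mpoly"
  assumes "finite W" "\<And>i. i \<in> W \<Longrightarrow> infinite (S i)"
    and "\<And>p. (\<And>i. i \<in> W \<Longrightarrow> p i \<in> S i) \<Longrightarrow> meval p P = 0"
  shows "meval p P = 0"
  using assms
proof (induction W arbitrary: p rule: finite_induct)
  case (insert v W)
  show ?case
  proof (rule insert.IH)
    fix p assume p: "\<And>i. i \<in> W \<Longrightarrow> p i \<in> S i"
    show "meval p P = 0"
    proof (rule meval_zero_on_line[of "S v" p v])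
      fix a assume "a \<in> S v"
      then show "meval (p(v := a)) P = 0"
        using p by (intro insert.prems(2)) auto
    qed (use insert.prems in auto)
  qed (use insert.prems in auto)
qed auto

text \<open>The coefficient, a polynomial in the other variables, of the \<open>k\<close>-th power of the variable \<open>v\<close>.\<close>

definition slice :: "'v \<Rightarrow> nat \<Rightarrow> ('v, 'a::comm_ring_1) mpoly \<Rightarrow> ('v, 'a) mpoly" where
  "slice v k P = (\<Sum>m\<in>{m\<in>Poly_Mapping.keys P. Poly_Mapping.lookup m v = k}.
     Poly_Mapping.single (m - Poly_Mapping.single v k) (Poly_Mapping.lookup P m))"

lemma minus_single_add:
  assumes "Poly_Mapping.lookup m v \<ge> k"
  shows "(m - Poly_Mapping.single v k) + Poly_Mapping.single v k = (m :: 'v \<Rightarrow>\<^sub>0 nat)"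
  using assms by (intro poly_mapping_eqI) (auto simp: lookup_add lookup_minus lookup_single when_def)

lemma meval_slice: "meval p (slice v k P) = coeff (line p v P) k"
proof -
  have *: "monval p (m - Poly_Mapping.single v (Poly_Mapping.lookup m v)) = monval (p(v := 1)) m" for m
  proof -
    let ?n = "m - Poly_Mapping.single v (Poly_Mapping.lookup m v)"
    have "monval (p(v := 1)) m = monval (p(v := 1)) (?n + Poly_Mapping.single v (Poly_Mapping.lookup m v))"
      by (subst minus_single_add) auto
    also have "\<dots> = monval (p(v := 1)) ?n" by (simp add: monval_add)
    also have "monval p ?n = monval (p(v := p v)) ?n" by simp
    then have "monval p ?n = monval (p(v := 1)) ?n"
      by (subst (asm) monval_fun_upd) (simp add: lookup_minus)
    finally show ?thesis by simp
  qed
  have "meval p (slice v k P) = (\<Sum>m\<in>{m\<in>Poly_Mapping.keys P. Poly_Mapping.lookup m v = k}.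
          Poly_Mapping.lookup P m * monval (p(v := 1)) m)"
    unfolding slice_def meval_sum by (intro sum.cong) (auto simp: meval_simps *)
  also have "\<dots> = coeff (line p v P) k"
    unfolding line_monomials coeff_sum
    by (simp add: sum.inter_filter)
  finally show ?thesis .
qed

lemma lookup_slice:
  "Poly_Mapping.lookup (slice v (Poly_Mapping.lookup m v) P) (m - Poly_Mapping.single v (Poly_Mapping.lookup m v))
     = Poly_Mapping.lookup P m"
proof -
  let ?k = "Poly_Mapping.lookup m v"
  have inj: "n - Poly_Mapping.single v ?k = m - Poly_Mapping.single v ?k \<longleftrightarrow> n = m"
    if "Poly_Mapping.lookup n v = ?k" for n
    using that by (metis minus_single_add order_refl)
  have "Poly_Mapping.lookup (slice v ?k P) (m - Poly_Mapping.single v ?k) =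
      (\<Sum>n\<in>{n\<in>Poly_Mapping.keys P. Poly_Mapping.lookup n v = ?k}. if n = m then Poly_Mapping.lookup P n else 0)"
    unfolding slice_def lookup_sum lookup_single when_def
    by (rule sum.cong) (auto simp: inj)
  also have "\<dots> = Poly_Mapping.lookup P m"
    by (auto simp: sum.delta in_keys_iff)
  finally show ?thesis .
qed

text \<open>Induction on the number of variables: the coefficients with respect to one variable vanish at every point,
  because a univariate polynomial over an infinite domain that vanishes everywhere is zero.\<close>

lemma mpoly_zero_if_meval_zero:
  fixes P :: "('v, 'a::{idom,ring_char_0}) mpoly"
  assumes "\<And>p. meval p P = 0"
  shows "P = 0"
proof -
  have "P = 0" if "finite W" "mvars P \<subseteq> W" "\<And>p. meval p P = 0" for W and P :: "('v, 'a) mpoly"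
    using that
  proof (induction W arbitrary: P rule: finite_induct)
    case empty
    then have "Poly_Mapping.keys P \<subseteq> {0}" by (auto simp: mvars_def)
    then have "P = Poly_Mapping.single 0 (Poly_Mapping.lookup P 0)"
      by (subst mpoly_expand, subst sum.mono_neutral_left[of "{0}"])
         (auto simp: in_keys_iff)
    moreover from this have "meval (\<lambda>_. 0) P = Poly_Mapping.lookup P 0"
      by (metis meval_simps(3) monval_0 mult.right_neutral)
    ultimately show ?case using empty.prems(2) by (metis single_zero)
  next
    case (insert v W)
    have s0: "slice v k P = 0" for k
    proof (rule insert.IH)
      have "Poly_Mapping.keys (slice v k P) \<subseteq>
          (\<Union>m\<in>{m\<in>Poly_Mapping.keys P. Poly_Mapping.lookup m v = k}. {m - Poly_Mapping.single v k})"
        unfolding slice_def by (rule order.trans[OF keys_sum]) (auto split: if_splits)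
      moreover have "Poly_Mapping.keys (m - Poly_Mapping.single v k) \<subseteq> W"
        if "m \<in> Poly_Mapping.keys P" "Poly_Mapping.lookup m v = k" for m
      proof
        fix i assume "i \<in> Poly_Mapping.keys (m - Poly_Mapping.single v k)"
        then have "i \<in> Poly_Mapping.keys m" "i \<noteq> v"
          using that(2) by (auto simp: in_keys_iff lookup_minus lookup_single when_def)
        then show "i \<in> W" using that(1) insert.prems(1) unfolding mvars_def by blast
      qed
      ultimately show "mvars (slice v k P) \<subseteq> W" unfolding mvars_def by blast
      show "meval p (slice v k P) = 0" for p
      proof -
        have "line p v P = 0"
          using insert.prems(2) infinite_UNIV_char_0 poly_roots_finite[of "line p v P"] by auto
        then show ?thesis by (simp add: meval_slice)
      qed
    qed
    show ?case
    proof (rule poly_mapping_eqI)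
      fix m show "Poly_Mapping.lookup P m = Poly_Mapping.lookup 0 m"
        using lookup_slice[of v m P] s0 by simp
    qed
  qed
  moreover have "finite (mvars P)" by (simp add: mvars_def)
  ultimately show ?thesis using assms by blast
qed

section \<open>Formal partial derivatives\<close>

lemma mpderiv_superset:
  assumes "finite S" "Poly_Mapping.keys P \<subseteq> S"
  shows "mpderiv i P = (\<Sum>m\<in>S. Poly_Mapping.single (m - Poly_Mapping.single i 1)
       (of_nat (Poly_Mapping.lookup m i) * Poly_Mapping.lookup P m))"
  unfolding mpderiv_def using assms
  by (intro sum.mono_neutral_left) (auto simp: in_keys_iff)

lemma mpderiv_single:
  "mpderiv i (Poly_Mapping.single m c) =
     Poly_Mapping.single (m - Poly_Mapping.single i 1) (of_nat (Poly_Mapping.lookup m i) * c)"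
  by (subst mpderiv_superset[of "{m}"]) auto

lemma mpderiv_add: "mpderiv i (P + Q) = mpderiv i P + mpderiv i Q"
proof -
  let ?S = "Poly_Mapping.keys P \<union> Poly_Mapping.keys Q"
  have "Poly_Mapping.keys (P + Q) \<subseteq> ?S" by (rule keys_add)
  then show ?thesis
    by (subst (1 2 3) mpderiv_superset[of ?S])
       (auto simp: lookup_add distrib_left sum.distrib single_add)
qed

lemma mpderiv_0 [simp]: "mpderiv i 0 = 0"
  by (simp add: mpderiv_def)

lemma mpderiv_uminus: "mpderiv i (- P) = - mpderiv i P"
  using mpderiv_add[of i P "- P"] by (simp add: eq_neg_iff_add_eq_0 add.commute)

lemma mpderiv_diff: "mpderiv i (P - Q) = mpderiv i P - mpderiv i Q"
  using mpderiv_add[of i P "- Q"] by (simp add: mpderiv_uminus)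

lemma mpderiv_mult: "mpderiv i (P * Q) = mpderiv i P * Q + P * mpderiv i Q"
proof (induction P rule: mpoly_induct)
  case (single m c)
  show ?case
  proof (induction Q rule: mpoly_induct)
    case (single n d)
    let ?e = "Poly_Mapping.single i (1::nat)"
    have shift: "Poly_Mapping.single (k + l - ?e) (of_nat (Poly_Mapping.lookup k i) * a) =
        Poly_Mapping.single (k - ?e + l) (of_nat (Poly_Mapping.lookup k i) * a)" for k l and a :: 'b
    proof (cases "Poly_Mapping.lookup k i = 0")
      case False
      then have "k + l - ?e = k - ?e + l"
        by (intro poly_mapping_eqI) (auto simp: lookup_add lookup_minus lookup_single when_def)
      then show ?thesis by simp
    qed simp
    have "mpderiv i (Poly_Mapping.single m c * Poly_Mapping.single n d) =
       Poly_Mapping.single (m + n - ?e) (of_nat (Poly_Mapping.lookup m i) * (c * d))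
       + Poly_Mapping.single (n + m - ?e) (of_nat (Poly_Mapping.lookup n i) * (c * d))"
      by (simp add: mult_single mpderiv_single lookup_add distrib_right single_add add.commute)
    also have "\<dots> = Poly_Mapping.single (m - ?e + n) (of_nat (Poly_Mapping.lookup m i) * (c * d))
       + Poly_Mapping.single (n - ?e + m) (of_nat (Poly_Mapping.lookup n i) * (c * d))"
      by (simp only: shift)
    finally show ?case
      by (simp add: mult_single mpderiv_single ac_simps)
  qed (simp add: distrib_left mpderiv_add algebra_simps)
qed (simp add: distrib_right mpderiv_add algebra_simps)

lemma mpderiv_mvar: "mpderiv i (mvar j) = (if i = j then 1 else 0)"
  by (auto simp: mvar_def mpderiv_single lookup_single)

lemma mpderiv_mconst: "mpderiv i (mconst c) = 0"
  by (simp add: mconst_def mpderiv_single)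

lemma mpderiv_1 [simp]: "mpderiv i 1 = 0"
  using mpderiv_mconst[of i 1] by (simp add: mconst_def)

lemmas mpderiv_simps = mpderiv_add mpderiv_uminus mpderiv_diff mpderiv_mult mpderiv_mvar mpderiv_mconst

lemma mpderiv_eq_0: "(\<And>m. m \<in> Poly_Mapping.keys P \<Longrightarrow> Poly_Mapping.lookup m i = 0) \<Longrightarrow> mpderiv i P = 0"
  by (simp add: mpderiv_def)

lemma pderiv_line: "poly (pderiv (line p v P)) a = meval (p(v := a)) (mpderiv v P)"
proof (induction P rule: mpoly_induct)
  case (single m c)
  have 1: "line p v (Poly_Mapping.single m c) = monom (c * monval (p(v := 1)) m) (Poly_Mapping.lookup m v)"
    by (cases "c = 0") (simp_all add: line_monomials)
  have 2: "monval (p(v := 1)) (m - Poly_Mapping.single v 1) = monval (p(v := 1)) m"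
    if "Poly_Mapping.lookup m v \<noteq> 0"
  proof -
    have "monval (p(v := 1)) m = monval (p(v := 1)) ((m - Poly_Mapping.single v 1) + Poly_Mapping.single v 1)"
      using that by (subst minus_single_add) auto
    then show ?thesis by (simp add: monval_add)
  qed
  show ?case
    unfolding mpderiv_single meval_simps 1 pderiv_monom
    by (subst monval_fun_upd[of p v a "m - _"])
       (cases "Poly_Mapping.lookup m v = 0"; simp add: 2[simplified] poly_monom lookup_minus ac_simps)
next
  case (add P Q)
  have "line p v (P + Q) = line p v P + line p v Q"
    unfolding line_def by (rule pconst_hom.mev_add)
  then show ?case using add by (simp add: pderiv_add mpderiv_add meval_simps)
qed

section \<open>The bigraded coordinate ring\<close>

lemma UNIV_svar: "(UNIV :: svar set) = {cS, cT, cX, cY, cZ}"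
  using svar.exhaust by auto

definition pt :: "'k \<Rightarrow> 'k \<Rightarrow> 'k \<Rightarrow> 'k \<Rightarrow> 'k \<Rightarrow> svar \<Rightarrow> 'k" where
  "pt s t x y z = (\<lambda>i. case i of cS \<Rightarrow> s | cT \<Rightarrow> t | cX \<Rightarrow> x | cY \<Rightarrow> y | cZ \<Rightarrow> z)"

lemma pt_simps [simp]: "pt s t x y z cS = s" "pt s t x y z cT = t" "pt s t x y z cX = x"
  "pt s t x y z cY = y" "pt s t x y z cZ = z"
  by (simp_all add: pt_def)

lemma monval_svar:
  "monval p m = p cS ^ Poly_Mapping.lookup m cS * p cT ^ Poly_Mapping.lookup m cT
     * p cX ^ Poly_Mapping.lookup m cX * p cY ^ Poly_Mapping.lookup m cY * p cZ ^ Poly_Mapping.lookup m cZ"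
  by (subst monval_superset[of "{cS, cT, cX, cY, cZ}"]) (auto simp: ac_simps intro: svar.exhaust)

lemma svar_exponents_eqI:
  assumes "Poly_Mapping.lookup m cS = Poly_Mapping.lookup n cS"
    "Poly_Mapping.lookup m cT = Poly_Mapping.lookup n cT"
    "Poly_Mapping.lookup m cX = Poly_Mapping.lookup n cX"
    "Poly_Mapping.lookup m cY = Poly_Mapping.lookup n cY"
    "Poly_Mapping.lookup m cZ = Poly_Mapping.lookup n cZ"
  shows "m = n"
proof (rule poly_mapping_eqI)
  fix k show "Poly_Mapping.lookup m k = Poly_Mapping.lookup n k"
    using assms by (cases k) auto
qed

lemma bidegree_add: "bidegree (m + n) = (fst (bidegree m) + fst (bidegree n), snd (bidegree m) + snd (bidegree n))"
  by (simp add: bidegree_def Let_def lookup_add)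

lemma bihomogeneous_0 [simp]: "bihomogeneous d 0"
  by (simp add: bihomogeneous_def)

lemma bihomogeneous_add: "bihomogeneous d P \<Longrightarrow> bihomogeneous d Q \<Longrightarrow> bihomogeneous d (P + Q)"
  using keys_add[of P Q] by (auto simp: bihomogeneous_def)

lemma bihomogeneous_uminus: "bihomogeneous d P \<Longrightarrow> bihomogeneous d (- P :: (svar, 'k::comm_ring_1) mpoly)"
  by (auto simp: bihomogeneous_def in_keys_iff)

lemma bihomogeneous_diff:
  "bihomogeneous d P \<Longrightarrow> bihomogeneous d Q \<Longrightarrow> bihomogeneous d (P - Q :: (svar, 'k::comm_ring_1) mpoly)"
  using bihomogeneous_add[of d P "- Q"] by (simp add: bihomogeneous_uminus)

lemma bihomogeneous_sum: "(\<And>x. x \<in> S \<Longrightarrow> bihomogeneous d (f x)) \<Longrightarrow> bihomogeneous d (sum f S)"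
  by (induction S rule: infinite_finite_induct) (auto intro: bihomogeneous_add)

lemma bihomogeneous_single: "bidegree m = d \<Longrightarrow> bihomogeneous d (Poly_Mapping.single m c)"
  by (auto simp: bihomogeneous_def)

lemma bihomogeneous_mult:
  assumes "bihomogeneous (d1, d2) P" "bihomogeneous (e1, e2) Q"
  shows "bihomogeneous (d1 + e1, d2 + e2) (P * Q :: (svar, 'k::comm_ring_1) mpoly)"
proof -
  have "bidegree m = (d1 + e1, d2 + e2)" if "m \<in> Poly_Mapping.keys (P * Q)" for m
  proof -
    obtain a b where "a \<in> Poly_Mapping.keys P" "b \<in> Poly_Mapping.keys Q" "m = a + b"
      using \<open>m \<in> _\<close> keys_mult[of P Q] by auto
    then show ?thesis
      using assms by (auto simp: bihomogeneous_def bidegree_add)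
  qed
  then show ?thesis by (simp add: bihomogeneous_def)
qed

lemma bihomogeneous_1 [simp]: "bihomogeneous (0, 0) (1 :: (svar, 'k::comm_ring_1) mpoly)"
  by (simp add: bihomogeneous_def bidegree_def Let_def)

lemma bihomogeneous_power:
  "bihomogeneous (d1, d2) P \<Longrightarrow> bihomogeneous (n * d1, n * d2) (P ^ n :: (svar, 'k::comm_ring_1) mpoly)"
  by (induction n) (auto dest: bihomogeneous_mult)

lemma bihomogeneous_mvar:
  "bihomogeneous (1, 0) (mvar cS :: (svar, 'k::comm_ring_1) mpoly)"
  "bihomogeneous (1, 0) (mvar cT :: (svar, 'k::comm_ring_1) mpoly)"
  "bihomogeneous (4, 1) (mvar cX :: (svar, 'k::comm_ring_1) mpoly)"
  "bihomogeneous (6, 1) (mvar cY :: (svar, 'k::comm_ring_1) mpoly)"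
  "bihomogeneous (0, 1) (mvar cZ :: (svar, 'k::comm_ring_1) mpoly)"
  by (auto simp: mvar_def bidegree_def Let_def lookup_single intro!: bihomogeneous_single)

lemma bihomogeneous_mconst: "bihomogeneous (0, 0) (mconst c :: (svar, 'k::comm_ring_1) mpoly)"
  by (auto simp: mconst_def bidegree_def Let_def intro!: bihomogeneous_single)

lemma bihomogeneous_mult':
  "bihomogeneous (d1, d2) P \<Longrightarrow> bihomogeneous (e1, e2) Q \<Longrightarrow> d1 + e1 = f1 \<Longrightarrow> d2 + e2 = f2 \<Longrightarrow>
    bihomogeneous (f1, f2) (P * Q :: (svar, 'k::comm_ring_1) mpoly)"
  using bihomogeneous_mult by blast

lemma bihomogeneous_section: "A \<in> sections n \<Longrightarrow> bihomogeneous (n, 0) A"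
proof (unfold bihomogeneous_def, rule ballI)
  fix m assume "A \<in> sections n" "m \<in> Poly_Mapping.keys A"
  then have k: "Poly_Mapping.keys m \<subseteq> {cS, cT}" and "Poly_Mapping.lookup m cS + Poly_Mapping.lookup m cT = n"
    by (auto simp: sections_def)
  moreover have "Poly_Mapping.lookup m cX = 0" "Poly_Mapping.lookup m cY = 0" "Poly_Mapping.lookup m cZ = 0"
    using k by (auto simp: in_keys_iff subset_iff)
  ultimately show "bidegree m = (n, 0)" by (simp add: bidegree_def Let_def)
qed

lemma sections_keys:
  assumes "A \<in> sections n" "m \<in> Poly_Mapping.keys A"
  shows "Poly_Mapping.lookup m cX = 0" "Poly_Mapping.lookup m cY = 0" "Poly_Mapping.lookup m cZ = 0"
    "Poly_Mapping.lookup m cS + Poly_Mapping.lookup m cT = n"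
  using assms by (auto simp: sections_def in_keys_iff subset_iff)

lemma meval_section_cong:
  assumes "A \<in> sections n" "p cS = q cS" "p cT = q cT"
  shows "meval p A = meval q A"
  unfolding meval_eq_mev mev_def
  by (rule sum.cong) (auto simp: monval_svar sections_keys[OF assms(1)] assms(2,3))

text \<open>The torus action.\<close>

definition act :: "'k::comm_ring_1 \<Rightarrow> 'k \<Rightarrow> (svar \<Rightarrow> 'k) \<Rightarrow> svar \<Rightarrow> 'k" where
  "act l u p = pt (l * p cS) (l * p cT) (l ^ 4 * u * p cX) (l ^ 6 * u * p cY) (u * p cZ)"

lemma meval_act:
  assumes "bihomogeneous (d1, d2) P"
  shows "meval (act l u p) P = l ^ d1 * u ^ d2 * meval p P"
proof -
  have "monval (act l u p) m = l ^ d1 * u ^ d2 * monval p m" if "bidegree m = (d1, d2)" for m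
    using that by (auto simp: monval_svar act_def bidegree_def Let_def power_mult_distrib power_add
      power_mult[symmetric] mult_ac)
  then show ?thesis
    using assms unfolding meval_eq_mev mev_def sum_distrib_left
    by (intro sum.cong) (auto simp: bihomogeneous_def)
qed

section \<open>Cubics with distinct roots\<close>

text \<open>The exceptional values of \<open>w\<close> are the critical values of the cubic, for which it has a double root.\<close>

lemma cubic_three_roots:
  fixes a c :: "'k::{alg_closed_field, field_char_0}"
  obtains F where "finite F"
    "\<And>w. w \<notin> F \<Longrightarrow> \<exists>R. card R = 3 \<and> (\<forall>r\<in>R. r ^ 3 + a * r + c = w)"
proof
  let ?F = "(\<lambda>r. r ^ 3 + a * r + c) ` {r. 3 * r ^ 2 + a = 0}"
  have "{r. 3 * r ^ 2 + a = 0} = {r. poly [:a, 0, 3:] r = 0}"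
    by (auto simp: power2_eq_square algebra_simps)
  then have "finite {r. 3 * r ^ 2 + a = 0}"
    by (simp only:) (rule poly_roots_finite, simp)
  then show "finite ?F" by simp
  fix w assume w: "w \<notin> ?F"
  obtain r where "poly [:c - w, a, 0, 1:] r = 0"
    using alg_closed_imp_poly_has_root[of "[:c - w, a, 0, 1:]"] by auto
  then have r: "r ^ 3 + a * r + c = w" by (simp add: algebra_simps power3_eq_cube)
  obtain q where "poly [:r ^ 2 + a, r, 1:] q = 0"
    using alg_closed_imp_poly_has_root[of "[:r ^ 2 + a, r, 1:]"] by auto
  then have q: "q ^ 2 + r * q + r ^ 2 + a = 0" by (simp add: algebra_simps power2_eq_square)
  have "q ^ 3 + a * q + c - (r ^ 3 + a * r + c) = (q - r) * (q ^ 2 + r * q + r ^ 2 + a)"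
    by (simp add: algebra_simps power2_eq_square power3_eq_cube)
  then have rootq: "q ^ 3 + a * q + c = w" using q r by simp
  let ?u = "- r - q"
  have "?u ^ 3 + a * ?u + c - (r ^ 3 + a * r + c) = - (2 * r + q) * (q ^ 2 + r * q + r ^ 2 + a)"
    by (simp add: algebra_simps power2_eq_square power3_eq_cube)
  then have rootu: "?u ^ 3 + a * ?u + c = w" using q r by simp
  have simple: "3 * v ^ 2 + a \<noteq> 0" if "v ^ 3 + a * v + c = w" for v using w that by auto
  have "r \<noteq> q" using simple[OF r] q by (auto simp: power2_eq_square algebra_simps)
  moreover have "r \<noteq> ?u"
  proof
    assume "r = ?u"
    then have "q = - 2 * r" by (simp add: eq_neg_iff_add_eq_0 algebra_simps)
    then show False using simple[OF r] q by (auto simp: power2_eq_square algebra_simps)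
  qed
  moreover have "q \<noteq> ?u"
  proof
    assume "q = ?u"
    then have "r = - 2 * q" by (simp add: eq_neg_iff_add_eq_0 algebra_simps)
    then show False using simple[OF rootq] q by (auto simp: power2_eq_square algebra_simps)
  qed
  ultimately show "\<exists>R. card R = 3 \<and> (\<forall>r\<in>R. r ^ 3 + a * r + c = w)"
    using r rootq rootu by (intro exI[of _ "{r, q, ?u}"]) auto
qed

section \<open>Normal forms on a Weierstrass surface\<close>

locale weierstrass_forms =
  fixes A B :: "(svar, 'k::{alg_closed_field, field_char_0}) mpoly"
  assumes A_section: "A \<in> sections 8" and B_section: "B \<in> sections 12"
begin

abbreviation "G \<equiv> weierstrass A B"

lemma meval_G:
  "meval p G = p cY ^ 2 * p cZ - (p cX ^ 3 + meval p A * p cX * p cZ ^ 2 + meval p B * p cZ ^ 3)"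
  by (simp add: weierstrass_def meval_simps)

lemma cone_eq: "p \<in> cone G \<Longrightarrow>
   p cX ^ 3 = p cY ^ 2 * p cZ - meval p A * p cX * p cZ ^ 2 - meval p B * p cZ ^ 3"
  by (auto simp: cone_def meval_G algebra_simps)

lemma bihomogeneous_G: "bihomogeneous (12, 3) G"
  unfolding weierstrass_def
  by (intro bihomogeneous_diff bihomogeneous_add)
     (auto intro!: bihomogeneous_mult' bihomogeneous_power[of _ _ _ 2, simplified]
        bihomogeneous_power[of _ _ _ 3, simplified] bihomogeneous_mvar bihomogeneous_section A_section B_section
        intro: bihomogeneous_power[of _ _ "mvar cX" 3, OF bihomogeneous_mvar(3), simplified]
          bihomogeneous_power[of _ _ "mvar cY" 2, OF bihomogeneous_mvar(4), simplified]
          bihomogeneous_power[of _ _ "mvar cZ" 2, OF bihomogeneous_mvar(5), simplified]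
          bihomogeneous_power[of _ _ "mvar cZ" 3, OF bihomogeneous_mvar(5), simplified])

definition reduced :: "(svar, 'k) mpoly \<Rightarrow> bool" where
  "reduced P \<longleftrightarrow> (\<forall>m\<in>Poly_Mapping.keys P. Poly_Mapping.lookup m cX \<le> 2)"

lemma reduced_add: "reduced P \<Longrightarrow> reduced Q \<Longrightarrow> reduced (P + Q)"
  using keys_add[of P Q] by (auto simp: reduced_def)

lemma reduced_uminus: "reduced P \<Longrightarrow> reduced (- P)"
  by (auto simp: reduced_def in_keys_iff)

lemma reduced_diff: "reduced P \<Longrightarrow> reduced Q \<Longrightarrow> reduced (P - Q)"
  using reduced_add[of P "- Q"] by (simp add: reduced_uminus)

lemma reduced_sum: "(\<And>x. x \<in> S \<Longrightarrow> reduced (f x)) \<Longrightarrow> reduced (sum f S)"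
  by (induction S rule: infinite_finite_induct) (auto intro: reduced_add simp: reduced_def[of 0])

lemma reduced_single_mult:
  assumes "reduced P" "Poly_Mapping.lookup m cX = 0"
  shows "reduced (P * Poly_Mapping.single m c)"
  using assms keys_mult[of P "Poly_Mapping.single m c"]
  by (fastforce simp: reduced_def lookup_add split: if_splits)

text \<open>Replacing \<open>x\<^sup>3\<close> by \<open>y\<^sup>2z - Axz\<^sup>2 - Bz\<^sup>3\<close> lowers the degree in \<open>x\<close> and
  keeps the bidegree.\<close>

lemma reduce_monomial:
  assumes "bidegree m = d"
  shows "\<exists>P. bihomogeneous d P \<and> reduced P \<and> (\<forall>p\<in>cone G. meval p P = c * monval p m)"
  using assms
proof (induction "Poly_Mapping.lookup m cX" arbitrary: m c rule: less_induct)
  case less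
  show ?case
  proof (cases "Poly_Mapping.lookup m cX \<le> 2")
    case True
    then show ?thesis using less.prems
      by (intro exI[of _ "Poly_Mapping.single m c"]) (auto simp: meval_simps reduced_def bihomogeneous_single)
  next
    case False
    define n where "n = m - Poly_Mapping.single cX 3"
    have m: "m = n + Poly_Mapping.single cX 3"
      unfolding n_def using False by (subst minus_single_add) auto
    define R where "R = mvar cY ^ 2 * mvar cZ - A * (mvar cX * mvar cZ ^ 2) - B * mvar cZ ^ 3"
    define Q where "Q = Poly_Mapping.single n c * R"
    have bR: "bihomogeneous (12, 3) R"
    proof -
      have "R = G + mvar cX ^ 3" by (simp add: R_def weierstrass_def algebra_simps)
      then show ?thesis
        using bihomogeneous_add[OF bihomogeneous_G bihomogeneous_power[OF bihomogeneous_mvar(3), of 3, simplified]]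
        by simp
    qed
    have bQ: "bihomogeneous d Q"
    proof -
      obtain d1 d2 where nd: "bidegree n = (d1, d2)" by fastforce
      have "d = (d1 + 12, d2 + 3)"
        using less.prems nd unfolding m by (auto simp: bidegree_def Let_def lookup_single lookup_add)
      then show ?thesis
        unfolding Q_def using bihomogeneous_mult[OF bihomogeneous_single[OF nd] bR] by simp
    qed
    have kR: "Poly_Mapping.lookup k cX \<le> 1" if "k \<in> Poly_Mapping.keys R" for k
    proof -
      have mono: "mvar cY ^ 2 * mvar cZ = (Poly_Mapping.single (Poly_Mapping.single cY 2 + Poly_Mapping.single cZ 1) 1 :: (svar, 'k) mpoly)"
        "mvar cX * mvar cZ ^ 2 = (Poly_Mapping.single (Poly_Mapping.single cX 1 + Poly_Mapping.single cZ 2) 1 :: (svar, 'k) mpoly)"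
        "mvar cZ ^ 3 = (Poly_Mapping.single (Poly_Mapping.single cZ 3) 1 :: (svar, 'k) mpoly)"
        by (simp_all add: mvar_def mult_single single_add[symmetric] numeral_2_eq_2 numeral_3_eq_3)
      consider "k \<in> Poly_Mapping.keys (mvar cY ^ 2 * mvar cZ :: (svar, 'k) mpoly)"
        | "k \<in> Poly_Mapping.keys (A * (mvar cX * mvar cZ ^ 2))" | "k \<in> Poly_Mapping.keys (B * mvar cZ ^ 3)"
        using \<open>k \<in> _\<close> unfolding R_def in_keys_iff lookup_minus
        by (metis diff_zero)
      then show ?thesis
      proof cases
        case 1
        then show ?thesis by (auto simp: mono lookup_add lookup_single split: if_splits)
      next
        case 2
        then obtain a where "a \<in> Poly_Mapping.keys A" "k = a + (Poly_Mapping.single cX 1 + Poly_Mapping.single cZ 2)"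
          using keys_mult[of A "mvar cX * mvar cZ ^ 2"] by (auto simp: mono split: if_splits)
        then show ?thesis using sections_keys[OF A_section] by (auto simp: lookup_add lookup_single)
      next
        case 3
        then obtain a where "a \<in> Poly_Mapping.keys B" "k = a + Poly_Mapping.single cZ 3"
          using keys_mult[of B "mvar cZ ^ 3"] by (auto simp: mono split: if_splits)
        then show ?thesis using sections_keys[OF B_section] by (auto simp: lookup_add lookup_single)
      qed
    qed
    have kQ: "Poly_Mapping.lookup k cX < Poly_Mapping.lookup m cX" if "k \<in> Poly_Mapping.keys Q" for k
    proof -
      obtain l where l: "l \<in> Poly_Mapping.keys R" "k = n + l"
        using \<open>k \<in> _\<close> keys_mult[of "Poly_Mapping.single n c" R] unfolding Q_def
        by (auto split: if_splits)
      then show ?thesis using kR[of l] by (simp add: m lookup_add)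
    qed
    have "\<forall>k\<in>Poly_Mapping.keys Q. \<exists>P. bihomogeneous d P \<and> reduced P \<and>
        (\<forall>p\<in>cone G. meval p P = Poly_Mapping.lookup Q k * monval p k)"
      using less.hyps kQ bQ by (auto simp: bihomogeneous_def)
    then obtain f where f: "\<And>k. k \<in> Poly_Mapping.keys Q \<Longrightarrow> bihomogeneous d (f k) \<and> reduced (f k) \<and>
        (\<forall>p\<in>cone G. meval p (f k) = Poly_Mapping.lookup Q k * monval p k)"
      by metis
    have "meval p (\<Sum>k\<in>Poly_Mapping.keys Q. f k) = c * monval p m" if p: "p \<in> cone G" for p
    proof -
      have "meval p (\<Sum>k\<in>Poly_Mapping.keys Q. f k) = (\<Sum>k\<in>Poly_Mapping.keys Q. Poly_Mapping.lookup Q k * monval p k)"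
        unfolding meval_sum using f p by (intro sum.cong) auto
      also have "\<dots> = meval p Q" by (simp add: meval_eq_mev mev_def)
      also have "\<dots> = c * monval p n * p cX ^ 3"
        unfolding cone_eq[OF p] by (simp add: Q_def R_def meval_simps algebra_simps)
      also have "\<dots> = c * monval p m" by (simp add: m monval_add)
      finally show ?thesis .
    qed
    then show ?thesis
      using f by (intro exI[of _ "\<Sum>k\<in>Poly_Mapping.keys Q. f k"]) (auto intro!: bihomogeneous_sum reduced_sum)
  qed
qed

lemma reduce:
  assumes "bihomogeneous d P"
  obtains Q where "bihomogeneous d Q" "reduced Q" "\<And>p. p \<in> cone G \<Longrightarrow> meval p Q = meval p P"
proof -
  have "\<forall>k\<in>Poly_Mapping.keys P. \<exists>Q. bihomogeneous d Q \<and> reduced Q \<and>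
      (\<forall>p\<in>cone G. meval p Q = Poly_Mapping.lookup P k * monval p k)"
    using assms reduce_monomial by (auto simp: bihomogeneous_def)
  then obtain f where f: "\<And>k. k \<in> Poly_Mapping.keys P \<Longrightarrow> bihomogeneous d (f k) \<and> reduced (f k) \<and>
      (\<forall>p\<in>cone G. meval p (f k) = Poly_Mapping.lookup P k * monval p k)"
    by metis
  show thesis
  proof
    fix p assume "p \<in> cone G"
    then have "meval p (\<Sum>k\<in>Poly_Mapping.keys P. f k) = (\<Sum>k\<in>Poly_Mapping.keys P. Poly_Mapping.lookup P k * monval p k)"
      unfolding meval_sum using f by (intro sum.cong) auto
    also have "\<dots> = meval p P" by (simp add: meval_eq_mev mev_def)
    finally show "meval p (\<Sum>k\<in>Poly_Mapping.keys P. f k) = meval p P" .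
  qed (use f in \<open>auto intro!: bihomogeneous_sum reduced_sum\<close>)
qed

text \<open>The powers \<open>1, x, x\<^sup>2\<close> are independent on the surface: over a general point of the \<open>(s,t,y,z)\<close>-space
  there are three values of \<open>x\<close>, too many for a nonzero polynomial of degree at most two. Infinitely many fibers
  suffice, since a polynomial in \<open>t\<close> has finitely many zeros.\<close>

lemma reduced_zero_if_vanishing:
  assumes red: "reduced Q" and inf: "infinite I"
    and van: "\<And>p. p \<in> cone G \<Longrightarrow> p cS \<noteq> 0 \<Longrightarrow> p cZ \<noteq> 0 \<Longrightarrow> p cY \<noteq> 0 \<Longrightarrow> p cT / p cS \<in> I \<Longrightarrow> meval p Q = 0"
  shows "Q = 0"
proof (rule mpoly_zero_if_meval_zero)
  have 1: "meval p Q = 0" if p: "p cS \<noteq> 0" "p cZ \<noteq> 0" "p cT / p cS \<in> I" for p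
  proof -
    define a c where "a = meval p A * p cZ ^ 2" and "c = meval p B * p cZ ^ 3"
    obtain F where F: "finite F" "\<And>w. w \<notin> F \<Longrightarrow> \<exists>R. card R = 3 \<and> (\<forall>r\<in>R. r ^ 3 + a * r + c = w)"
      using cubic_three_roots[of a c] by metis
    define Y where "Y = {y. y \<noteq> 0 \<and> y ^ 2 * p cZ \<notin> F}"
    have "finite {y. y ^ 2 * p cZ = w}" for w
    proof -
      have "{y. y ^ 2 * p cZ = w} = {y. poly [:- w, 0, p cZ:] y = 0}"
        by (auto simp: power2_eq_square algebra_simps)
      then show ?thesis using p by (simp only:) (rule poly_roots_finite, simp)
    qed
    then have "finite (\<Union>w\<in>F. {y. y ^ 2 * p cZ = w})" using F(1) by blast
    then have "finite (insert 0 (\<Union>w\<in>F. {y. y ^ 2 * p cZ = w}))" by simp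
    then have "infinite (- insert 0 (\<Union>w\<in>F. {y. y ^ 2 * p cZ = w}))"
      using infinite_UNIV_char_0 by (metis Diff_infinite_finite Compl_eq_Diff_UNIV)
    moreover have "- insert 0 (\<Union>w\<in>F. {y. y ^ 2 * p cZ = w}) = Y" by (auto simp: Y_def)
    ultimately have Y: "infinite Y" by simp
    show ?thesis
    proof (rule meval_zero_on_line[OF Y])
      fix y assume y: "y \<in> Y"
      then obtain R where R: "card R = 3" "\<And>r. r \<in> R \<Longrightarrow> r ^ 3 + a * r + c = y ^ 2 * p cZ"
        using F(2)[of "y ^ 2 * p cZ"] by (auto simp: Y_def)
      let ?q = "p(cY := y)"
      have "R \<subseteq> {x. poly (line ?q cX Q) x = 0}"
      proof
        fix x assume x: "x \<in> R"
        have cong: "meval (?q(cX := x)) A = meval p A" "meval (?q(cX := x)) B = meval p B"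
          by (rule meval_section_cong[OF A_section] meval_section_cong[OF B_section]; simp)+
        have "meval (?q(cX := x)) Q = 0"
        proof (rule van)
          show "?q(cX := x) \<in> cone G"
            using p R(2)[OF x] by (simp add: cone_def meval_G cong a_def c_def algebra_simps)
        qed (use p y in \<open>auto simp: Y_def\<close>)
        then show "x \<in> {x. poly (line ?q cX Q) x = 0}" by simp
      qed
      moreover have "Polynomial.degree (line ?q cX Q) \<le> 2"
        using red by (intro degree_line_le) (auto simp: reduced_def)
      ultimately have "line ?q cX Q = 0"
        using R(1) poly_eqI_degree[of R "line ?q cX Q" 0] by fastforce
      then have "poly (line ?q cX Q) (p cX) = 0" by simp
      then show "meval (p(cY := y)) Q = 0" by (simp add: fun_upd_twist fun_upd_idem)
    qed
  qed
  have 2: "meval p Q = 0" if p: "p cS \<noteq> 0" "p cZ \<noteq> 0" for p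
  proof (rule meval_zero_on_line[of "(*) (p cS) ` I" p cT])
    show "infinite ((*) (p cS) ` I)"
      using p inf by (subst finite_image_iff) (auto simp: inj_on_def)
  qed (use p in \<open>auto intro!: 1\<close>)
  show "meval p Q = 0" for p
  proof (rule meval_zero_on_grid[of "{cS, cZ}" "\<lambda>_. - {0}"])
    show "infinite (- {0 :: 'k})"
      using infinite_UNIV_char_0[where 'a = 'k] by (simp add: Compl_eq_Diff_UNIV)
  qed (use 2 in auto)
qed

section \<open>Irreducibility\<close>

lemma affine_fiber_normal_form:
  "\<exists>p0 p1. \<forall>x y. y ^ 2 = x ^ 3 + a * x + b \<longrightarrow> meval (pt s t x y 1) P = poly p0 x + poly p1 x * (y :: 'k)"
proof (induction P rule: mpoly_induct)
  case (single m c)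
  have "\<exists>p0 p1. \<forall>x y. y ^ 2 = x ^ 3 + a * x + b \<longrightarrow> y ^ j = poly p0 x + poly p1 x * (y :: 'k)" for j
  proof (induction j)
    case 0
    show ?case by (rule exI[of _ 1], rule exI[of _ 0]) auto
  next
    case (Suc j)
    then obtain p0 p1 where *: "\<And>x y. y ^ 2 = x ^ 3 + a * x + b \<Longrightarrow> y ^ j = poly p0 x + poly p1 x * y"
      by blast
    have "y ^ Suc j = poly (p1 * [:b, a, 0, 1:]) x + poly p0 x * y" if "y ^ 2 = x ^ 3 + a * x + b" for x y
    proof -
      have "y ^ Suc j = poly p0 x * y + poly p1 x * y ^ 2"
        using *[OF that] by (simp add: power2_eq_square algebra_simps)
      then show ?thesis unfolding that by (simp add: algebra_simps power3_eq_cube)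
    qed
    then show ?case by blast
  qed
  then obtain p0 p1 where *: "\<And>x y. y ^ 2 = x ^ 3 + a * x + b \<Longrightarrow>
      y ^ Poly_Mapping.lookup m cY = poly p0 x + poly p1 x * y"
    by blast
  let ?q = "monom (c * s ^ Poly_Mapping.lookup m cS * t ^ Poly_Mapping.lookup m cT) (Poly_Mapping.lookup m cX)"
  have "meval (pt s t x y 1) (Poly_Mapping.single m c) = poly (?q * p0) x + poly (?q * p1) x * y"
    if "y ^ 2 = x ^ 3 + a * x + b" for x y
    by (simp add: meval_simps monval_svar poly_monom *[OF that] algebra_simps)
  then show ?case by blast
next
  case (add P Q)
  then obtain p0 p1 q0 q1 where
    "\<And>x y. y ^ 2 = x ^ 3 + a * x + b \<Longrightarrow> meval (pt s t x y 1) P = poly p0 x + poly p1 x * y"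
    "\<And>x y. y ^ 2 = x ^ 3 + a * x + b \<Longrightarrow> meval (pt s t x y 1) Q = poly q0 x + poly q1 x * y"
    by blast
  then have "meval (pt s t x y 1) (P + Q) = poly (p0 + q0) x + poly (p1 + q1) x * y"
    if "y ^ 2 = x ^ 3 + a * x + b" for x y
    using that by (simp add: meval_simps algebra_simps)
  then show ?case by blast
qed

text \<open>The norm \<open>p0\<^sup>2 - (x\<^sup>3 + ax + b) p1\<^sup>2\<close> of a nonzero function \<open>p0 + p1 y\<close> does not vanish, since
  its two terms have degrees of different parity.\<close>

lemma norm_eq_zero:
  fixes p0 p1 :: "'k poly"
  assumes "p0 ^ 2 = [:b, a, 0, 1:] * p1 ^ 2"
  shows "p0 = 0 \<and> p1 = 0"
proof -
  have "p1 = 0"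
  proof (rule ccontr)
    assume p1: "p1 \<noteq> 0"
    have d: "Polynomial.degree ([:b, a, 0, 1:] * p1 ^ 2) = 3 + 2 * Polynomial.degree p1"
      using p1 by (subst degree_mult_eq) (auto simp: degree_power_eq)
    have "Polynomial.degree (p0 ^ 2) = 2 * Polynomial.degree p0"
      by (cases "p0 = 0") (auto simp: degree_power_eq)
    with d assms have "2 * Polynomial.degree p0 = 3 + 2 * Polynomial.degree p1" by simp
    then show False by presburger
  qed
  then show ?thesis using assms by simp
qed

text \<open>Multiplication by the conjugate \<open>p0 - p1 y\<close> turns the two functions into their norms, polynomials in \<open>x\<close> whose
  product vanishes identically.\<close>

lemma affine_fiber_irreducible:
  fixes P Q :: "(svar, 'k) mpoly"
  assumes "\<And>x y. y ^ 2 = x ^ 3 + a * x + b \<Longrightarrow> meval (pt s t x y 1) P * meval (pt s t x y 1) Q = 0"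
  shows "(\<forall>x y. y ^ 2 = x ^ 3 + a * x + b \<longrightarrow> meval (pt s t x y 1) P = 0) \<or>
         (\<forall>x y. y ^ 2 = x ^ 3 + a * x + b \<longrightarrow> meval (pt s t x y 1) Q = 0)"
proof -
  obtain p0 p1 where P: "\<And>x y. y ^ 2 = x ^ 3 + a * x + b \<Longrightarrow> meval (pt s t x y 1) P = poly p0 x + poly p1 x * y"
    using affine_fiber_normal_form by blast
  obtain q0 q1 where Q: "\<And>x y. y ^ 2 = x ^ 3 + a * x + b \<Longrightarrow> meval (pt s t x y 1) Q = poly q0 x + poly q1 x * y"
    using affine_fiber_normal_form by blast
  let ?f = "[:b, a, 0, 1:]"
  have "poly ((p0 ^ 2 - ?f * p1 ^ 2) * (q0 ^ 2 - ?f * q1 ^ 2)) x = 0" for x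
  proof -
    obtain y where "y ^ 2 = x ^ 3 + a * x + b"
      using nth_root_exists[of 2 "x ^ 3 + a * x + b"] by auto
    then have y: "y ^ 2 = poly ?f x" "y ^ 2 = x ^ 3 + a * x + b" "(- y) ^ 2 = x ^ 3 + a * x + b"
      by (auto simp: algebra_simps power3_eq_cube)
    have "(poly p0 x + poly p1 x * y) * (poly q0 x + poly q1 x * y) = 0"
      using assms[OF y(2)] P[OF y(2)] Q[OF y(2)] by simp
    then have "((poly p0 x + poly p1 x * y) * (poly p0 x - poly p1 x * y)) *
        ((poly q0 x + poly q1 x * y) * (poly q0 x - poly q1 x * y)) = 0"
      by auto
    also have "((poly p0 x + poly p1 x * y) * (poly p0 x - poly p1 x * y)) *
        ((poly q0 x + poly q1 x * y) * (poly q0 x - poly q1 x * y)) =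
        (poly p0 x ^ 2 - y ^ 2 * poly p1 x ^ 2) * (poly q0 x ^ 2 - y ^ 2 * poly q1 x ^ 2)"
      by (simp add: power2_eq_square algebra_simps)
    finally show ?thesis unfolding y(1) by (simp only: poly_mult poly_diff poly_power)
  qed
  then have "(p0 ^ 2 - ?f * p1 ^ 2) * (q0 ^ 2 - ?f * q1 ^ 2) = 0"
    by (metis poly_all_0_iff_0)
  then consider "p0 ^ 2 = ?f * p1 ^ 2" | "q0 ^ 2 = ?f * q1 ^ 2" by auto
  then show ?thesis
    by cases (use norm_eq_zero P Q in force)+
qed

text \<open>On each fiber one of the two factors vanishes, so one of them vanishes on infinitely many fibers; its normal form is
  then zero.\<close>

lemma irreducible_surface_G: "irreducible_surface G"
proof -
  let ?fib = "\<lambda>\<tau> P. \<forall>x y. y ^ 2 = x ^ 3 + meval (st_point 1 \<tau>) A * x + meval (st_point 1 \<tau>) B \<longrightarrow>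
      meval (pt 1 \<tau> x y 1) P = 0"
  have st: "meval (pt 1 \<tau> x y z) A = meval (st_point 1 \<tau>) A" "meval (pt 1 \<tau> x y z) B = meval (st_point 1 \<tau>) B"
    for \<tau> x y z
    by (rule meval_section_cong[OF A_section] meval_section_cong[OF B_section]; simp add: st_point_def)+
  have vanish: "\<forall>p\<in>cone G. meval p P = 0" if bP: "bihomogeneous (d1, d2) P" and inf: "infinite {\<tau>. ?fib \<tau> P}" for P d1 d2
  proof -
    obtain Q where Q: "bihomogeneous (d1, d2) Q" "reduced Q" "\<And>p. p \<in> cone G \<Longrightarrow> meval p Q = meval p P"
      using reduce[OF bP] by metis
    have "Q = 0"
    proof (rule reduced_zero_if_vanishing[OF Q(2) inf])
      fix p assume p: "p \<in> cone G" "p cS \<noteq> 0" "p cZ \<noteq> 0" "p cY \<noteq> 0" "p cT / p cS \<in> {\<tau>. ?fib \<tau> P}"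
      define q where "q = pt 1 (p cT / p cS) (p cX / (p cS ^ 4 * p cZ)) (p cY / (p cS ^ 6 * p cZ)) 1"
      have pq: "p = act (p cS) (p cZ) q"
      proof
        fix i show "p i = act (p cS) (p cZ) q i"
          using p by (cases i) (auto simp: act_def q_def)
      qed
      have "0 = p cS ^ 12 * p cZ ^ 3 * meval q G"
        using p(1) meval_act[OF bihomogeneous_G, of "p cS" "p cZ" q] pq by (simp add: cone_def)
      then have "meval q G = 0" using p by simp
      then have "meval q P = 0"
        using p(5) unfolding meval_G q_def st by (simp add: algebra_simps)
      then have "meval p P = 0"
        using meval_act[OF bP, of "p cS" "p cZ" q] pq by simp
      then show "meval p Q = 0" using Q(3) p(1) by simp
    qed
    then show ?thesis using Q(3) by (auto simp: meval_simps)
  qed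
  have "pt 1 0 0 1 0 \<in> cone G" by (simp add: cone_def meval_G)
  moreover have "(\<forall>p\<in>cone G. meval p P = 0) \<or> (\<forall>p\<in>cone G. meval p Q = 0)"
    if hyp: "bihomogeneous d P" "bihomogeneous e Q" "\<forall>p\<in>cone G. meval p P * meval p Q = 0" for P Q d e
  proof -
    have "?fib \<tau> P \<or> ?fib \<tau> Q" for \<tau>
    proof (rule affine_fiber_irreducible)
      fix x y assume "y ^ 2 = x ^ 3 + meval (st_point 1 \<tau>) A * x + meval (st_point 1 \<tau>) B"
      then have "pt 1 \<tau> x y 1 \<in> cone G" by (simp add: cone_def meval_G st)
      then show "meval (pt 1 \<tau> x y 1) P * meval (pt 1 \<tau> x y 1) Q = 0" using hyp(3) by blast
    qed
    then have "{\<tau>. ?fib \<tau> P} \<union> {\<tau>. ?fib \<tau> Q} = UNIV" by blast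
    then have "infinite ({\<tau>. ?fib \<tau> P} \<union> {\<tau>. ?fib \<tau> Q})" using infinite_UNIV_char_0 by metis
    then have "infinite {\<tau>. ?fib \<tau> P} \<or> infinite {\<tau>. ?fib \<tau> Q}" by blast
    then show ?thesis
      using vanish[of "fst d" "snd d" P] vanish[of "fst e" "snd e" Q] hyp(1,2) by auto
  qed
  ultimately show ?thesis unfolding irreducible_surface_def by blast
qed

end

section \<open>Dividing by monomials\<close>

definition part :: "(('v \<Rightarrow>\<^sub>0 nat) \<Rightarrow> bool) \<Rightarrow> ('v, 'a::comm_ring_1) mpoly \<Rightarrow> ('v, 'a) mpoly" where
  "part R P = (\<Sum>m\<in>{m\<in>Poly_Mapping.keys P. R m}. Poly_Mapping.single m (Poly_Mapping.lookup P m))"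

lemma lookup_part: "Poly_Mapping.lookup (part R P) m = (if R m then Poly_Mapping.lookup P m else 0)"
  unfolding part_def lookup_sum lookup_single when_def
  by (subst sum.delta) (auto simp: in_keys_iff)

lemma part_keys: "m \<in> Poly_Mapping.keys (part R P) \<longleftrightarrow> m \<in> Poly_Mapping.keys P \<and> R m"
  by (auto simp: in_keys_iff lookup_part)

lemma part_add_part_not: "part R P + part (\<lambda>m. \<not> R m) P = P"
  by (rule poly_mapping_eqI) (simp add: lookup_add lookup_part)

lemma lookup_mult_single:
  fixes P :: "('v, 'a::comm_ring_1) mpoly"
  shows "Poly_Mapping.lookup (P * Poly_Mapping.single n c) (m + n) = Poly_Mapping.lookup P m * c"
proof (induction P rule: mpoly_induct)
  case (single k d)
  then show ?case by (auto simp: mult_single lookup_single when_def)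
qed (simp add: distrib_right lookup_add)

lemma lookup_mult_single_eq_0:
  assumes "Poly_Mapping.lookup m v < Poly_Mapping.lookup n v"
  shows "Poly_Mapping.lookup (P * Poly_Mapping.single n c :: ('v, 'a::comm_ring_1) mpoly) m = 0"
proof (rule ccontr)
  assume "Poly_Mapping.lookup (P * Poly_Mapping.single n c) m \<noteq> 0"
  then have "m \<in> Poly_Mapping.keys (P * Poly_Mapping.single n c)" by (simp add: in_keys_iff)
  then obtain k where "m = k + n"
    using keys_mult[of P "Poly_Mapping.single n c"] by (auto split: if_splits)
  then show False using assms by (simp add: lookup_add)
qed

lemma mult_single_cancel:
  fixes P Q :: "('v, 'a::comm_ring_1) mpoly"
  assumes "P * Poly_Mapping.single n 1 = Q * Poly_Mapping.single n 1"
  shows "P = Q"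
proof (rule poly_mapping_eqI)
  fix m show "Poly_Mapping.lookup P m = Poly_Mapping.lookup Q m"
    using lookup_mult_single[of P n 1 m] lookup_mult_single[of Q n 1 m] assms by simp
qed

lemma divide_monomial:
  fixes L :: "('v, 'a::comm_ring_1) mpoly"
  assumes "\<And>m v. m \<in> Poly_Mapping.keys L \<Longrightarrow> Poly_Mapping.lookup n v \<le> Poly_Mapping.lookup m v"
  obtains P where "L = P * Poly_Mapping.single n 1" "\<And>m. m \<in> Poly_Mapping.keys P \<Longrightarrow> m + n \<in> Poly_Mapping.keys L"
proof
  let ?P = "\<Sum>m\<in>Poly_Mapping.keys L. Poly_Mapping.single (m - n) (Poly_Mapping.lookup L m)"
  have "m - n + n = m" if "m \<in> Poly_Mapping.keys L" for m
    using assms[OF that] by (intro poly_mapping_eqI) (simp add: lookup_add lookup_minus)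
  then show L: "L = ?P * Poly_Mapping.single n 1"
    by (subst mpoly_expand[of L]) (simp add: sum_distrib_right mult_single)
  show "m + n \<in> Poly_Mapping.keys L" if "m \<in> Poly_Mapping.keys ?P" for m
    using that lookup_mult_single[of ?P n 1 m, folded L] by (simp add: in_keys_iff)
qed

lemma bihomogeneous_divide:
  assumes "bihomogeneous (d1 + e1, d2 + e2) L" "bidegree n = (e1, e2)"
    "\<And>m. m \<in> Poly_Mapping.keys P \<Longrightarrow> m + n \<in> Poly_Mapping.keys L"
  shows "bihomogeneous (d1, d2) P"
  unfolding bihomogeneous_def
proof
  fix m assume "m \<in> Poly_Mapping.keys P"
  then have "bidegree (m + n) = (d1 + e1, d2 + e2)" using assms by (auto simp: bihomogeneous_def)
  then show "bidegree m = (d1, d2)" using assms(2) by (cases "bidegree m") (simp add: bidegree_add)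
qed

lemma bihomogeneous_part: "bihomogeneous d P \<Longrightarrow> bihomogeneous d (part R P)"
  by (auto simp: bihomogeneous_def part_keys)

lemma bidegree_single [simp]:
  "bidegree (Poly_Mapping.single cS n) = (n, 0)" "bidegree (Poly_Mapping.single cT n) = (n, 0)"
  "bidegree (Poly_Mapping.single cX n) = (4 * n, n)" "bidegree (Poly_Mapping.single cY n) = (6 * n, n)"
  "bidegree (Poly_Mapping.single cZ n) = (0, n)"
  by (auto simp: bidegree_def Let_def lookup_single)

section \<open>The first cohomology of the structure sheaf\<close>

abbreviation chart :: "svar \<Rightarrow> svar \<Rightarrow> (svar \<Rightarrow>\<^sub>0 nat)" where
  "chart i j \<equiv> Poly_Mapping.single i 1 + Poly_Mapping.single j 1"

lemma charts_eq: "charts = {chart cS cZ, chart cS cY, chart cT cZ, chart cT cY}"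
  by (auto simp: charts_def)

lemma chart_inj:
  assumes "i \<in> {cS, cT}" "k \<in> {cS, cT}" "j \<in> {cZ, cY}" "l \<in> {cZ, cY}"
  shows "chart i j = chart k l \<longleftrightarrow> i = k \<and> j = l"
proof
  assume *: "chart i j = chart k l"
  have "Poly_Mapping.lookup (chart i j) v = Poly_Mapping.lookup (chart k l) v" for v
    by (simp only: *)
  from this[of cS] this[of cZ] show "i = k \<and> j = l"
    using assms by (auto simp: lookup_add lookup_single)
qed auto

context weierstrass_forms
begin

lemma locus_iff: "p \<in> locus G m \<longleftrightarrow> p \<in> cone G \<and> monval p m \<noteq> 0"
  by (simp add: locus_def meval_simps)

lemma regular_on_iff:
  "regular_on G m f \<longleftrightarrow> (\<exists>k P. bihomogeneous (k * fst (bidegree m), k * snd (bidegree m)) P \<and>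
     (\<forall>p\<in>locus G m. f p = meval p P / monval p m ^ k))"
proof
  assume "regular_on G m f"
  then obtain P k where "bihomogeneous (k * fst (bidegree m), k * snd (bidegree m)) P"
    "\<forall>p\<in>locus G m. f p = frac_eval (P, Poly_Mapping.single m 1 ^ k) p"
    unfolding regular_on_def fractions_def by auto
  then show "\<exists>k P. bihomogeneous (k * fst (bidegree m), k * snd (bidegree m)) P \<and>
     (\<forall>p\<in>locus G m. f p = meval p P / monval p m ^ k)"
    by (intro exI[of _ k] exI[of _ P]) (simp add: frac_eval_def meval_simps)
next
  assume "\<exists>k P. bihomogeneous (k * fst (bidegree m), k * snd (bidegree m)) P \<and>
     (\<forall>p\<in>locus G m. f p = meval p P / monval p m ^ k)"
  then obtain P k where "bihomogeneous (k * fst (bidegree m), k * snd (bidegree m)) P"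
    "\<forall>p\<in>locus G m. f p = meval p P / monval p m ^ k"
    by blast
  then show "regular_on G m f"
    unfolding regular_on_def fractions_def
    by (intro bexI[of _ "(P, Poly_Mapping.single m 1 ^ k)"]) (auto simp: frac_eval_def meval_simps)
qed

text \<open>Multiplying numerator and denominator by the same monomial makes every larger exponent possible, so that
  several fractions can be given a common exponent.\<close>

lemma regular_on_reduced:
  assumes "regular_on G m f"
  obtains k0 where "\<And>k. k \<ge> k0 \<Longrightarrow> \<exists>P. bihomogeneous (k * fst (bidegree m), k * snd (bidegree m)) P \<and>
     reduced P \<and> (\<forall>p\<in>locus G m. f p = meval p P / monval p m ^ k)"
proof -
  obtain k0 P where P: "bihomogeneous (k0 * fst (bidegree m), k0 * snd (bidegree m)) P"
    "\<And>p. p \<in> locus G m \<Longrightarrow> f p = meval p P / monval p m ^ k0"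
    using assms unfolding regular_on_iff by blast
  have "\<exists>P. bihomogeneous (k * fst (bidegree m), k * snd (bidegree m)) P \<and>
     reduced P \<and> (\<forall>p\<in>locus G m. f p = meval p P / monval p m ^ k)" if k: "k \<ge> k0" for k
  proof -
    let ?P = "P * Poly_Mapping.single m 1 ^ (k - k0)"
    have "bihomogeneous ((k - k0) * fst (bidegree m), (k - k0) * snd (bidegree m)) (Poly_Mapping.single m (1 :: 'k) ^ (k - k0))"
      by (intro bihomogeneous_power bihomogeneous_single) simp
    then have "bihomogeneous (k * fst (bidegree m), k * snd (bidegree m)) ?P"
      using k by (intro bihomogeneous_mult'[OF P(1)]) (auto simp flip: add_mult_distrib)
    then obtain Q where Q: "bihomogeneous (k * fst (bidegree m), k * snd (bidegree m)) Q" "reduced Q"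
      "\<And>p. p \<in> cone G \<Longrightarrow> meval p Q = meval p ?P"
      using reduce by metis
    have "f p = meval p Q / monval p m ^ k" if p: "p \<in> locus G m" for p
    proof -
      have "monval p m ^ k = monval p m ^ (k - k0) * monval p m ^ k0"
        using k by (simp flip: power_add)
      moreover have "meval p Q = meval p P * monval p m ^ (k - k0)"
        using Q(3)[of p] p by (simp add: locus_iff meval_simps)
      ultimately show ?thesis using P(2)[OF p] p by (simp add: locus_iff)
    qed
    with Q show ?thesis by blast
  qed
  then show thesis by (rule that)
qed

text \<open>The denominator \<open>i\<^sup>a j\<^sup>b\<close> is completed to the power \<open>(ij)\<^bsup>a+b\<^esup>\<close> of the monomial of the chart. The first degree of
  \<open>y\<close> is 6 and that of \<open>z\<close> is 0.\<close>

lemma regular_onI: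
  assumes w: "i \<in> {cS, cT}" "j \<in> {cZ, cY}"
    and P: "bihomogeneous (a + (if j = cY then 6 else 0) * b, b) P"
    and f: "\<And>p. p \<in> cone G \<Longrightarrow> p i \<noteq> 0 \<Longrightarrow> p j \<noteq> 0 \<Longrightarrow> f p = meval p P / (p i ^ a * p j ^ b)"
  shows "regular_on G (chart i j) f"
proof -
  let ?P = "P * (Poly_Mapping.single (Poly_Mapping.single i b + Poly_Mapping.single j a) 1)"
  have "bihomogeneous ((a + b) * fst (bidegree (chart i j)), (a + b) * snd (bidegree (chart i j))) ?P"
    using w by (intro bihomogeneous_mult'[OF P, of "b + (if j = cY then 6 else 0) * a" a] bihomogeneous_single)
       (auto simp: bidegree_add)
  moreover have "f p = meval p ?P / monval p (chart i j) ^ (a + b)" if "p \<in> locus G (chart i j)" for p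
  proof -
    have *: "p \<in> cone G" "p i \<noteq> 0" "p j \<noteq> 0" using that by (auto simp: locus_iff monval_add)
    show ?thesis
      unfolding f[OF *] using *(2,3)
      by (simp add: meval_simps monval_add power_mult_distrib power_add field_simps)
  qed
  ultimately show ?thesis unfolding regular_on_iff by blast
qed

text \<open>A reduced monomial of degree \<open>2k\<close> in \<open>x\<close>, \<open>y\<close>, \<open>z\<close> is divisible by \<open>y\<^sup>k\<close> or by \<open>z\<^sup>k\<close>, with the
  single exception \<open>x\<^sup>2(yz)\<^bsup>k-1\<^esup>\<close>. The exceptional monomial spans the first cohomology of the fibers.\<close>

lemma split_fiberwise:
  assumes P: "bihomogeneous (e + 2 + 6 * k, 2 * k) P" "reduced P" and k: "k > 0"
  obtains U W E where
    "P = U * Poly_Mapping.single (Poly_Mapping.single cY k) 1 + W * Poly_Mapping.single (Poly_Mapping.single cZ k) 1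
       + E * Poly_Mapping.single (Poly_Mapping.single cX 2 + Poly_Mapping.single cY (k - 1) + Poly_Mapping.single cZ (k - 1)) 1"
    "bihomogeneous (e + 2, k) U" "bihomogeneous (e + 2 + 6 * k, k) W" "bihomogeneous (e, 0) E"
    "reduced U" "reduced W"
proof -
  let ?R1 = "\<lambda>m. k \<le> Poly_Mapping.lookup m cY" and ?R2 = "\<lambda>m. k \<le> Poly_Mapping.lookup m cZ"
  define P1 P2 P3 where "P1 = part ?R1 P" and "P2 = part ?R2 (part (\<lambda>m. \<not> ?R1 m) P)"
    and "P3 = part (\<lambda>m. \<not> ?R2 m) (part (\<lambda>m. \<not> ?R1 m) P)"
  have sum: "P = P1 + P2 + P3"
    unfolding P1_def P2_def P3_def by (simp add: part_add_part_not add.assoc)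
  have b: "bihomogeneous (e + 2 + 6 * k, 2 * k) P1" "bihomogeneous (e + 2 + 6 * k, 2 * k) P2"
    "bihomogeneous (e + 2 + 6 * k, 2 * k) P3"
    unfolding P1_def P2_def P3_def by (intro bihomogeneous_part P)+
  obtain U where U: "P1 = U * Poly_Mapping.single (Poly_Mapping.single cY k) 1"
    "\<And>m. m \<in> Poly_Mapping.keys U \<Longrightarrow> m + Poly_Mapping.single cY k \<in> Poly_Mapping.keys P1"
    by (rule divide_monomial[of P1 "Poly_Mapping.single cY k"])
       (auto simp: P1_def part_keys lookup_single when_def)
  obtain W where W: "P2 = W * Poly_Mapping.single (Poly_Mapping.single cZ k) 1"
    "\<And>m. m \<in> Poly_Mapping.keys W \<Longrightarrow> m + Poly_Mapping.single cZ k \<in> Poly_Mapping.keys P2"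
    by (rule divide_monomial[of P2 "Poly_Mapping.single cZ k"])
       (auto simp: P2_def part_keys lookup_single when_def)
  let ?n = "Poly_Mapping.single cX 2 + Poly_Mapping.single cY (k - 1) + Poly_Mapping.single cZ (k - 1)"
  have P3: "Poly_Mapping.lookup m cX = 2 \<and> Poly_Mapping.lookup m cY = k - 1 \<and> Poly_Mapping.lookup m cZ = k - 1"
    if m: "m \<in> Poly_Mapping.keys P3" for m
  proof -
    have "Poly_Mapping.lookup m cX \<le> 2" "Poly_Mapping.lookup m cY < k" "Poly_Mapping.lookup m cZ < k"
      using m P(2) by (auto simp: P3_def part_keys reduced_def)
    moreover have "Poly_Mapping.lookup m cX + Poly_Mapping.lookup m cY + Poly_Mapping.lookup m cZ = 2 * k"
      using b(3) m by (auto simp: bihomogeneous_def bidegree_def Let_def)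
    ultimately show ?thesis by linarith
  qed
  have "Poly_Mapping.lookup ?n v \<le> Poly_Mapping.lookup m v" if "m \<in> Poly_Mapping.keys P3" for m v
    using P3[OF that] by (cases v) (auto simp: lookup_add lookup_single)
  then obtain E where E: "P3 = E * Poly_Mapping.single ?n 1"
    "\<And>m. m \<in> Poly_Mapping.keys E \<Longrightarrow> m + ?n \<in> Poly_Mapping.keys P3"
    using divide_monomial[of P3 ?n] by metis
  show thesis
  proof (rule that[of U W E])
    show "bihomogeneous (e + 2, k) U"
      by (rule bihomogeneous_divide[of _ "6 * k" _ k P1, OF _ _ U(2)]) (use b in \<open>simp_all add: mult_2\<close>)
    show "bihomogeneous (e + 2 + 6 * k, k) W"
      by (rule bihomogeneous_divide[of _ 0 _ k P2, OF _ _ W(2)]) (use b in \<open>simp_all add: mult_2\<close>)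
    have "e + 2 + 6 * k = e + (8 + 6 * (k - 1))" "2 * k = 0 + (2 + (k - 1) + (k - 1))" using k by auto
    then have "bihomogeneous (e + (8 + 6 * (k - 1)), 0 + (2 + (k - 1) + (k - 1))) P3"
      using b(3) by (simp only:)
    moreover have "bidegree ?n = (8 + 6 * (k - 1), 2 + (k - 1) + (k - 1))"
      by (simp add: bidegree_add)
    ultimately show "bihomogeneous (e, 0) E"
      using E(2) by (rule bihomogeneous_divide)
    show "reduced U" "reduced W"
      using P(2) U(2) W(2) unfolding reduced_def P1_def P2_def part_keys
      by (fastforce simp: lookup_add lookup_single)+
  qed (simp add: sum U W E)
qed

text \<open>A binary form of degree \<open>4k\<close>, divided by \<open>(st)\<^bsup>2k\<^esup>\<close>, is a polynomial in \<open>t/s\<close> plus a polynomial in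
  \<open>s/t\<close>: the projective line has no first cohomology.\<close>

lemma split_form:
  assumes p: "bihomogeneous (4 * k, 0) p"
  obtains q r :: "(svar, 'k) mpoly" where
    "p = q * Poly_Mapping.single (Poly_Mapping.single cT (2 * k)) 1 + r * Poly_Mapping.single (Poly_Mapping.single cS (2 * k)) 1"
    "bihomogeneous (2 * k, 0) q" "bihomogeneous (2 * k, 0) r"
proof -
  let ?R = "\<lambda>m. 2 * k \<le> Poly_Mapping.lookup m cT"
  have b: "bihomogeneous (4 * k, 0) (part ?R p)" "bihomogeneous (4 * k, 0) (part (\<lambda>m. \<not> ?R m) p)"
    by (intro bihomogeneous_part p)+
  obtain q where q: "part ?R p = q * Poly_Mapping.single (Poly_Mapping.single cT (2 * k)) 1"
    "\<And>m. m \<in> Poly_Mapping.keys q \<Longrightarrow> m + Poly_Mapping.single cT (2 * k) \<in> Poly_Mapping.keys (part ?R p)"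
    by (rule divide_monomial[of "part ?R p" "Poly_Mapping.single cT (2 * k)"])
       (auto simp: part_keys lookup_single when_def)
  have "2 * k \<le> Poly_Mapping.lookup m cS" if m: "m \<in> Poly_Mapping.keys (part (\<lambda>m. \<not> ?R m) p)" for m
  proof -
    have "bidegree m = (4 * k, 0)" using m b(2) by (auto simp: bihomogeneous_def)
    then have "Poly_Mapping.lookup m cS + Poly_Mapping.lookup m cT = 4 * k"
      by (auto simp: bidegree_def Let_def)
    moreover have "Poly_Mapping.lookup m cT < 2 * k" using m by (auto simp: part_keys)
    ultimately show ?thesis by linarith
  qed
  then obtain r where r: "part (\<lambda>m. \<not> ?R m) p = r * Poly_Mapping.single (Poly_Mapping.single cS (2 * k)) 1"
    "\<And>m. m \<in> Poly_Mapping.keys r \<Longrightarrow> m + Poly_Mapping.single cS (2 * k) \<in> Poly_Mapping.keys (part (\<lambda>m. \<not> ?R m) p)"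
    by (rule_tac divide_monomial[of "part (\<lambda>m. \<not> ?R m) p" "Poly_Mapping.single cS (2 * k)"])
       (auto simp: lookup_single when_def)
  show thesis
  proof (rule that[of q r])
    show "p = q * Poly_Mapping.single (Poly_Mapping.single cT (2 * k)) 1 + r * Poly_Mapping.single (Poly_Mapping.single cS (2 * k)) 1"
      using part_add_part_not[of ?R p] q(1) r(1) by simp
    show "bihomogeneous (2 * k, 0) q"
      by (rule bihomogeneous_divide[of _ "2 * k" _ 0 "part ?R p", OF _ _ q(2)]) (use b in \<open>simp_all add: mult_2[symmetric]\<close>)
    show "bihomogeneous (2 * k, 0) r"
      by (rule bihomogeneous_divide[of _ "2 * k" _ 0 "part (\<lambda>m. \<not> ?R m) p", OF _ _ r(2)]) (use b in \<open>simp_all add: mult_2[symmetric]\<close>)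
  qed
qed

text \<open>The hypothesis is the cocycle identity cleared of denominators. The exceptional parts must cancel against each
  other, but one of them is divisible by \<open>t\<^bsup>2k\<^esup>\<close> and the other by \<open>s\<^bsup>2k\<^esup>\<close>, while their cofactors have degree
  \<open>2k - 2\<close>, so that they have no monomial in common: the sheaf of fiberwise first cohomology groups is
  \<open>\<O>(-2)\<close>, which has no sections. What remains has the form \<open>L y\<^bsup>2k\<^esup> = N z\<^bsup>2k\<^esup>\<close>, and by degrees \<open>L = p z\<^bsup>2k\<^esup>\<close>,
  \<open>N = p y\<^bsup>2k\<^esup>\<close> for a binary form \<open>p\<close>.\<close>

lemma cocycle_splits:
  fixes U1 W1 E1 U3 W3 E3 P13 P24 :: "(svar, 'k) mpoly"
    and k :: nat
  defines "sg \<equiv> \<lambda>i n. Poly_Mapping.single (Poly_Mapping.single i n) (1 :: 'k)"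
  defines "ex \<equiv> Poly_Mapping.single (Poly_Mapping.single cX 2 + Poly_Mapping.single cY (2 * k - 1)
      + Poly_Mapping.single cZ (2 * k - 1)) (1 :: 'k)"
  assumes k: "k > 0"
    and bE: "bihomogeneous (2 * k - 2, 0) E1" "bihomogeneous (2 * k - 2, 0) E3"
    and bU: "bihomogeneous (2 * k, k) U1" "bihomogeneous (2 * k, k) U3"
    and bP: "bihomogeneous (2 * k, 2 * k) P13"
    and Q0: "U1 * (sg cT (2 * k) * sg cY (2 * k) * sg cZ k) + W1 * (sg cT (2 * k) * sg cY k * sg cZ (2 * k))
       + E1 * (sg cT (2 * k) * ex) + P24 * (sg cS k * sg cT k * sg cZ (2 * k))
       - P13 * (sg cS k * sg cT k * sg cY (2 * k))
       - U3 * (sg cS (2 * k) * sg cY (2 * k) * sg cZ k) - W3 * (sg cS (2 * k) * sg cY k * sg cZ (2 * k))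
       - E3 * (sg cS (2 * k) * ex) = 0"
  obtains p where "E1 = 0" "E3 = 0" "bihomogeneous (4 * k, 0) p"
    "P13 * (sg cS k * sg cT k) = U1 * (sg cT (2 * k) * sg cZ k) - U3 * (sg cS (2 * k) * sg cZ k) - p * sg cZ (2 * k)"
    "P24 * (sg cS k * sg cT k) = W3 * (sg cS (2 * k) * sg cY k) - W1 * (sg cT (2 * k) * sg cY k) - p * sg cY (2 * k)"
proof -
  note sgs = sg_def ex_def mult_single
  have Eexp: "Poly_Mapping.lookup m cX = 0 \<and> Poly_Mapping.lookup m cY = 0 \<and> Poly_Mapping.lookup m cZ = 0
      \<and> Poly_Mapping.lookup m cS + Poly_Mapping.lookup m cT = 2 * k - 2"
    if "m \<in> Poly_Mapping.keys E" "bihomogeneous (2 * k - 2, 0) E" for m and E :: "(svar, 'k) mpoly"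
  proof -
    have "bidegree m = (2 * k - 2, 0)" using that by (auto simp: bihomogeneous_def)
    then show ?thesis by (auto simp: bidegree_def Let_def)
  qed
  have look: "Poly_Mapping.lookup (U1 * (sg cT (2 * k) * sg cY (2 * k) * sg cZ k) + W1 * (sg cT (2 * k) * sg cY k * sg cZ (2 * k))
       + E1 * (sg cT (2 * k) * ex) + P24 * (sg cS k * sg cT k * sg cZ (2 * k))
       - P13 * (sg cS k * sg cT k * sg cY (2 * k))
       - U3 * (sg cS (2 * k) * sg cY (2 * k) * sg cZ k) - W3 * (sg cS (2 * k) * sg cY k * sg cZ (2 * k))
       - E3 * (sg cS (2 * k) * ex)) M =
       Poly_Mapping.lookup (E1 * (sg cT (2 * k) * ex)) M - Poly_Mapping.lookup (E3 * (sg cS (2 * k) * ex)) M"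
    if "Poly_Mapping.lookup M cY < 2 * k" "Poly_Mapping.lookup M cZ < 2 * k" for M
  proof -
    have "Poly_Mapping.lookup (U1 * (sg cT (2 * k) * sg cY (2 * k) * sg cZ k)) M = 0"
      "Poly_Mapping.lookup (P13 * (sg cS k * sg cT k * sg cY (2 * k))) M = 0"
      "Poly_Mapping.lookup (U3 * (sg cS (2 * k) * sg cY (2 * k) * sg cZ k)) M = 0"
      unfolding sgs by (rule lookup_mult_single_eq_0[of _ cY]; use that in \<open>simp add: lookup_add lookup_single\<close>)+
    moreover have "Poly_Mapping.lookup (W1 * (sg cT (2 * k) * sg cY k * sg cZ (2 * k))) M = 0"
      "Poly_Mapping.lookup (P24 * (sg cS k * sg cT k * sg cZ (2 * k))) M = 0"
      "Poly_Mapping.lookup (W3 * (sg cS (2 * k) * sg cY k * sg cZ (2 * k))) M = 0"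
      unfolding sgs by (rule lookup_mult_single_eq_0[of _ cZ]; use that in \<open>simp add: lookup_add lookup_single\<close>)+
    ultimately show ?thesis by (simp only: lookup_add lookup_minus) simp
  qed
  let ?e = "Poly_Mapping.single cX 2 + Poly_Mapping.single cY (2 * k - 1) + Poly_Mapping.single cZ (2 * k - 1)"
  have E1: "E1 = 0"
  proof (rule ccontr)
    assume "E1 \<noteq> 0"
    then obtain m where m: "m \<in> Poly_Mapping.keys E1" by fastforce
    let ?M = "m + (Poly_Mapping.single cT (2 * k) + ?e)"
    have "Poly_Mapping.lookup (E1 * (sg cT (2 * k) * ex)) ?M = Poly_Mapping.lookup E1 m"
      using lookup_mult_single[of E1 "Poly_Mapping.single cT (2 * k) + ?e" 1 m] by (simp add: sgs)
    moreover have "Poly_Mapping.lookup (E3 * (sg cS (2 * k) * ex)) ?M = 0"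
      unfolding sgs by (rule lookup_mult_single_eq_0[of _ cS])
        (use k Eexp[OF m bE(1)] in \<open>auto simp: lookup_add lookup_single\<close>)
    ultimately show False
      using look[of ?M] Q0 Eexp[OF m bE(1)] k m by (simp add: lookup_add lookup_single in_keys_iff)
  qed
  have E3: "E3 = 0"
  proof (rule ccontr)
    assume "E3 \<noteq> 0"
    then obtain m where m: "m \<in> Poly_Mapping.keys E3" by fastforce
    let ?M = "m + (Poly_Mapping.single cS (2 * k) + ?e)"
    have "Poly_Mapping.lookup (E3 * (sg cS (2 * k) * ex)) ?M = Poly_Mapping.lookup E3 m"
      using lookup_mult_single[of E3 "Poly_Mapping.single cS (2 * k) + ?e" 1 m] by (simp add: sgs)
    moreover have "Poly_Mapping.lookup (E1 * (sg cT (2 * k) * ex)) ?M = 0"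
      by (simp add: E1)
    ultimately show False
      using look[of ?M] Q0 Eexp[OF m bE(2)] k m by (simp add: lookup_add lookup_single in_keys_iff)
  qed
  define L where "L = U1 * (sg cT (2 * k) * sg cZ k) - U3 * (sg cS (2 * k) * sg cZ k) - P13 * (sg cS k * sg cT k)"
  define N where "N = W3 * (sg cS (2 * k) * sg cY k) - W1 * (sg cT (2 * k) * sg cY k) - P24 * (sg cS k * sg cT k)"
  have LN: "L * sg cY (2 * k) = N * sg cZ (2 * k)"
    using Q0 unfolding L_def N_def E1 E3 by (simp add: algebra_simps)
  have bL: "bihomogeneous (4 * k, 2 * k) L"
    unfolding L_def sgs
    by (intro bihomogeneous_diff bihomogeneous_mult'[OF bU(1)] bihomogeneous_mult'[OF bU(2)]
          bihomogeneous_mult'[OF bP] bihomogeneous_single) (simp_all add: bidegree_add)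
  have keysL: "Poly_Mapping.lookup m cX = 0 \<and> Poly_Mapping.lookup m cY = 0 \<and> Poly_Mapping.lookup m cZ = 2 * k"
    if m: "m \<in> Poly_Mapping.keys L" for m
  proof -
    have "Poly_Mapping.lookup (L * sg cY (2 * k)) (m + Poly_Mapping.single cY (2 * k)) \<noteq> 0"
      using m by (simp add: sg_def lookup_mult_single in_keys_iff)
    then have "\<not> Poly_Mapping.lookup (m + Poly_Mapping.single cY (2 * k)) cZ < 2 * k"
      unfolding LN using lookup_mult_single_eq_0[of "m + Poly_Mapping.single cY (2 * k)" cZ "Poly_Mapping.single cZ (2 * k)" N 1]
      by (auto simp: sg_def)
    then have "Poly_Mapping.lookup m cZ \<ge> 2 * k" by (simp add: lookup_add lookup_single)
    moreover have "Poly_Mapping.lookup m cX + Poly_Mapping.lookup m cY + Poly_Mapping.lookup m cZ = 2 * k"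
      using bL m by (auto simp: bihomogeneous_def bidegree_def Let_def)
    ultimately show ?thesis by auto
  qed
  obtain p where p: "L = p * Poly_Mapping.single (Poly_Mapping.single cZ (2 * k)) 1"
    "\<And>m. m \<in> Poly_Mapping.keys p \<Longrightarrow> m + Poly_Mapping.single cZ (2 * k) \<in> Poly_Mapping.keys L"
    by (rule divide_monomial[of L "Poly_Mapping.single cZ (2 * k)"])
       (auto simp: keysL lookup_single when_def)
  have bp: "bihomogeneous (4 * k, 0) p"
    by (rule bihomogeneous_divide[of _ 0 _ "2 * k" L, OF _ _ p(2)]) (use bL in auto)
  have "(p * sg cY (2 * k)) * sg cZ (2 * k) = N * sg cZ (2 * k)"
    using LN p(1) by (simp add: sg_def ac_simps)
  then have "p * sg cY (2 * k) = N"
    unfolding sg_def by (rule mult_single_cancel)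
  with p(1) show thesis
    by (intro that[OF E1 E3 bp]) (simp_all add: L_def N_def sg_def algebra_simps)
qed

text \<open>The charts \<open>sz\<close>, \<open>sy\<close>, \<open>tz\<close>, \<open>ty\<close> carry the numbers 1 to 4. The components \<open>g\<^sub>1\<^sub>2\<close> and \<open>g\<^sub>3\<^sub>4\<close> live over one chart of
  the base and split fiberwise up to the exceptional monomials; the components \<open>g\<^sub>1\<^sub>3\<close> and \<open>g\<^sub>2\<^sub>4\<close> force the
  exceptional parts to vanish and determine the rest up to a binary form, which splits on the base.\<close>

lemma H1_structure_sheaf_vanishes_G: "H1_structure_sheaf_vanishes G"
  unfolding H1_structure_sheaf_vanishes_def
proof (intro allI impI, elim conjE)
  fix g
  assume reg: "\<forall>a\<in>charts. \<forall>b\<in>charts. regular_on G (a + b) (g a b)"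
    and coc: "\<forall>a\<in>charts. \<forall>b\<in>charts. \<forall>c\<in>charts. \<forall>p\<in>locus G (a + b + c). g a c p = g a b p + g b c p"
  let ?sz = "chart cS cZ" and ?sy = "chart cS cY" and ?tz = "chart cT cZ" and ?ty = "chart cT cY"
  have r: "regular_on G (?sz + ?sy) (g ?sz ?sy)" "regular_on G (?tz + ?ty) (g ?tz ?ty)"
    "regular_on G (?sz + ?tz) (g ?sz ?tz)" "regular_on G (?sy + ?ty) (g ?sy ?ty)"
    using reg by (auto simp: charts_eq)
  obtain k1 where k1: "\<And>k. k \<ge> k1 \<Longrightarrow> \<exists>P. bihomogeneous (k * fst (bidegree (?sz + ?sy)), k * snd (bidegree (?sz + ?sy))) P \<and>
     reduced P \<and> (\<forall>p\<in>locus G (?sz + ?sy). g ?sz ?sy p = meval p P / monval p (?sz + ?sy) ^ k)"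
    using regular_on_reduced[OF r(1)] by metis
  obtain k2 where k2: "\<And>k. k \<ge> k2 \<Longrightarrow> \<exists>P. bihomogeneous (k * fst (bidegree (?tz + ?ty)), k * snd (bidegree (?tz + ?ty))) P \<and>
     reduced P \<and> (\<forall>p\<in>locus G (?tz + ?ty). g ?tz ?ty p = meval p P / monval p (?tz + ?ty) ^ k)"
    using regular_on_reduced[OF r(2)] by metis
  obtain k3 where k3: "\<And>k. k \<ge> k3 \<Longrightarrow> \<exists>P. bihomogeneous (k * fst (bidegree (?sz + ?tz)), k * snd (bidegree (?sz + ?tz))) P \<and>
     reduced P \<and> (\<forall>p\<in>locus G (?sz + ?tz). g ?sz ?tz p = meval p P / monval p (?sz + ?tz) ^ k)"
    using regular_on_reduced[OF r(3)] by metis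
  obtain k4 where k4: "\<And>k. k \<ge> k4 \<Longrightarrow> \<exists>P. bihomogeneous (k * fst (bidegree (?sy + ?ty)), k * snd (bidegree (?sy + ?ty))) P \<and>
     reduced P \<and> (\<forall>p\<in>locus G (?sy + ?ty). g ?sy ?ty p = meval p P / monval p (?sy + ?ty) ^ k)"
    using regular_on_reduced[OF r(4)] by metis
  define k where "k = Suc (k1 + k2 + k3 + k4)"
  have k: "k > 0" "k \<ge> k1" "k \<ge> k2" "k \<ge> k3" "k \<ge> k4" by (auto simp: k_def)
  have bd: "bidegree (?sz + ?sy) = (8, 2)" "bidegree (?tz + ?ty) = (8, 2)" "bidegree (?sz + ?tz) = (2, 2)"
    by (simp_all add: bidegree_add)
  have kk: "k * fst (8 :: nat, 2 :: nat) = 2 * k - 2 + 2 + 6 * k" "k * snd (8 :: nat, 2 :: nat) = 2 * k"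
    "k * fst (2 :: nat, 2 :: nat) = 2 * k" "k * snd (2 :: nat, 2 :: nat) = 2 * k"
    using k(1) by auto
  obtain P12 where P12: "bihomogeneous (2 * k - 2 + 2 + 6 * k, 2 * k) P12" "reduced P12"
    "\<And>p. p \<in> locus G (?sz + ?sy) \<Longrightarrow> g ?sz ?sy p = meval p P12 / monval p (?sz + ?sy) ^ k"
    using k1[OF k(2)] unfolding bd kk by blast
  obtain P34 where P34: "bihomogeneous (2 * k - 2 + 2 + 6 * k, 2 * k) P34" "reduced P34"
    "\<And>p. p \<in> locus G (?tz + ?ty) \<Longrightarrow> g ?tz ?ty p = meval p P34 / monval p (?tz + ?ty) ^ k"
    using k2[OF k(3)] unfolding bd kk by blast
  obtain P13 where P13: "bihomogeneous (2 * k, 2 * k) P13" "reduced P13"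
    "\<And>p. p \<in> locus G (?sz + ?tz) \<Longrightarrow> g ?sz ?tz p = meval p P13 / monval p (?sz + ?tz) ^ k"
    using k3[OF k(4)] unfolding bd kk by blast
  obtain P24 where P24: "reduced P24"
    "\<And>p. p \<in> locus G (?sy + ?ty) \<Longrightarrow> g ?sy ?ty p = meval p P24 / monval p (?sy + ?ty) ^ k"
    using k4[OF k(5)] by blast
  let ?sg = "\<lambda>i n. Poly_Mapping.single (Poly_Mapping.single i n) (1 :: 'k)"
  let ?x = "\<lambda>l. Poly_Mapping.single (Poly_Mapping.single cX 2 + Poly_Mapping.single cY (l - 1) + Poly_Mapping.single cZ (l - 1)) (1 :: 'k)"
  obtain U1 W1 E1 where 1: "P12 = U1 * ?sg cY k + W1 * ?sg cZ k + E1 * ?x k"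
    "bihomogeneous (2 * k - 2 + 2, k) U1" "bihomogeneous (2 * k - 2 + 2 + 6 * k, k) W1"
    "bihomogeneous (2 * k - 2, 0) E1" "reduced U1" "reduced W1"
    using split_fiberwise[OF P12(1,2) k(1)] by metis
  obtain U3 W3 E3 where 3: "P34 = U3 * ?sg cY k + W3 * ?sg cZ k + E3 * ?x k"
    "bihomogeneous (2 * k - 2 + 2, k) U3" "bihomogeneous (2 * k - 2 + 2 + 6 * k, k) W3"
    "bihomogeneous (2 * k - 2, 0) E3" "reduced U3" "reduced W3"
    using split_fiberwise[OF P34(1,2) k(1)] by metis
  have k2': "2 * k - 2 + 2 = 2 * k" using k(1) by simp
  have ev: "meval p (?sg i n) = p i ^ n" for p i n by (simp add: meval_simps)
  have evx: "meval p (?x l) = p cX ^ 2 * p cY ^ (l - 1) * p cZ ^ (l - 1)" for p l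
    by (simp add: meval_simps monval_add)
  have loc: "p \<in> locus G (chart i j + chart i' j') \<longleftrightarrow> p \<in> cone G \<and> p i \<noteq> 0 \<and> p j \<noteq> 0 \<and> p i' \<noteq> 0 \<and> p j' \<noteq> 0" for p i j i' j'
    by (auto simp: locus_iff monval_add)
  have loc3: "p \<in> locus G (chart i j + chart i' j' + chart i'' j'') \<longleftrightarrow>
      p \<in> cone G \<and> p i \<noteq> 0 \<and> p j \<noteq> 0 \<and> p i' \<noteq> 0 \<and> p j' \<noteq> 0 \<and> p i'' \<noteq> 0 \<and> p j'' \<noteq> 0" for p i j i' j' i'' j''
    by (auto simp: locus_iff monval_add)
  \<comment> \<open>the identity \<open>g\<^sub>1\<^sub>2 + g\<^sub>2\<^sub>4 - g\<^sub>1\<^sub>3 - g\<^sub>3\<^sub>4 = 0\<close>, multiplied by \<open>(styz)\<^bsup>2k\<^esup>\<close>\<close>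
  let ?Q = "U1 * (?sg cT (2 * k) * ?sg cY (2 * k) * ?sg cZ k) + W1 * (?sg cT (2 * k) * ?sg cY k * ?sg cZ (2 * k))
       + E1 * (?sg cT (2 * k) * ?x (2 * k)) + P24 * (?sg cS k * ?sg cT k * ?sg cZ (2 * k))
       - P13 * (?sg cS k * ?sg cT k * ?sg cY (2 * k))
       - U3 * (?sg cS (2 * k) * ?sg cY (2 * k) * ?sg cZ k) - W3 * (?sg cS (2 * k) * ?sg cY k * ?sg cZ (2 * k))
       - E3 * (?sg cS (2 * k) * ?x (2 * k))"
  have "?Q = 0"
  proof (rule reduced_zero_if_vanishing)
    have rE: "reduced (E * Poly_Mapping.single n 1)" if "bihomogeneous (2 * k - 2, 0) E" "Poly_Mapping.lookup n cX \<le> 2" for E n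
    proof -
      have "Poly_Mapping.lookup m cX = 0" if "m \<in> Poly_Mapping.keys E" for m
        using that \<open>bihomogeneous (2 * k - 2, 0) E\<close> by (auto simp: bihomogeneous_def bidegree_def Let_def)
      then show ?thesis
        using keys_mult[of E "Poly_Mapping.single n (1 :: 'k)"] that(2)
        by (fastforce simp: reduced_def lookup_add)
    qed
    show "reduced ?Q"
      unfolding mult_single mult_1
      by (intro reduced_diff reduced_add rE[OF 1(4)] rE[OF 3(4)] reduced_single_mult[OF 1(5)] reduced_single_mult[OF 1(6)]
            reduced_single_mult[OF 3(5)] reduced_single_mult[OF 3(6)] reduced_single_mult[OF P13(2)]
            reduced_single_mult[OF P24(1)])
         (simp_all add: lookup_add lookup_single)
    show "infinite (- {0 :: 'k})"
      using infinite_UNIV_char_0[where 'a = 'k] by (simp add: Compl_eq_Diff_UNIV)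
    fix p assume p: "p \<in> cone G" "p cS \<noteq> 0" "p cZ \<noteq> 0" "p cY \<noteq> 0" "p cT / p cS \<in> - {0}"
    then have t: "p cT \<noteq> 0" by auto
    have "g ?sz ?ty p = g ?sz ?sy p + g ?sy ?ty p" "g ?sz ?ty p = g ?sz ?tz p + g ?tz ?ty p"
      by (rule coc[rule_format]; use p t in \<open>auto simp: charts_eq loc3 simp del: One_nat_def\<close>)+
    then have rel: "g ?sz ?sy p + g ?sy ?ty p - g ?sz ?tz p - g ?tz ?ty p = 0" by simp
    define s t y z x where "s = p cS" and "t = p cT" and "y = p cY" and "z = p cZ" and "x = p cX"
    have nz: "s \<noteq> 0" "t \<noteq> 0" "y \<noteq> 0" "z \<noteq> 0" using p \<open>p cT \<noteq> 0\<close> by (auto simp: s_def t_def y_def z_def)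
    define a where "a = (\<lambda>P. meval p P)"
    have g12: "g ?sz ?sy p * (s ^ (2 * k) * y ^ k * z ^ k) = a U1 * y ^ k + a W1 * z ^ k + a E1 * (x ^ 2 * y ^ (k - 1) * z ^ (k - 1))"
      using p nz by (subst P12(3))
         (auto simp: loc 1(1) meval_simps(4,7) ev evx monval_add power_mult_distrib power_mult a_def s_def y_def z_def x_def power2_eq_square simp del: One_nat_def)
    have g34: "g ?tz ?ty p * (t ^ (2 * k) * y ^ k * z ^ k) = a U3 * y ^ k + a W3 * z ^ k + a E3 * (x ^ 2 * y ^ (k - 1) * z ^ (k - 1))"
      using p nz \<open>p cT \<noteq> 0\<close> by (subst P34(3))
         (auto simp: loc 3(1) meval_simps(4,7) ev evx monval_add power_mult_distrib power_mult a_def t_def y_def z_def x_def power2_eq_square simp del: One_nat_def)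
    have g13: "g ?sz ?tz p * (s ^ k * t ^ k * z ^ (2 * k)) = a P13"
      using p nz \<open>p cT \<noteq> 0\<close> by (subst P13(3))
         (auto simp: loc monval_add power_mult_distrib power_mult a_def s_def t_def z_def power2_eq_square simp del: One_nat_def)
    have g24: "g ?sy ?ty p * (s ^ k * t ^ k * y ^ (2 * k)) = a P24"
      using p nz \<open>p cT \<noteq> 0\<close> by (subst P24(2))
         (auto simp: loc monval_add power_mult_distrib power_mult a_def s_def t_def y_def power2_eq_square simp del: One_nat_def)
    have pk: "v ^ (2 * k - 1) = v ^ (k - 1) * v ^ k" "v ^ (2 * k) = v ^ k * v ^ k" for v :: 'k
      using k(1) by (simp_all flip: power_add add: mult_2)
    have "meval p ?Q = (a U1 * y ^ k + a W1 * z ^ k + a E1 * (x ^ 2 * y ^ (k - 1) * z ^ (k - 1))) * (t ^ (2 * k) * y ^ k * z ^ k)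
       + a P24 * (s ^ k * t ^ k * z ^ (2 * k)) - a P13 * (s ^ k * t ^ k * y ^ (2 * k))
       - (a U3 * y ^ k + a W3 * z ^ k + a E3 * (x ^ 2 * y ^ (k - 1) * z ^ (k - 1))) * (s ^ (2 * k) * y ^ k * z ^ k)"
      unfolding id_hom.mev_add[folded meval_eq_mev] id_hom.mev_diff[folded meval_eq_mev]
        id_hom.mev_mult[folded meval_eq_mev] ev evx pk
      unfolding a_def s_def t_def x_def y_def z_def by (simp add: algebra_simps)
    also have "\<dots> = (g ?sz ?sy p + g ?sy ?ty p - g ?sz ?tz p - g ?tz ?ty p) * (s ^ (2 * k) * t ^ (2 * k) * y ^ (2 * k) * z ^ (2 * k))"
      unfolding g12[symmetric] g34[symmetric] g13[symmetric] g24[symmetric] pk by (simp add: algebra_simps)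
    finally show "meval p ?Q = 0" unfolding rel by simp
  qed
  then obtain q where q: "E1 = 0" "E3 = 0" "bihomogeneous (4 * k, 0) q"
    "P13 * (?sg cS k * ?sg cT k) = U1 * (?sg cT (2 * k) * ?sg cZ k) - U3 * (?sg cS (2 * k) * ?sg cZ k) - q * ?sg cZ (2 * k)"
    "P24 * (?sg cS k * ?sg cT k) = W3 * (?sg cS (2 * k) * ?sg cY k) - W1 * (?sg cT (2 * k) * ?sg cY k) - q * ?sg cY (2 * k)"
    using cocycle_splits[OF k(1) 1(4) 3(4) 1(2)[unfolded k2'] 3(2)[unfolded k2'] P13(1), of W1 P24 W3] by metis
  obtain r1 r3 where r: "q = r1 * ?sg cT (2 * k) + r3 * ?sg cS (2 * k)"
    "bihomogeneous (2 * k, 0) r1" "bihomogeneous (2 * k, 0) r3"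
    using split_form[OF q(3)] by metis
  let ?H = "\<lambda>P i j (p :: svar \<Rightarrow> 'k). meval p P / (p i ^ (2 * k) * p j ^ k)"
  \<comment> \<open>\<open>g\<^sub>1\<^sub>2 = h2 - h1\<close> and \<open>g\<^sub>3\<^sub>4 = h4 - h3\<close> hold for any \<open>r1\<close>, \<open>r3\<close>; these two correct \<open>g\<^sub>1\<^sub>3\<close> and \<open>g\<^sub>2\<^sub>4\<close>\<close>
  define h1 h2 h3 h4 where "h1 = ?H (r1 * ?sg cZ k - U1) cS cZ" and "h2 = ?H (r1 * ?sg cY k + W1) cS cY"
    and "h3 = ?H (- (r3 * ?sg cZ k) - U3) cT cZ" and "h4 = ?H (W3 - r3 * ?sg cY k) cT cY"
  define h where "h = (\<lambda>a. if a = ?sz then h1 else if a = ?sy then h2 else if a = ?tz then h3 else h4)"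
  have h: "h ?sz = h1" "h ?sy = h2" "h ?tz = h3" "h ?ty = h4"
  proof -
    have "?sy \<noteq> ?sz" "?tz \<noteq> ?sz" "?tz \<noteq> ?sy" "?ty \<noteq> ?sz" "?ty \<noteq> ?sy" "?ty \<noteq> ?tz"
      by (subst chart_inj; simp)+
    then show "h ?sz = h1" "h ?sy = h2" "h ?tz = h3" "h ?ty = h4"
      unfolding h_def by (simp_all only: if_False if_True simp_thms)
  qed
  have rz: "bihomogeneous (2 * k, k) (r * ?sg cZ k)" "bihomogeneous (2 * k + 6 * k, k) (r * ?sg cY k)"
    if "bihomogeneous (2 * k, 0) r" for r
    using that by (auto intro!: bihomogeneous_mult' bihomogeneous_single)
  have "regular_on G a (h a)" if "a \<in> charts" for a
  proof -
    note b = 1(2,3)[unfolded k2'] 3(2,3)[unfolded k2'] rz[OF r(2)] rz[OF r(3)]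
    have "regular_on G ?sz h1" unfolding h1_def
      by (rule regular_onI[where a = "2 * k" and b = k]) (use b in \<open>auto intro!: bihomogeneous_diff\<close>)
    moreover have "regular_on G ?sy h2" unfolding h2_def
      by (rule regular_onI[where a = "2 * k" and b = k]) (use b in \<open>auto intro!: bihomogeneous_add\<close>)
    moreover have "regular_on G ?tz h3" unfolding h3_def
      by (rule regular_onI[where a = "2 * k" and b = k]) (use b in \<open>auto intro!: bihomogeneous_diff bihomogeneous_uminus\<close>)
    moreover have "regular_on G ?ty h4" unfolding h4_def
      by (rule regular_onI[where a = "2 * k" and b = k]) (use b in \<open>auto intro!: bihomogeneous_diff\<close>)
    ultimately show ?thesis using that h unfolding charts_eq by auto
  qed
  moreover have "g a b p = h b p - h a p" if "a \<in> charts" "b \<in> charts" "p \<in> locus G (a + b)" for a b p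
  proof -
    note ev' = id_hom.mev_add[folded meval_eq_mev] id_hom.mev_diff[folded meval_eq_mev]
        id_hom.mev_mult[folded meval_eq_mev] id_hom.mev_uminus[folded meval_eq_mev] id_hom.mev_0[folded meval_eq_mev] ev
    have pk: "v ^ (2 * k) = v ^ k * v ^ k" for v :: 'k
      by (simp flip: power_add add: mult_2)
    have e12: "g ?sz ?sy p = h ?sy p - h ?sz p" if "p \<in> locus G (?sz + ?sy)" for p
    proof -
      have nz: "p cS \<noteq> 0" "p cZ \<noteq> 0" "p cY \<noteq> 0" using that by (auto simp: loc simp del: One_nat_def)
      have "monval p (?sz + ?sy) ^ k = p cS ^ (2 * k) * p cZ ^ k * p cY ^ k"
        by (simp add: monval_add power_mult_distrib pk)
      then show ?thesis
        unfolding P12(3)[OF that] h h1_def h2_def 1(1) q(1) ev' using nz by (simp add: field_simps)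
    qed
    have e34: "g ?tz ?ty p = h ?ty p - h ?tz p" if "p \<in> locus G (?tz + ?ty)" for p
    proof -
      have nz: "p cT \<noteq> 0" "p cZ \<noteq> 0" "p cY \<noteq> 0" using that by (auto simp: loc simp del: One_nat_def)
      have "monval p (?tz + ?ty) ^ k = p cT ^ (2 * k) * p cZ ^ k * p cY ^ k"
        by (simp add: monval_add power_mult_distrib pk)
      then show ?thesis
        unfolding P34(3)[OF that] h h3_def h4_def 3(1) q(2) ev' using nz by (simp add: field_simps)
    qed
    have e13: "g ?sz ?tz p = h ?tz p - h ?sz p" if "p \<in> locus G (?sz + ?tz)" for p
    proof -
      have nz: "p cS \<noteq> 0" "p cZ \<noteq> 0" "p cT \<noteq> 0" using that by (auto simp: loc simp del: One_nat_def)
      have m: "monval p (?sz + ?tz) ^ k = p cS ^ k * p cT ^ k * (p cZ ^ k * p cZ ^ k)"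
        by (simp add: monval_add power_mult_distrib)
      have "meval p P13 * (p cS ^ k * p cT ^ k) = meval p U1 * (p cT ^ k * p cT ^ k * p cZ ^ k)
          - meval p U3 * (p cS ^ k * p cS ^ k * p cZ ^ k)
          - (meval p r1 * (p cT ^ k * p cT ^ k) + meval p r3 * (p cS ^ k * p cS ^ k)) * (p cZ ^ k * p cZ ^ k)"
        using arg_cong[OF q(4), of "meval p"] unfolding r(1) ev' pk by simp
      then have P13': "meval p P13 = (meval p U1 * (p cT ^ k * p cT ^ k * p cZ ^ k)
          - meval p U3 * (p cS ^ k * p cS ^ k * p cZ ^ k)
          - (meval p r1 * (p cT ^ k * p cT ^ k) + meval p r3 * (p cS ^ k * p cS ^ k)) * (p cZ ^ k * p cZ ^ k)) / (p cS ^ k * p cT ^ k)"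
        using nz by (simp add: nonzero_eq_divide_eq)
      show ?thesis
        unfolding P13(3)[OF that] h h1_def h3_def m ev' P13' pk using nz by (simp add: divide_simps) (simp add: algebra_simps)
    qed
    have e24: "g ?sy ?ty p = h ?ty p - h ?sy p" if "p \<in> locus G (?sy + ?ty)" for p
    proof -
      have nz: "p cS \<noteq> 0" "p cY \<noteq> 0" "p cT \<noteq> 0" using that by (auto simp: loc simp del: One_nat_def)
      have m: "monval p (?sy + ?ty) ^ k = p cS ^ k * p cT ^ k * (p cY ^ k * p cY ^ k)"
        by (simp add: monval_add power_mult_distrib)
      have "meval p P24 * (p cS ^ k * p cT ^ k) = meval p W3 * (p cS ^ k * p cS ^ k * p cY ^ k)
          - meval p W1 * (p cT ^ k * p cT ^ k * p cY ^ k)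
          - (meval p r1 * (p cT ^ k * p cT ^ k) + meval p r3 * (p cS ^ k * p cS ^ k)) * (p cY ^ k * p cY ^ k)"
        using arg_cong[OF q(5), of "meval p"] unfolding r(1) ev' pk by simp
      then have P24': "meval p P24 = (meval p W3 * (p cS ^ k * p cS ^ k * p cY ^ k)
          - meval p W1 * (p cT ^ k * p cT ^ k * p cY ^ k)
          - (meval p r1 * (p cT ^ k * p cT ^ k) + meval p r3 * (p cS ^ k * p cS ^ k)) * (p cY ^ k * p cY ^ k)) / (p cS ^ k * p cT ^ k)"
        using nz by (simp add: nonzero_eq_divide_eq)
      show ?thesis
        unfolding P24(2)[OF that] h h2_def h4_def m ev' P24' pk using nz by (simp add: divide_simps) (simp add: algebra_simps)
    qed
    have triv: "g a a p = 0" if "a \<in> charts" "p \<in> locus G (a + a)" for a p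
    proof -
      have "p \<in> locus G (a + a + a)" using that by (auto simp: locus_iff monval_add)
      then show ?thesis using coc[rule_format, of a a a p] that by simp
    qed
    have anti: "g b a p = - g a b p" if "a \<in> charts" "b \<in> charts" "p \<in> locus G (a + b)" for a b p
    proof -
      have "p \<in> locus G (a + b + a)" "p \<in> locus G (a + a)" using that by (auto simp: locus_iff monval_add)
      then show ?thesis
        using coc[rule_format, of a b a p] triv[of a p] that by (simp add: eq_neg_iff_add_eq_0 add.commute)
    qed
    have e14: "g ?sz ?ty p = h ?ty p - h ?sz p" if "p \<in> locus G (?sz + ?ty)" for p
    proof -
      have "g ?sz ?ty p = g ?sz ?sy p + g ?sy ?ty p"
        by (rule coc[rule_format]) (use that in \<open>auto simp: charts_eq loc loc3 simp del: One_nat_def\<close>)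
      then show ?thesis using e12[of p] e24[of p] that by (auto simp: loc simp del: One_nat_def)
    qed
    have e23: "g ?sy ?tz p = h ?tz p - h ?sy p" if "p \<in> locus G (?sy + ?tz)" for p
    proof -
      have "g ?sy ?tz p = g ?sy ?sz p + g ?sz ?tz p"
        by (rule coc[rule_format]) (use that in \<open>auto simp: charts_eq loc loc3 simp del: One_nat_def\<close>)
      moreover have "g ?sy ?sz p = - g ?sz ?sy p"
        by (rule anti) (use that in \<open>auto simp: charts_eq loc simp del: One_nat_def\<close>)
      ultimately show ?thesis using e12[of p] e13[of p] that by (auto simp: loc simp del: One_nat_def)
    qed
    have swap: "g b a p = h a p - h b p" if "a \<in> charts" "b \<in> charts" "p \<in> locus G (b + a)"
      "\<And>p. p \<in> locus G (a + b) \<Longrightarrow> g a b p = h b p - h a p" for a b p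
      using anti[OF that(1,2), of p] that(3,4) by (simp add: add.commute)
    from that(1,2) show ?thesis
      using e12[of p] e13[of p] e14[of p] e23[of p] e24[of p] e34[of p] triv[of a p] that
        swap[OF _ _ _ e12] swap[OF _ _ _ e13] swap[OF _ _ _ e14] swap[OF _ _ _ e23] swap[OF _ _ _ e24] swap[OF _ _ _ e34]
      unfolding charts_eq by (elim insertE emptyE) (simp_all only: simp_thms insert_iff diff_self)
  qed
  ultimately show "\<exists>h. (\<forall>a\<in>charts. regular_on G a (h a)) \<and>
       (\<forall>a\<in>charts. \<forall>b\<in>charts. \<forall>p\<in>locus G (a + b). g a b p = h b p - h a p)"
    by blast
qed

end

section \<open>Smoothness\<close>

lemma meval_numeral: "meval p (numeral n) = numeral n"
  by (subst single_numeral[symmetric]) (simp add: meval_simps del: single_numeral)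

text \<open>Dehomogenization of a binary form on the chart \<open>i \<noteq> 0\<close> of the projective line.\<close>

definition opp :: "svar \<Rightarrow> svar" where
  "opp i = (if i = cS then cT else cS)"

definition affine_form :: "svar \<Rightarrow> (svar, 'k::comm_ring_1) mpoly \<Rightarrow> 'k poly" where
  "affine_form i A = line (\<lambda>_. 1) (opp i) A"

lemma meval_affine_form:
  fixes A :: "(svar, 'k::field) mpoly"
  assumes "A \<in> sections n" "i \<in> {cS, cT}" "p i \<noteq> 0"
  shows "meval p A = p i ^ n * poly (affine_form i A) (p (opp i) / p i)"
proof -
  let ?q = "(\<lambda>_. 1)(opp i := p (opp i) / p i)"
  have "meval p A = meval (act (p i) 1 ?q) A"
    by (rule meval_section_cong[OF assms(1)]) (use assms(2,3) in \<open>auto simp: act_def opp_def\<close>)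
  then show ?thesis
    by (simp add: affine_form_def meval_act[OF bihomogeneous_section[OF assms(1)]])
qed

lemma mpderiv_section:
  assumes "A \<in> sections (Suc n)" "i \<in> {cS, cT}"
  shows "mpderiv i A \<in> sections n"
  unfolding sections_def
proof (rule CollectI, rule ballI)
  fix k assume "k \<in> Poly_Mapping.keys (mpderiv i A)"
  then have "k \<in> (\<Union>m\<in>Poly_Mapping.keys A. Poly_Mapping.keys (Poly_Mapping.single (m - Poly_Mapping.single i 1)
       (of_nat (Poly_Mapping.lookup m i) * Poly_Mapping.lookup A m)))"
    unfolding mpderiv_def by (rule subsetD[OF keys_sum])
  then obtain m where m1: "m \<in> Poly_Mapping.keys A" and k: "k \<in> Poly_Mapping.keys
      (Poly_Mapping.single (m - Poly_Mapping.single i 1) (of_nat (Poly_Mapping.lookup m i) * Poly_Mapping.lookup A m))"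
    by blast
  have "of_nat (Poly_Mapping.lookup m i) * Poly_Mapping.lookup A m \<noteq> 0"
  proof
    assume 0: "of_nat (Poly_Mapping.lookup m i) * Poly_Mapping.lookup A m = 0"
    show False using k unfolding 0 by simp
  qed
  then have m: "m \<in> Poly_Mapping.keys A" "k = m - Poly_Mapping.single i 1" "Poly_Mapping.lookup m i \<noteq> 0"
    using m1 k by (auto simp: gr0_conv_Suc[symmetric] intro!: gr0I split: if_splits)
  have "Poly_Mapping.keys k \<subseteq> {cS, cT}"
  proof (intro subsetI)
    fix v assume "v \<in> Poly_Mapping.keys k"
    then show "v \<in> {cS, cT}"
      using m(2) sections_keys[OF assms(1) m(1)] by (cases v) (auto simp: in_keys_iff lookup_minus)
  qed
  moreover have "Poly_Mapping.lookup k cS + Poly_Mapping.lookup k cT = n"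
    using m(2,3) sections_keys(4)[OF assms(1) m(1)] assms(2) by (auto simp: lookup_minus lookup_single)
  ultimately show "Poly_Mapping.keys k \<subseteq> {cS, cT} \<and> Poly_Mapping.lookup k cS + Poly_Mapping.lookup k cT = n"
    by simp
qed

lemma meval_mpderiv_affine_form:
  fixes A :: "(svar, 'k::field) mpoly"
  assumes "A \<in> sections (Suc n)" "i \<in> {cS, cT}" "p i \<noteq> 0"
  shows "meval p (mpderiv (opp i) A) = p i ^ n * poly (pderiv (affine_form i A)) (p (opp i) / p i)"
proof -
  have "mpderiv (opp i) A \<in> sections n"
    by (rule mpderiv_section[OF assms(1)]) (simp add: opp_def)
  from meval_affine_form[where p = p, OF this assms(2,3)] show ?thesis
    by (simp add: affine_form_def pderiv_line)
qed

lemma meval_mpderiv_times: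
  "p i * meval p (mpderiv i P) = (\<Sum>m\<in>Poly_Mapping.keys P. of_nat (Poly_Mapping.lookup m i) * (Poly_Mapping.lookup P m * monval p m))"
proof -
  have "p i * meval p (Poly_Mapping.single (m - Poly_Mapping.single i 1) (of_nat (Poly_Mapping.lookup m i) * c)) =
      of_nat (Poly_Mapping.lookup m i) * (c * monval p m)" for m c
  proof (cases "Poly_Mapping.lookup m i = 0")
    case False
    then have "monval p m = monval p (m - Poly_Mapping.single i 1 + Poly_Mapping.single i 1)"
      by (subst minus_single_add) auto
    then show ?thesis by (simp add: meval_simps monval_add ac_simps)
  qed (simp add: meval_simps)
  then show ?thesis
    unfolding mpderiv_def meval_sum sum_distrib_left by (intro sum.cong) auto
qed

lemma euler_section:
  assumes "A \<in> sections n"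
  shows "p cS * meval p (mpderiv cS A) + p cT * meval p (mpderiv cT A) = of_nat n * meval p A"
proof -
  have "of_nat (Poly_Mapping.lookup m cS) * c + of_nat (Poly_Mapping.lookup m cT) * c = of_nat n * c"
    if "m \<in> Poly_Mapping.keys A" for m and c :: 'a
    using sections_keys(4)[OF assms that] by (metis distrib_right of_nat_add)
  then show ?thesis
    unfolding meval_mpderiv_times unfolding meval_eq_mev mev_def sum_distrib_left
    by (simp flip: sum.distrib)
qed

lemma poly_bezout:
  fixes p q :: "'k::alg_closed_field poly"
  assumes "\<And>x. poly p x = 0 \<Longrightarrow> poly q x \<noteq> 0"
  shows "\<exists>u v. u * p + v * q = 1"
  using assms
proof (induction "if q = 0 then 0 else Suc (Polynomial.degree q)" arbitrary: p q rule: less_induct)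
  case less
  show ?case
  proof (cases "q = 0")
    case True
    then have "Polynomial.degree p = 0"
      using less.prems alg_closed_imp_poly_has_root by fastforce
    then obtain c where c: "p = [:c:]" using degree_eq_zeroE by blast
    then have "c \<noteq> 0" using less.prems[of 0] True by auto
    then have "[:1 / c:] * p + 0 * q = 1" using c by (simp add: one_pCons)
    then show ?thesis by blast
  next
    case False
    have "\<exists>u v. u * q + v * (p mod q) = 1"
    proof (rule less.hyps)
      show "(if p mod q = 0 then 0 else Suc (Polynomial.degree (p mod q))) < (if q = 0 then 0 else Suc (Polynomial.degree q))"
        using False degree_mod_less[of q p] by auto
      fix x assume x: "poly q x = 0"
      have "poly p x = poly (p div q * q + p mod q) x" by simp
      also have "\<dots> = poly (p mod q) x" unfolding poly_add poly_mult x by simp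
      finally show "poly (p mod q) x \<noteq> 0" using less.prems[of x] x by auto
    qed
    then obtain u v where "u * q + v * (p mod q) = 1" by blast
    moreover have "p mod q = p - p div q * q" by (simp add: minus_div_mult_eq_mod)
    ultimately have "v * p + (u - v * (p div q)) * q = 1" by (simp add: algebra_simps)
    then show ?thesis by blast
  qed
qed

context weierstrass_forms
begin

definition disc :: "svar \<Rightarrow> 'k poly" where
  "disc i = 4 * affine_form i A ^ 3 + 27 * affine_form i B ^ 2"

definition grad :: "(svar \<Rightarrow> 'k) \<Rightarrow> svar \<Rightarrow> 'k" where
  "grad p i = meval p (mpderiv i G)"

lemma mpderiv_AB_0:
  "mpderiv cX A = 0" "mpderiv cY A = 0" "mpderiv cZ A = 0" "mpderiv cX B = 0" "mpderiv cY B = 0" "mpderiv cZ B = 0"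
  by (rule mpderiv_eq_0; use sections_keys[OF A_section] sections_keys[OF B_section] in simp)+

lemma grad:
  "grad p cX = - (3 * p cX ^ 2 + meval p A * p cZ ^ 2)"
  "grad p cY = 2 * p cY * p cZ"
  "grad p cZ = p cY ^ 2 - 2 * meval p A * p cX * p cZ - 3 * meval p B * p cZ ^ 2"
  "grad p cS = - (meval p (mpderiv cS A) * p cX * p cZ ^ 2 + meval p (mpderiv cS B) * p cZ ^ 3)"
  "grad p cT = - (meval p (mpderiv cT A) * p cX * p cZ ^ 2 + meval p (mpderiv cT B) * p cZ ^ 3)"
  unfolding grad_def weierstrass_def power2_eq_square power3_eq_cube
  by (simp_all add: mpderiv_simps mpderiv_AB_0 meval_simps meval_numeral algebra_simps)

text \<open>The two Euler vector fields, tangent to the orbits of the torus.\<close>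

definition euler1 :: "(svar \<Rightarrow> 'k) \<Rightarrow> svar \<Rightarrow> 'k" where
  "euler1 p = pt (p cS) (p cT) (4 * p cX) (6 * p cY) 0"

definition euler2 :: "(svar \<Rightarrow> 'k) \<Rightarrow> svar \<Rightarrow> 'k" where
  "euler2 p = pt 0 0 (p cX) (p cY) (p cZ)"

lemma sum_svar: "(\<Sum>i\<in>UNIV. f i) = f cS + f cT + f cX + f cY + f cZ"
  by (simp add: UNIV_svar add.assoc)

lemma euler_tangent:
  assumes "p \<in> cone G"
  shows "(\<Sum>i\<in>UNIV. grad p i * euler1 p i) = 0" "(\<Sum>i\<in>UNIV. grad p i * euler2 p i) = 0"
proof -
  have G0: "meval p G = 0" using assms by (simp add: cone_def)
  have eA: "p cS * meval p (mpderiv cS A) + p cT * meval p (mpderiv cT A) = 8 * meval p A"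
    and eB: "p cS * meval p (mpderiv cS B) + p cT * meval p (mpderiv cT B) = 12 * meval p B"
    using euler_section[OF A_section, of p] euler_section[OF B_section, of p] by simp_all
  have "(\<Sum>i\<in>UNIV. grad p i * euler1 p i) =
      - (p cS * meval p (mpderiv cS A) + p cT * meval p (mpderiv cT A)) * p cX * p cZ ^ 2
      - (p cS * meval p (mpderiv cS B) + p cT * meval p (mpderiv cT B)) * p cZ ^ 3
      - 4 * p cX * (3 * p cX ^ 2 + meval p A * p cZ ^ 2) + 12 * p cY ^ 2 * p cZ"
    unfolding sum_svar grad euler1_def by (simp add: algebra_simps power2_eq_square power3_eq_cube)
  also have "\<dots> = 12 * meval p G"
    unfolding eA eB meval_G by (simp add: algebra_simps power2_eq_square power3_eq_cube)
  finally show "(\<Sum>i\<in>UNIV. grad p i * euler1 p i) = 0" using G0 by simp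
  have "(\<Sum>i\<in>UNIV. grad p i * euler2 p i) = 3 * meval p G"
    unfolding sum_svar grad euler2_def meval_G by (simp add: algebra_simps power2_eq_square power3_eq_cube)
  then show "(\<Sum>i\<in>UNIV. grad p i * euler2 p i) = 0" using G0 by simp
qed

text \<open>Affine coordinates on the chart \<open>iz \<noteq> 0\<close>.\<close>

lemma affine_equation:
  assumes p: "p \<in> cone G" "i \<in> {cS, cT}" "p i \<noteq> 0" "p cZ \<noteq> 0"
  defines "\<tau> \<equiv> p (opp i) / p i" and "xa \<equiv> p cX / (p i ^ 4 * p cZ)" and "ya \<equiv> p cY / (p i ^ 6 * p cZ)"
  shows "ya ^ 2 = xa ^ 3 + poly (affine_form i A) \<tau> * xa + poly (affine_form i B) \<tau>"
    "grad p cX = - (p i ^ 8 * p cZ ^ 2) * (3 * xa ^ 2 + poly (affine_form i A) \<tau>)"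
    "grad p cY = p i ^ 6 * p cZ ^ 2 * (2 * ya)"
    "grad p (opp i) = - (p i ^ 11 * p cZ ^ 3) * (poly (pderiv (affine_form i A)) \<tau> * xa + poly (pderiv (affine_form i B)) \<tau>)"
proof -
  note A = meval_affine_form[where p = p, OF A_section p(2,3), folded \<tau>_def]
  note B = meval_affine_form[where p = p, OF B_section p(2,3), folded \<tau>_def]
  have A': "meval p (mpderiv (opp i) A) = p i ^ 7 * poly (pderiv (affine_form i A)) \<tau>"
    unfolding \<tau>_def by (rule meval_mpderiv_affine_form) (use A_section p in simp_all)
  have B': "meval p (mpderiv (opp i) B) = p i ^ 11 * poly (pderiv (affine_form i B)) \<tau>"
    unfolding \<tau>_def by (rule meval_mpderiv_affine_form) (use B_section p in simp_all)
  have x: "p cX = xa * (p i ^ 4 * p cZ)" and y: "p cY = ya * (p i ^ 6 * p cZ)"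
    using p by (simp_all add: xa_def ya_def)
  have "0 = meval p G" using p(1) by (simp add: cone_def)
  also have "\<dots> = p i ^ 12 * p cZ ^ 3 * (ya ^ 2 - (xa ^ 3 + poly (affine_form i A) \<tau> * xa + poly (affine_form i B) \<tau>))"
    unfolding meval_G A B x y by (simp add: algebra_simps power2_eq_square power3_eq_cube flip: power_add)
  finally show "ya ^ 2 = xa ^ 3 + poly (affine_form i A) \<tau> * xa + poly (affine_form i B) \<tau>"
    using p by simp
  show "grad p cX = - (p i ^ 8 * p cZ ^ 2) * (3 * xa ^ 2 + poly (affine_form i A) \<tau>)"
    unfolding grad A x by (simp add: algebra_simps power2_eq_square flip: power_add)
  show "grad p cY = p i ^ 6 * p cZ ^ 2 * (2 * ya)"
    unfolding grad y by (simp add: algebra_simps power2_eq_square)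
  have "grad p (opp i) = - (meval p (mpderiv (opp i) A) * p cX * p cZ ^ 2 + meval p (mpderiv (opp i) B) * p cZ ^ 3)"
    by (simp add: opp_def grad)
  then show "grad p (opp i) = - (p i ^ 11 * p cZ ^ 3) * (poly (pderiv (affine_form i A)) \<tau> * xa + poly (pderiv (affine_form i B)) \<tau>)"
    unfolding A' B' x by (simp add: algebra_simps power2_eq_square power3_eq_cube flip: power_add)
qed

text \<open>Near the section \<open>(0 : 1 : 0)\<close> the coordinates are \<open>\<xi> = i\<^sup>2x/y\<close> and \<open>\<zeta> = i\<^sup>6z/y\<close>.\<close>

lemma infinity_equation:
  assumes p: "p \<in> cone G" "i \<in> {cS, cT}" "p i \<noteq> 0" "p cY \<noteq> 0"
  defines "\<tau> \<equiv> p (opp i) / p i" and "\<xi> \<equiv> p i ^ 2 * p cX / p cY" and "\<zeta> \<equiv> p i ^ 6 * p cZ / p cY"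
  defines "a \<equiv> poly (affine_form i A) \<tau>" and "b \<equiv> poly (affine_form i B) \<tau>"
  shows "\<zeta> = \<xi> ^ 3 + a * \<xi> * \<zeta> ^ 2 + b * \<zeta> ^ 3"
    "p i ^ 4 * grad p cX = - (p cY ^ 2 * (3 * \<xi> ^ 2 + a * \<zeta> ^ 2))"
    "grad p cZ = p cY ^ 2 * (1 - 2 * a * \<xi> * \<zeta> - 3 * b * \<zeta> ^ 2)"
proof -
  note A = meval_affine_form[where p = p, OF A_section p(2,3), folded \<tau>_def, folded a_def]
  note B = meval_affine_form[where p = p, OF B_section p(2,3), folded \<tau>_def, folded b_def]
  have x: "p i ^ 2 * p cX = \<xi> * p cY" and z: "p i ^ 6 * p cZ = \<zeta> * p cY"
    using p by (simp_all add: \<xi>_def \<zeta>_def)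
  have "0 = p i ^ 6 * meval p G" using p(1) by (simp add: cone_def)
  also have "\<dots> = p cY ^ 2 * (p i ^ 6 * p cZ) - ((p i ^ 2 * p cX) ^ 3 + a * (p i ^ 2 * p cX) * (p i ^ 6 * p cZ) ^ 2
      + b * (p i ^ 6 * p cZ) ^ 3)"
    unfolding meval_G A B by (simp add: algebra_simps flip: power_mult power_add)
  also have "\<dots> = p cY ^ 3 * (\<zeta> - (\<xi> ^ 3 + a * \<xi> * \<zeta> ^ 2 + b * \<zeta> ^ 3))"
    unfolding x z by (simp add: algebra_simps power2_eq_square power3_eq_cube)
  finally show "\<zeta> = \<xi> ^ 3 + a * \<xi> * \<zeta> ^ 2 + b * \<zeta> ^ 3"
    using p by simp
  have "p i ^ 4 * grad p cX = - (3 * (p i ^ 2 * p cX) ^ 2 + a * (p i ^ 6 * p cZ) ^ 2)"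
    unfolding grad A by (simp add: algebra_simps flip: power_mult power_add)
  then show "p i ^ 4 * grad p cX = - (p cY ^ 2 * (3 * \<xi> ^ 2 + a * \<zeta> ^ 2))"
    unfolding x z by (simp add: algebra_simps)
  have "grad p cZ = p cY ^ 2 - 2 * a * (p i ^ 2 * p cX) * (p i ^ 6 * p cZ) - 3 * b * (p i ^ 6 * p cZ) ^ 2"
    unfolding grad A B by (simp add: algebra_simps flip: power_mult power_add)
  then show "grad p cZ = p cY ^ 2 * (1 - 2 * a * \<xi> * \<zeta> - 3 * b * \<zeta> ^ 2)"
    unfolding x z by (simp add: algebra_simps power2_eq_square)
qed

text \<open>Let \<open>\<Phi>\<close> be the right side of the assumption, \<open>\<Phi>\<^sub>\<xi>\<close> its derivative and \<open>F\<^sub>\<zeta> = 1 - \<Phi>\<^sub>\<zeta>\<close>. Then \<open>1 = F\<^sub>\<zeta> + (2a\<xi> + 3b\<zeta>)\<zeta>\<close>, and the Euler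
  relation \<open>3\<Phi> = \<xi>\<Phi>\<^sub>\<xi> + \<zeta>\<Phi>\<^sub>\<zeta>\<close> together with \<open>\<Phi> = \<zeta>\<close> gives \<open>2\<zeta> = \<xi>\<Phi>\<^sub>\<xi> - \<zeta>F\<^sub>\<zeta>\<close>.\<close>

lemma infinity_unit:
  fixes a b \<xi> \<zeta> :: 'k
  assumes "\<zeta> = \<xi> ^ 3 + a * \<xi> * \<zeta> ^ 2 + b * \<zeta> ^ 3"
  shows "(1 - (2 * a * \<xi> + 3 * b * \<zeta>) * \<zeta> / 2) * (1 - 2 * a * \<xi> * \<zeta> - 3 * b * \<zeta> ^ 2)
     + ((2 * a * \<xi> + 3 * b * \<zeta>) * \<xi> / 2) * (3 * \<xi> ^ 2 + a * \<zeta> ^ 2) = 1"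
proof -
  let ?h = "2 * a * \<xi> + 3 * b * \<zeta>"
  have "(1 - ?h * \<zeta> / 2) * (1 - 2 * a * \<xi> * \<zeta> - 3 * b * \<zeta> ^ 2) + (?h * \<xi> / 2) * (3 * \<xi> ^ 2 + a * \<zeta> ^ 2)
      = 1 - 3 / 2 * ?h * (\<zeta> - (\<xi> ^ 3 + a * \<xi> * \<zeta> ^ 2 + b * \<zeta> ^ 3))"
    by (simp add: field_simps power2_eq_square power3_eq_cube)
  then show ?thesis using assms by simp
qed

text \<open>The coefficients come from the classical expression of \<open>4a\<^sup>3 + 27b\<^sup>2\<close> in terms of the cubic \<open>f = X\<^sup>3 + aX + b\<close> and
  \<open>f\<^sub>X = 3X\<^sup>2 + a\<close>, and from \<open>12a\<^sup>2 - 54bX = (12a + 18X\<^sup>2) f\<^sub>X - 54X f\<close>, which shows that the derivative of the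
  discriminant lies in the ideal of \<open>f\<close>, \<open>f\<^sub>X\<close> and \<open>a'X + b'\<close>; here \<open>X\<close> is \<open>xa\<close> and \<open>f = ya\<^sup>2\<close>.\<close>

lemma affine_unit:
  fixes a b a' b' xa ya r q :: 'k
  assumes "ya ^ 2 = xa ^ 3 + a * xa + b" and "r * (4 * a ^ 3 + 27 * b ^ 2) + q * (12 * a ^ 2 * a' + 54 * b * b') = 1"
  shows "((r * (27 * b - 18 * a * xa) - 54 * q * a' * xa) * ya / 2) * (2 * ya)
     + (r * (6 * a * xa ^ 2 - 9 * b * xa + 4 * a ^ 2) + q * a' * (12 * a + 18 * xa ^ 2)) * (3 * xa ^ 2 + a)
     + 54 * q * b * (a' * xa + b') = 1"
proof -
  have "((r * (27 * b - 18 * a * xa) - 54 * q * a' * xa) * ya / 2) * (2 * ya) =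
      (r * (27 * b - 18 * a * xa) - 54 * q * a' * xa) * (xa ^ 3 + a * xa + b)"
    unfolding assms(1)[symmetric] by (simp add: power2_eq_square)
  then show ?thesis
    unfolding assms(2)[symmetric] by (simp add: algebra_simps power2_eq_square power3_eq_cube)
qed

end

locale smooth_weierstrass = weierstrass_forms +
  assumes disc_simple: "i \<in> {cS, cT} \<Longrightarrow> poly (disc i) \<tau> = 0 \<Longrightarrow> poly (pderiv (disc i)) \<tau> \<noteq> 0"
begin

lemma disc_bezout:
  assumes "i \<in> {cS, cT}"
  obtains r q where "\<And>\<tau>. poly r \<tau> * (4 * poly (affine_form i A) \<tau> ^ 3 + 27 * poly (affine_form i B) \<tau> ^ 2)
     + poly q \<tau> * (12 * poly (affine_form i A) \<tau> ^ 2 * poly (pderiv (affine_form i A)) \<tau>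
       + 54 * poly (affine_form i B) \<tau> * poly (pderiv (affine_form i B)) \<tau>) = 1"
proof -
  let ?a = "affine_form i A" and ?b = "affine_form i B"
  obtain r q where rq: "r * disc i + q * pderiv (disc i) = 1"
    using poly_bezout[of "disc i" "pderiv (disc i)"] disc_simple[OF assms] by blast
  have d: "disc i = [:4:] * (?a * ?a * ?a) + [:27:] * (?b * ?b)"
    by (simp add: disc_def power2_eq_square power3_eq_cube numeral_poly)
  have "poly (pderiv (disc i)) \<tau> = 12 * poly ?a \<tau> ^ 2 * poly (pderiv ?a) \<tau> + 54 * poly ?b \<tau> * poly (pderiv ?b) \<tau>" for \<tau>
    unfolding d pderiv_add pderiv_mult by (simp add: pderiv_pCons algebra_simps power2_eq_square)
  moreover have "poly (disc i) \<tau> = 4 * poly ?a \<tau> ^ 3 + 27 * poly ?b \<tau> ^ 2" for \<tau>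
    by (simp add: disc_def)
  moreover have "poly r \<tau> * poly (disc i) \<tau> + poly q \<tau> * poly (pderiv (disc i)) \<tau> = 1" for \<tau>
    using arg_cong[OF rq, of "\<lambda>P. poly P \<tau>"] by simp
  ultimately show thesis by (intro that[of r q]) simp
qed

lemma smooth_affine:
  assumes p: "p \<in> cone G" "i \<in> {cS, cT}" "p i \<noteq> 0" "p cZ \<noteq> 0"
  shows "grad p cX \<noteq> 0 \<or> grad p cY \<noteq> 0 \<or> grad p (opp i) \<noteq> 0"
proof (rule ccontr)
  assume neg: "\<not> ?thesis"
  obtain r q where rq: "\<And>\<tau>. poly r \<tau> * (4 * poly (affine_form i A) \<tau> ^ 3 + 27 * poly (affine_form i B) \<tau> ^ 2)
     + poly q \<tau> * (12 * poly (affine_form i A) \<tau> ^ 2 * poly (pderiv (affine_form i A)) \<tau>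
       + 54 * poly (affine_form i B) \<tau> * poly (pderiv (affine_form i B)) \<tau>) = 1"
    using disc_bezout[OF p(2)] by metis
  note e = affine_equation[OF p]
  show False
    using affine_unit[OF e(1) rq] e(2-4) neg p(3,4) by simp
qed

lemma smooth_infinity:
  assumes p: "p \<in> cone G" "i \<in> {cS, cT}" "p i \<noteq> 0" "p cY \<noteq> 0"
  shows "grad p cX \<noteq> 0 \<or> grad p cZ \<noteq> 0"
proof (rule ccontr)
  assume neg: "\<not> ?thesis"
  note e = infinity_equation[OF p]
  show False using infinity_unit[OF e(1)] e(2,3) neg p(3,4) by simp
qed

lemma cone_chart:
  assumes "p \<in> cone G"
  obtains i where "i \<in> {cS, cT}" "p i \<noteq> 0" "p cZ \<noteq> 0 \<or> p cY \<noteq> 0"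
proof -
  have "p cZ \<noteq> 0 \<or> p cY \<noteq> 0"
    using assms cone_eq[OF assms] by (auto simp: cone_def)
  then show thesis using assms that[of cS] that[of cT] by (auto simp: cone_def)
qed

lemma smooth_surface_G: "smooth_surface G"
  unfolding smooth_surface_def
proof
  fix p assume p: "p \<in> cone G"
  then obtain i where "i \<in> {cS, cT}" "p i \<noteq> 0" "p cZ \<noteq> 0 \<or> p cY \<noteq> 0" by (rule cone_chart)
  then show "\<exists>i. meval p (mpderiv i G) \<noteq> 0"
    using smooth_affine[OF p] smooth_infinity[OF p] unfolding grad_def by blast
qed

end

section \<open>The regular 2-form\<close>

lemma dir_deriv_mult:
  "dir_deriv (P * Q) p u = dir_deriv P p u * meval p Q + meval p P * dir_deriv Q p u"
  by (simp add: dir_deriv_def mpderiv_mult meval_simps sum.distrib sum_distrib_left sum_distrib_right algebra_simps)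

lemma dir_deriv_mvar [simp]: "dir_deriv (mvar i) p u = u i"
  by (cases i) (simp_all add: dir_deriv_def mpderiv_mvar UNIV_svar meval_simps)

lemma dir_deriv_1 [simp]: "dir_deriv 1 p u = 0"
  by (simp add: dir_deriv_def meval_simps)

lemma dir_deriv_power: "dir_deriv (P ^ n) p u = of_nat n * meval p P ^ (n - 1) * dir_deriv P p u"
proof (induction n)
  case (Suc n)
  then show ?case
    by (cases n) (simp_all add: dir_deriv_mult meval_simps algebra_simps)
qed simp

lemma frac_diff_cancel:
  assumes "meval p D \<noteq> 0" "meval p N \<noteq> 0"
  shows "frac_diff (P * N, D * N) p u =
    (dir_deriv P p u * meval p D - meval p P * dir_deriv D p u) / meval p D ^ 2"
  using assms by (simp add: frac_diff_def dir_deriv_mult meval_simps field_simps power2_eq_square)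

definition wedge :: "('a \<Rightarrow> 'b::comm_ring_1) \<Rightarrow> ('a \<Rightarrow> 'b) \<Rightarrow> 'a \<Rightarrow> 'a \<Rightarrow> 'b" where
  "wedge u v i j = u i * v j - u j * v i"

text \<open>Laplace expansion, along the first two rows, of the \<open>4 \<times> 4\<close> minor with rows \<open>E\<close>, \<open>F\<close>, \<open>u\<close>, \<open>v\<close>.\<close>

definition minor4 :: "('a \<Rightarrow> 'b::comm_ring_1) \<Rightarrow> ('a \<Rightarrow> 'b) \<Rightarrow> ('a \<Rightarrow> 'b) \<Rightarrow> ('a \<Rightarrow> 'b) \<Rightarrow> 'a \<Rightarrow> 'a \<Rightarrow> 'a \<Rightarrow> 'a \<Rightarrow> 'b" where
  "minor4 E F u v a b c d = wedge E F a b * wedge u v c d - wedge E F a c * wedge u v b d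
     + wedge E F a d * wedge u v b c + wedge E F b c * wedge u v a d - wedge E F b d * wedge u v a c
     + wedge E F c d * wedge u v a b"

lemma minor4_repeat [simp]:
  "minor4 E F u v a b c a = 0" "minor4 E F u v a b c b = 0" "minor4 E F u v a b c c = 0"
  by (simp_all add: minor4_def wedge_def algebra_simps)

lemma minor4_permute:
  "minor4 E F u v a b d c = - minor4 E F u v a b c d"
  "minor4 E F u v a c d b = minor4 E F u v a b c d"
  "minor4 E F u v b c d a = - minor4 E F u v a b c d"
  by (simp_all add: minor4_def wedge_def algebra_simps)

text \<open>Expanding the minors along the last column, each row contributes a multiple of its product with \<open>g\<close>.\<close>

lemma minor4_contract:
  fixes g :: "'a::finite \<Rightarrow> 'b::comm_ring_1"
  assumes "(\<Sum>j\<in>UNIV. g j * E j) = 0" "(\<Sum>j\<in>UNIV. g j * F j) = 0"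
    "(\<Sum>j\<in>UNIV. g j * u j) = 0" "(\<Sum>j\<in>UNIV. g j * v j) = 0"
  shows "(\<Sum>j\<in>UNIV. g j * minor4 E F u v a b c j) = 0"
proof -
  define KE KF Ku Kv where "KE = - (F a * wedge u v b c - F b * wedge u v a c + F c * wedge u v a b)"
    and "KF = E a * wedge u v b c - E b * wedge u v a c + E c * wedge u v a b"
    and "Ku = - (wedge E F a b * v c - wedge E F a c * v b + wedge E F b c * v a)"
    and "Kv = wedge E F a b * u c - wedge E F a c * u b + wedge E F b c * u a"
  have "g j * minor4 E F u v a b c j = KE * (g j * E j) + KF * (g j * F j) + Ku * (g j * u j) + Kv * (g j * v j)" for j
    unfolding minor4_def KE_def KF_def Ku_def Kv_def
    by (simp add: wedge_def[of _ _ _ j] algebra_simps)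
  then have "(\<Sum>j\<in>UNIV. g j * minor4 E F u v a b c j) = KE * (\<Sum>j\<in>UNIV. g j * E j) + KF * (\<Sum>j\<in>UNIV. g j * F j)
      + Ku * (\<Sum>j\<in>UNIV. g j * u j) + Kv * (\<Sum>j\<in>UNIV. g j * v j)"
    by (simp add: sum.distrib sum_distrib_left)
  then show ?thesis using assms by simp
qed

instance svar :: finite
  by standard (simp add: UNIV_svar)

text \<open>The charts \<open>s \<noteq> 0\<close> and \<open>t \<noteq> 0\<close> have opposite orientations, as \<open>s\<close> and \<open>t\<close> change places.\<close>

definition eps :: "svar \<Rightarrow> 'k::comm_ring_1" where
  "eps i = (if i = cS then 1 else - 1)"

lemma eps_square [simp]: "eps i * eps i = (1 :: 'k::comm_ring_1)"
  by (simp add: eps_def)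

lemma chart_fraction:
  fixes P :: "(svar, 'k::field) mpoly"
  assumes w: "i \<in> {cS, cT}" "j \<in> {cZ, cY}"
    and P: "bihomogeneous (a + (if j = cY then 6 else 0) * b, b) P"
  shows "\<exists>r\<in>fractions (chart i j).
    (\<forall>p. p i \<noteq> 0 \<longrightarrow> p j \<noteq> 0 \<longrightarrow> frac_eval r p = meval p P / (p i ^ a * p j ^ b)) \<and>
    (\<forall>p u. p i \<noteq> 0 \<longrightarrow> p j \<noteq> 0 \<longrightarrow> frac_diff r p u = (dir_deriv P p u * (p i ^ a * p j ^ b)
       - meval p P * (of_nat a * p i ^ (a - 1) * u i * p j ^ b + p i ^ a * (of_nat b * p j ^ (b - 1) * u j)))
       / (p i ^ a * p j ^ b) ^ 2)"
proof -
  let ?N = "mvar i ^ b * mvar j ^ a :: (svar, 'k) mpoly" and ?D = "mvar i ^ a * mvar j ^ b :: (svar, 'k) mpoly"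
  have s: "Poly_Mapping.single (chart i j) 1 = (mvar i * mvar j :: (svar, 'k) mpoly)"
    by (simp add: mvar_def mult_single)
  have DN: "Poly_Mapping.single (chart i j) 1 ^ (a + b) = ?D * ?N"
    unfolding s by (simp add: power_mult_distrib power_add ac_simps)
  have "bihomogeneous ((a + b) * fst (bidegree (chart i j)), (a + b) * snd (bidegree (chart i j))) (P * ?N)"
  proof (rule bihomogeneous_mult'[OF P])
    show "bihomogeneous (b + (if j = cY then 6 else 0) * a, a) ?N"
    proof (rule bihomogeneous_mult')
      show "bihomogeneous (b * 1, b * 0) (mvar i ^ b :: (svar, 'k) mpoly)"
        by (rule bihomogeneous_power) (use w(1) bihomogeneous_mvar in auto)
      show "bihomogeneous (a * (if j = cY then 6 else 0), a * 1) (mvar j ^ a :: (svar, 'k) mpoly)"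
        by (rule bihomogeneous_power) (use w(2) bihomogeneous_mvar in auto)
    qed auto
  qed (use w in \<open>auto simp: bidegree_add\<close>)
  then have 1: "(P * ?N, ?D * ?N) \<in> fractions (chart i j)"
    unfolding fractions_def DN[symmetric] by blast
  have 2: "frac_eval (P * ?N, ?D * ?N) p = meval p P / (p i ^ a * p j ^ b)" if "p i \<noteq> 0" "p j \<noteq> 0" for p
    using that by (simp add: frac_eval_def meval_simps)
  have 3: "frac_diff (P * ?N, ?D * ?N) p u = (dir_deriv P p u * (p i ^ a * p j ^ b)
       - meval p P * (of_nat a * p i ^ (a - 1) * u i * p j ^ b + p i ^ a * (of_nat b * p j ^ (b - 1) * u j)))
       / (p i ^ a * p j ^ b) ^ 2" if "p i \<noteq> 0" "p j \<noteq> 0" for p u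
    using that by (subst frac_diff_cancel) (simp_all add: meval_simps dir_deriv_mult dir_deriv_power)
  show ?thesis using 1 2 3 by blast
qed

context weierstrass_forms
begin

lemma regular_on_const: "regular_on G m (\<lambda>_. c)"
proof -
  have "bihomogeneous (0 * fst (bidegree m), 0 * snd (bidegree m)) (mconst c)"
    using bihomogeneous_mconst by simp
  moreover have "\<forall>p\<in>locus G m. c = meval p (mconst c) / monval p m ^ 0" by (simp add: meval_simps)
  ultimately show ?thesis unfolding regular_on_iff by blast
qed

lemma regular_on_arith:
  assumes "regular_on G m f" "regular_on G m g"
  shows "regular_on G m (\<lambda>p. f p + g p)" "regular_on G m (\<lambda>p. f p * g p)"
proof -
  obtain k P where P: "bihomogeneous (k * fst (bidegree m), k * snd (bidegree m)) P"
    "\<And>p. p \<in> locus G m \<Longrightarrow> f p = meval p P / monval p m ^ k"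
    using assms(1) unfolding regular_on_iff by blast
  obtain l Q where Q: "bihomogeneous (l * fst (bidegree m), l * snd (bidegree m)) Q"
    "\<And>p. p \<in> locus G m \<Longrightarrow> g p = meval p Q / monval p m ^ l"
    using assms(2) unfolding regular_on_iff by blast
  let ?M = "\<lambda>n. Poly_Mapping.single m (1 :: 'k) ^ n"
  have M: "bihomogeneous (n * fst (bidegree m), n * snd (bidegree m)) (?M n)" for n
    by (intro bihomogeneous_power bihomogeneous_single) simp
  have "bihomogeneous ((k + l) * fst (bidegree m), (k + l) * snd (bidegree m)) (P * ?M l + Q * ?M k)"
    by (intro bihomogeneous_add bihomogeneous_mult'[OF P(1) M] bihomogeneous_mult'[OF Q(1) M])
       (simp_all add: algebra_simps)
  moreover have "\<forall>p\<in>locus G m. f p + g p = meval p (P * ?M l + Q * ?M k) / monval p m ^ (k + l)"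
    by (simp add: P Q meval_simps locus_iff field_simps power_add)
  ultimately show "regular_on G m (\<lambda>p. f p + g p)" unfolding regular_on_iff by blast
  have "bihomogeneous ((k + l) * fst (bidegree m), (k + l) * snd (bidegree m)) (P * Q)"
    by (intro bihomogeneous_mult'[OF P(1) Q(1)]) (simp_all add: algebra_simps)
  moreover have "\<forall>p\<in>locus G m. f p * g p = meval p (P * Q) / monval p m ^ (k + l)"
    by (simp add: P Q meval_simps power_add)
  ultimately show "regular_on G m (\<lambda>p. f p * g p)" unfolding regular_on_iff by blast
qed

lemma regular_on_diff: "regular_on G m f \<Longrightarrow> regular_on G m g \<Longrightarrow> regular_on G m (\<lambda>p. f p - g p)"
  using regular_on_arith(1)[of m f "\<lambda>p. (- 1) * g p"] regular_on_arith(2)[OF regular_on_const[of m "- 1"]]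
  by simp

lemma regular_on_power: "regular_on G m f \<Longrightarrow> regular_on G m (\<lambda>p. f p ^ n)"
  by (induction n) (auto intro: regular_on_arith regular_on_const[of m 1])

lemma regular_on_poly: "regular_on G m f \<Longrightarrow> regular_on G m (\<lambda>p. poly q (f p))"
  by (induction q) (auto intro: regular_on_arith regular_on_const)

lemmas regular_intros = regular_on_arith regular_on_diff regular_on_power regular_on_poly regular_on_const

text \<open>The Poincare residue of \<open>ds dt dx dy dz / G\<close>, contracted with the two Euler fields: the minors of the
  matrix with rows \<open>euler1\<close>, \<open>euler2\<close>, \<open>u\<close>, \<open>v\<close> are proportional to the gradient of \<open>G\<close>, because all four rows are
  orthogonal to it, and the value of the form is the factor of proportionality.\<close>

abbreviation "vol p u v \<equiv> minor4 (euler1 p) (euler2 p) u v"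

definition is_residue :: "(svar \<Rightarrow> 'k) \<Rightarrow> (svar \<Rightarrow> 'k) \<Rightarrow> (svar \<Rightarrow> 'k) \<Rightarrow> 'k \<Rightarrow> bool" where
  "is_residue p u v c \<longleftrightarrow> vol p u v cS cT cX cZ = c * grad p cY \<and> vol p u v cS cT cY cZ = - c * grad p cX \<and>
     vol p u v cS cX cY cZ = c * grad p cT \<and> vol p u v cT cX cY cZ = - c * grad p cS \<and>
     vol p u v cS cT cX cY = - c * grad p cZ"

definition res_form :: "(svar \<Rightarrow> 'k) \<Rightarrow> (svar \<Rightarrow> 'k) \<Rightarrow> (svar \<Rightarrow> 'k) \<Rightarrow> 'k" where
  "res_form p u v = (SOME c. is_residue p u v c)"

lemma tangent_iff: "u \<in> tangent G p \<longleftrightarrow> (\<Sum>j\<in>UNIV. grad p j * u j) = 0"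
  by (simp add: tangent_def dir_deriv_def grad_def)

text \<open>The contractions of the minors with the gradient vanish, which says that minors and gradient are proportional.\<close>

lemma residue_exists:
  assumes p: "p \<in> cone G" and u: "u \<in> tangent G p" and v: "v \<in> tangent G p" and g: "grad p i \<noteq> 0"
  shows "\<exists>c. is_residue p u v c"
proof -
  have con: "(\<Sum>j\<in>UNIV. grad p j * vol p u v a b c j) = 0" for a b c
    by (rule minor4_contract) (use euler_tangent[OF p] u v in \<open>simp_all add: tangent_iff\<close>)
  define vY vX vT vS vZ where "vY = vol p u v cS cT cX cZ" and "vX = vol p u v cS cT cY cZ"
    and "vT = vol p u v cS cX cY cZ" and "vS = vol p u v cT cX cY cZ" and "vZ = vol p u v cS cT cX cY"
  have perm: "vol p u v cS cT cY cX = - vZ" "vol p u v cS cT cZ cX = - vY" "vol p u v cS cT cZ cY = - vX"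
    "vol p u v cS cX cY cT = vZ" "vol p u v cS cX cZ cT = vY" "vol p u v cS cX cZ cY = - vT"
    "vol p u v cS cY cZ cT = vX" "vol p u v cS cY cZ cX = vT" "vol p u v cT cX cY cS = - vZ"
    "vol p u v cT cX cZ cS = - vY" "vol p u v cT cX cZ cY = - vS" "vol p u v cT cY cZ cS = - vX"
    "vol p u v cT cY cZ cX = vS" "vol p u v cX cY cZ cS = - vT" "vol p u v cX cY cZ cT = - vS"
    unfolding vY_def vX_def vT_def vS_def vZ_def
    by (fact minor4_permute)+
  note def' = vY_def[symmetric] vX_def[symmetric] vT_def[symmetric] vS_def[symmetric] vZ_def[symmetric]
  have eqs: "grad p cY * vZ + grad p cZ * vY = 0" "grad p cZ * vX = grad p cX * vZ"
    "grad p cX * vY + grad p cY * vX = 0" "grad p cT * vZ + grad p cZ * vT = 0" "grad p cT * vY = grad p cY * vT"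
    "grad p cT * vX + grad p cX * vT = 0" "grad p cZ * vS = grad p cS * vZ" "grad p cS * vY + grad p cY * vS = 0"
    "grad p cX * vS = grad p cS * vX" "grad p cS * vT + grad p cT * vS = 0"
    using con[of cS cT cX] con[of cS cT cY] con[of cS cT cZ] con[of cS cX cY] con[of cS cX cZ]
      con[of cS cY cZ] con[of cT cX cY] con[of cT cX cZ] con[of cT cY cZ] con[of cX cY cZ]
    unfolding sum_svar minor4_repeat perm def'
    by (simp_all add: algebra_simps eq_neg_iff_add_eq_0 neg_eq_iff_add_eq_0)
  define c where "c = (case i of cS \<Rightarrow> - vS | cT \<Rightarrow> vT | cX \<Rightarrow> - vX | cY \<Rightarrow> vY | cZ \<Rightarrow> - vZ) / grad p i"
  have "is_residue p u v c"
    unfolding is_residue_def def'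
    using eqs g unfolding c_def
    by (cases i) (simp_all add: field_simps eq_neg_iff_add_eq_0 neg_eq_iff_add_eq_0)
  then show ?thesis by blast
qed

text \<open>The minors in terms of the differentials of the affine coordinates.\<close>

lemma vol_affine:
  assumes i: "i \<in> {cS, cT}" and nz: "p i \<noteq> 0" "p cZ \<noteq> 0"
  defines "dt \<equiv> \<lambda>u. (u (opp i) * p i - p (opp i) * u i) / p i ^ 2"
    and "dx \<equiv> \<lambda>u. (u cX * (p i ^ 4 * p cZ) - p cX * (4 * p i ^ 3 * u i * p cZ + p i ^ 4 * u cZ)) / (p i ^ 4 * p cZ) ^ 2"
    and "dy \<equiv> \<lambda>u. (u cY * (p i ^ 6 * p cZ) - p cY * (6 * p i ^ 5 * u i * p cZ + p i ^ 6 * u cZ)) / (p i ^ 6 * p cZ) ^ 2"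
  shows "vol p u v cS cT cX cZ = eps i * (p i ^ 6 * p cZ ^ 2) * (dt u * dx v - dt v * dx u)"
    "vol p u v cS cT cY cZ = eps i * (p i ^ 8 * p cZ ^ 2) * (dt u * dy v - dt v * dy u)"
    "vol p u v i cX cY cZ = p i ^ 11 * p cZ ^ 3 * (dx u * dy v - dx v * dy u)"
proof -
  have dt: "u (opp i) = p i * dt u + p (opp i) * u i / p i" for u
    using nz by (simp add: dt_def field_simps power2_eq_square)
  have dx: "u cX = p i ^ 4 * p cZ * dx u + p cX * (4 * u i / p i + u cZ / p cZ)" for u
    using nz by (simp add: dx_def field_simps power2_eq_square) (simp add: power_numeral_reduce algebra_simps)
  have dy: "u cY = p i ^ 6 * p cZ * dy u + p cY * (6 * u i / p i + u cZ / p cZ)" for u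
    using nz by (simp add: dy_def field_simps power2_eq_square) (simp add: power_numeral_reduce algebra_simps)
  consider "i = cS" "opp i = cT" | "i = cT" "opp i = cS" using i by (auto simp: opp_def)
  note cs = this
  show "vol p u v cS cT cX cZ = eps i * (p i ^ 6 * p cZ ^ 2) * (dt u * dx v - dt v * dx u)"
    using cs
  proof cases
    case 1
    show ?thesis
      unfolding minor4_def wedge_def euler1_def euler2_def pt_simps dx[of u] dx[of v] dt[of u, unfolded 1(2)] dt[of v, unfolded 1(2)] 1(1)
      using nz[unfolded 1(1)] by (simp add: eps_def field_simps) (simp add: power_numeral_reduce algebra_simps)?
  next
    case 2
    show ?thesis
      unfolding minor4_def wedge_def euler1_def euler2_def pt_simps dx[of u] dx[of v] dt[of u, unfolded 2(2)] dt[of v, unfolded 2(2)] 2(1)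
      using nz[unfolded 2(1)] by (simp add: eps_def field_simps) (simp add: power_numeral_reduce algebra_simps)?
  qed
  show "vol p u v cS cT cY cZ = eps i * (p i ^ 8 * p cZ ^ 2) * (dt u * dy v - dt v * dy u)"
    using cs
  proof cases
    case 1
    show ?thesis
      unfolding minor4_def wedge_def euler1_def euler2_def pt_simps dy[of u] dy[of v] dt[of u, unfolded 1(2)] dt[of v, unfolded 1(2)] 1(1)
      using nz[unfolded 1(1)] by (simp add: eps_def field_simps) (simp add: power_numeral_reduce algebra_simps)?
  next
    case 2
    show ?thesis
      unfolding minor4_def wedge_def euler1_def euler2_def pt_simps dy[of u] dy[of v] dt[of u, unfolded 2(2)] dt[of v, unfolded 2(2)] 2(1)
      using nz[unfolded 2(1)] by (simp add: eps_def field_simps) (simp add: power_numeral_reduce algebra_simps)?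
  qed
  have e: "euler1 p i = p i" "euler2 p i = 0" using i by (auto simp: euler1_def euler2_def)
  show "vol p u v i cX cY cZ = p i ^ 11 * p cZ ^ 3 * (dx u * dy v - dx v * dy u)"
    unfolding minor4_def wedge_def e unfolding euler1_def euler2_def pt_simps dx[of u] dx[of v] dy[of u] dy[of v]
    using nz by (simp add: field_simps) (simp add: power_numeral_reduce algebra_simps)?
qed

lemma vol_infinity:
  assumes i: "i \<in> {cS, cT}" and nz: "p i \<noteq> 0" "p cY \<noteq> 0"
  defines "dt \<equiv> \<lambda>u. (u (opp i) * p i - p (opp i) * u i) / p i ^ 2"
    and "dx \<equiv> \<lambda>u. ((2 * p i * u i * p cX + p i ^ 2 * u cX) * p cY - p i ^ 2 * p cX * u cY) / p cY ^ 2"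
    and "dz \<equiv> \<lambda>u. ((6 * p i ^ 5 * u i * p cZ + p i ^ 6 * u cZ) * p cY - p i ^ 6 * p cZ * u cY) / p cY ^ 2"
  shows "vol p u v cS cT cX cY = eps i * p cY ^ 2 * (dt u * dx v - dt v * dx u)"
    "p i ^ 4 * vol p u v cS cT cY cZ = - eps i * p cY ^ 2 * (dt u * dz v - dt v * dz u)"
proof -
  have dt: "u (opp i) = p i * dt u + p (opp i) * u i / p i" for u
    using nz by (simp add: dt_def field_simps power2_eq_square)
  have dx: "u cX = p cY * dx u / p i ^ 2 + p cX * (u cY / p cY - 2 * u i / p i)" for u
    using nz by (simp add: dx_def field_simps power2_eq_square) (simp add: power_numeral_reduce algebra_simps)?
  have dz: "u cZ = p cY * dz u / p i ^ 6 + p cZ * (u cY / p cY - 6 * u i / p i)" for u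
    using nz by (simp add: dz_def field_simps power2_eq_square) (simp add: power_numeral_reduce algebra_simps)?
  consider "i = cS" "opp i = cT" | "i = cT" "opp i = cS" using i by (auto simp: opp_def)
  note cs = this
  show "vol p u v cS cT cX cY = eps i * p cY ^ 2 * (dt u * dx v - dt v * dx u)"
    using cs
  proof cases
    case 1
    show ?thesis
      unfolding minor4_def wedge_def euler1_def euler2_def pt_simps dx[of u] dx[of v] dt[of u, unfolded 1(2)] dt[of v, unfolded 1(2)] 1(1)
      using nz[unfolded 1(1)] by (simp add: eps_def field_simps) (simp add: power_numeral_reduce algebra_simps)?
  next
    case 2
    show ?thesis
      unfolding minor4_def wedge_def euler1_def euler2_def pt_simps dx[of u] dx[of v] dt[of u, unfolded 2(2)] dt[of v, unfolded 2(2)] 2(1)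
      using nz[unfolded 2(1)] by (simp add: eps_def field_simps) (simp add: power_numeral_reduce algebra_simps)?
  qed
  show "p i ^ 4 * vol p u v cS cT cY cZ = - eps i * p cY ^ 2 * (dt u * dz v - dt v * dz u)"
    using cs
  proof cases
    case 1
    show ?thesis
      unfolding minor4_def wedge_def euler1_def euler2_def pt_simps dz[of u] dz[of v] dt[of u, unfolded 1(2)] dt[of v, unfolded 1(2)] 1(1)
      using nz[unfolded 1(1)] by (simp add: eps_def field_simps) (simp add: power_numeral_reduce algebra_simps)?
  next
    case 2
    show ?thesis
      unfolding minor4_def wedge_def euler1_def euler2_def pt_simps dz[of u] dz[of v] dt[of u, unfolded 2(2)] dt[of v, unfolded 2(2)] 2(1)
      using nz[unfolded 2(1)] by (simp add: eps_def field_simps) (simp add: power_numeral_reduce algebra_simps)?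
  qed
qed

end

context smooth_weierstrass
begin

lemma gradient_nonzero:
  assumes "p \<in> cone G"
  obtains i where "grad p i \<noteq> 0"
  using smooth_surface_G assms that unfolding smooth_surface_def grad_def by blast

lemma is_residue_res_form:
  assumes "p \<in> cone G" "u \<in> tangent G p" "v \<in> tangent G p"
  shows "is_residue p u v (res_form p u v)"
proof -
  obtain i where "grad p i \<noteq> 0" using gradient_nonzero[OF assms(1)] .
  from residue_exists[OF assms this] show ?thesis
    unfolding res_form_def by (rule someI_ex)
qed

text \<open>On the chart the forms \<open>d\<tau> \<and> dx\<close>, \<open>d\<tau> \<and> dy\<close>, \<open>dx \<and> dy\<close> are, up to sign, the residue times the three partial derivatives of
  the affine equation. By \<open>affine_unit\<close> a combination of these derivatives with regular coefficients is 1, and the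
  same combination of the forms is the residue.\<close>

lemma res_form_regular_affine:
  assumes i: "i \<in> {cS, cT}"
  shows "\<exists>L. set L \<subseteq> fractions (chart i cZ) \<times> fractions (chart i cZ) \<times> fractions (chart i cZ) \<and>
        (\<forall>p\<in>locus G (chart i cZ). \<forall>u\<in>tangent G p. \<forall>v\<in>tangent G p.
           res_form p u v = (\<Sum>(f, g, h)\<leftarrow>L. frac_eval f p *
              (frac_diff g p u * frac_diff h p v - frac_diff g p v * frac_diff h p u)))"
proof -
  let ?m = "chart i cZ"
  have loc: "p \<in> cone G \<and> p i \<noteq> 0 \<and> p cZ \<noteq> 0" if "p \<in> locus G ?m" for p
    using that by (auto simp: locus_iff monval_add)
  have bt: "bihomogeneous (Suc 0, 0) (mvar (opp i) :: (svar, 'a) mpoly)"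
    using bihomogeneous_mvar by (auto simp: opp_def)
  have "\<exists>r\<in>fractions ?m. (\<forall>p :: svar \<Rightarrow> 'a. p i \<noteq> 0 \<longrightarrow> p cZ \<noteq> 0 \<longrightarrow> frac_eval r p = p (opp i) / p i) \<and>
    (\<forall>p u. p i \<noteq> 0 \<longrightarrow> p cZ \<noteq> 0 \<longrightarrow> frac_diff r p u = (u (opp i) * p i - p (opp i) * u i) / p i ^ 2)"
    using chart_fraction[OF i, of cZ 1 0 "mvar (opp i) :: (svar, 'a) mpoly"] by (simp add: bt meval_simps dir_deriv_mult dir_deriv_power)
  then obtain rt :: "(svar, 'a) mpoly \<times> (svar, 'a) mpoly" where rt: "rt \<in> fractions ?m"
    "\<And>p. p i \<noteq> 0 \<Longrightarrow> p cZ \<noteq> 0 \<Longrightarrow> frac_eval rt p = p (opp i) / p i"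
    "\<And>p u. p i \<noteq> 0 \<Longrightarrow> p cZ \<noteq> 0 \<Longrightarrow> frac_diff rt p u = (u (opp i) * p i - p (opp i) * u i) / p i ^ 2"
    by blast
  have "\<exists>r\<in>fractions ?m. (\<forall>p :: svar \<Rightarrow> 'a. p i \<noteq> 0 \<longrightarrow> p cZ \<noteq> 0 \<longrightarrow> frac_eval r p = p cX / (p i ^ 4 * p cZ)) \<and>
    (\<forall>p u. p i \<noteq> 0 \<longrightarrow> p cZ \<noteq> 0 \<longrightarrow> frac_diff r p u = (u cX * (p i ^ 4 * p cZ) - p cX * (4 * p i ^ 3 * u i * p cZ + p i ^ 4 * u cZ)) / (p i ^ 4 * p cZ) ^ 2)"
    using chart_fraction[OF i, of cZ 4 1 "mvar cX :: (svar, 'a) mpoly"] by (simp add: bihomogeneous_mvar[simplified] meval_simps dir_deriv_mult dir_deriv_power)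
  then obtain rx :: "(svar, 'a) mpoly \<times> (svar, 'a) mpoly" where rx: "rx \<in> fractions ?m"
    "\<And>p. p i \<noteq> 0 \<Longrightarrow> p cZ \<noteq> 0 \<Longrightarrow> frac_eval rx p = p cX / (p i ^ 4 * p cZ)"
    "\<And>p u. p i \<noteq> 0 \<Longrightarrow> p cZ \<noteq> 0 \<Longrightarrow> frac_diff rx p u = (u cX * (p i ^ 4 * p cZ) - p cX * (4 * p i ^ 3 * u i * p cZ + p i ^ 4 * u cZ)) / (p i ^ 4 * p cZ) ^ 2"
    by blast
  have "\<exists>r\<in>fractions ?m. (\<forall>p :: svar \<Rightarrow> 'a. p i \<noteq> 0 \<longrightarrow> p cZ \<noteq> 0 \<longrightarrow> frac_eval r p = p cY / (p i ^ 6 * p cZ)) \<and>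
    (\<forall>p u. p i \<noteq> 0 \<longrightarrow> p cZ \<noteq> 0 \<longrightarrow> frac_diff r p u = (u cY * (p i ^ 6 * p cZ) - p cY * (6 * p i ^ 5 * u i * p cZ + p i ^ 6 * u cZ)) / (p i ^ 6 * p cZ) ^ 2)"
    using chart_fraction[OF i, of cZ 6 1 "mvar cY :: (svar, 'a) mpoly"] by (simp add: bihomogeneous_mvar[simplified] meval_simps dir_deriv_mult dir_deriv_power)
  then obtain ry :: "(svar, 'a) mpoly \<times> (svar, 'a) mpoly" where ry: "ry \<in> fractions ?m"
    "\<And>p. p i \<noteq> 0 \<Longrightarrow> p cZ \<noteq> 0 \<Longrightarrow> frac_eval ry p = p cY / (p i ^ 6 * p cZ)"
    "\<And>p u. p i \<noteq> 0 \<Longrightarrow> p cZ \<noteq> 0 \<Longrightarrow> frac_diff ry p u = (u cY * (p i ^ 6 * p cZ) - p cY * (6 * p i ^ 5 * u i * p cZ + p i ^ 6 * u cZ)) / (p i ^ 6 * p cZ) ^ 2"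
    by blast
  define \<tau> xa ya where "\<tau> = (\<lambda>p :: svar \<Rightarrow> 'a. p (opp i) / p i)"
    and "xa = (\<lambda>p :: svar \<Rightarrow> 'a. p cX / (p i ^ 4 * p cZ))" and "ya = (\<lambda>p :: svar \<Rightarrow> 'a. p cY / (p i ^ 6 * p cZ))"
  have reg: "regular_on G ?m \<tau>" "regular_on G ?m xa" "regular_on G ?m ya"
    unfolding regular_on_def \<tau>_def xa_def ya_def
    by (rule bexI[OF _ rt(1)] bexI[OF _ rx(1)] bexI[OF _ ry(1)]; use rt(2) rx(2) ry(2) loc in \<open>simp add: meval_simps\<close>)+
  obtain r q where rq: "\<And>\<tau>. poly r \<tau> * (4 * poly (affine_form i A) \<tau> ^ 3 + 27 * poly (affine_form i B) \<tau> ^ 2)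
     + poly q \<tau> * (12 * poly (affine_form i A) \<tau> ^ 2 * poly (pderiv (affine_form i A)) \<tau>
       + 54 * poly (affine_form i B) \<tau> * poly (pderiv (affine_form i B)) \<tau>) = 1"
    using disc_bezout[OF i] by metis
  define a b a' where "a = (\<lambda>p. poly (affine_form i A) (\<tau> p))" and "b = (\<lambda>p. poly (affine_form i B) (\<tau> p))"
    and "a' = (\<lambda>p. poly (pderiv (affine_form i A)) (\<tau> p))"
  define r' q' where "r' = (\<lambda>p. poly r (\<tau> p))" and "q' = (\<lambda>p. poly q (\<tau> p))"
  have reg': "regular_on G ?m a" "regular_on G ?m b" "regular_on G ?m a'" "regular_on G ?m r'" "regular_on G ?m q'"
    unfolding a_def b_def a'_def r'_def q'_def by (rule regular_on_poly[OF reg(1)])+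
  define c1 c2 c3 where "c1 = (\<lambda>p. (r' p * (27 * b p - 18 * a p * xa p) - 54 * q' p * a' p * xa p) * ya p * (1 / 2))"
    and "c2 = (\<lambda>p. r' p * (6 * a p * xa p ^ 2 - 9 * b p * xa p + 4 * a p ^ 2) + q' p * a' p * (12 * a p + 18 * xa p ^ 2))"
    and "c3 = (\<lambda>p. 54 * q' p * b p)"
  have "regular_on G ?m (\<lambda>p. eps i * c1 p)" "regular_on G ?m (\<lambda>p. eps i * c2 p)" "regular_on G ?m (\<lambda>p. - eps i * c3 p)"
    unfolding c1_def c2_def c3_def by (intro regular_intros reg reg')+
  then obtain f1 f2 f3 where f: "f1 \<in> fractions ?m" "\<And>p. p \<in> locus G ?m \<Longrightarrow> eps i * c1 p = frac_eval f1 p"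
    "f2 \<in> fractions ?m" "\<And>p. p \<in> locus G ?m \<Longrightarrow> eps i * c2 p = frac_eval f2 p"
    "f3 \<in> fractions ?m" "\<And>p. p \<in> locus G ?m \<Longrightarrow> - eps i * c3 p = frac_eval f3 p"
    unfolding regular_on_def by blast
  let ?W = "\<lambda>g h p u v. frac_diff g p u * frac_diff h p v - frac_diff g p v * frac_diff h p u"
  have main: "res_form p u v = eps i * c1 p * ?W rt rx p u v + eps i * c2 p * ?W rt ry p u v + - eps i * c3 p * ?W rx ry p u v"
    if p: "p \<in> locus G ?m" and u: "u \<in> tangent G p" and v: "v \<in> tangent G p" for p u v
  proof -
    note nz = loc[OF p, THEN conjunct2, THEN conjunct1] loc[OF p, THEN conjunct2, THEN conjunct2]
    note cn = loc[OF p, THEN conjunct1]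
    define c where "c = res_form p u v"
    have res: "is_residue p u v c"
      unfolding c_def by (rule is_residue_res_form[OF cn u v])
    have d: "frac_diff rt p u = (u (opp i) * p i - p (opp i) * u i) / p i ^ 2"
      "frac_diff rx p u = (u cX * (p i ^ 4 * p cZ) - p cX * (4 * p i ^ 3 * u i * p cZ + p i ^ 4 * u cZ)) / (p i ^ 4 * p cZ) ^ 2"
      "frac_diff ry p u = (u cY * (p i ^ 6 * p cZ) - p cY * (6 * p i ^ 5 * u i * p cZ + p i ^ 6 * u cZ)) / (p i ^ 6 * p cZ) ^ 2" for u
      by (fact rt(3)[OF nz] rx(3)[OF nz] ry(3)[OF nz])+
    note vol = vol_affine[OF i nz, of u v, folded d]
    note e = affine_equation[OF cn i nz, folded \<tau>_def xa_def ya_def]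
    have ee: "eps i * (eps i * x) = x" for x :: 'a
      by (simp flip: mult.assoc)
    have "eps i * (p i ^ 6 * p cZ ^ 2) * ?W rt rx p u v = c * (p i ^ 6 * p cZ ^ 2 * (2 * ya p))"
      using res vol(1) e(3) unfolding is_residue_def ya_def by simp
    then have "(p i ^ 6 * p cZ ^ 2) * (eps i * ?W rt rx p u v) = (p i ^ 6 * p cZ ^ 2) * (c * (2 * ya p))"
      by (simp add: ac_simps)
    then have 1: "eps i * ?W rt rx p u v = c * (2 * ya p)" using nz by simp
    have "eps i * (p i ^ 8 * p cZ ^ 2) * ?W rt ry p u v = c * (p i ^ 8 * p cZ ^ 2 * (3 * xa p ^ 2 + a p))"
      using res vol(2) e(2) unfolding is_residue_def xa_def a_def \<tau>_def by simp
    then have "(p i ^ 8 * p cZ ^ 2) * (eps i * ?W rt ry p u v) = (p i ^ 8 * p cZ ^ 2) * (c * (3 * xa p ^ 2 + a p))"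
      by (simp add: ac_simps)
    then have 2: "eps i * ?W rt ry p u v = c * (3 * xa p ^ 2 + a p)" using nz by simp
    have "vol p u v i cX cY cZ = eps i * c * grad p (opp i)"
      using res i by (auto simp: is_residue_def eps_def opp_def)
    then have "(p i ^ 11 * p cZ ^ 3) * ?W rx ry p u v = (p i ^ 11 * p cZ ^ 3) * (- eps i * c * (a' p * xa p + poly (pderiv (affine_form i B)) (\<tau> p)))"
      using vol(3) e(4) unfolding xa_def a'_def \<tau>_def by simp
    then have 3: "?W rx ry p u v = - eps i * c * (a' p * xa p + poly (pderiv (affine_form i B)) (\<tau> p))"
      using nz by (simp only: mult_cancel_left) simp
    have "eps i * c1 p * ?W rt rx p u v + eps i * c2 p * ?W rt ry p u v + - eps i * c3 p * ?W rx ry p u v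
        = c1 p * (eps i * ?W rt rx p u v) + c2 p * (eps i * ?W rt ry p u v) - eps i * c3 p * ?W rx ry p u v"
      by (simp add: ac_simps)
    also have "\<dots> = c * (c1 p * (2 * ya p) + c2 p * (3 * xa p ^ 2 + a p) + c3 p * (a' p * xa p + poly (pderiv (affine_form i B)) (\<tau> p)))"
      unfolding 1 2 3 by (simp add: algebra_simps ee)
    also have "c1 p * (2 * ya p) + c2 p * (3 * xa p ^ 2 + a p) + c3 p * (a' p * xa p + poly (pderiv (affine_form i B)) (\<tau> p)) = 1"
      using affine_unit[of "ya p" "xa p" "a p" "b p" "r' p" "q' p" "a' p" "poly (pderiv (affine_form i B)) (\<tau> p)"]
        e(1) rq[of "\<tau> p"] unfolding c1_def c2_def c3_def a_def b_def a'_def r'_def q'_def xa_def ya_def \<tau>_def by simp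
    finally show ?thesis unfolding c_def by simp
  qed
  show ?thesis
  proof (rule exI[of _ "[(f1, rt, rx), (f2, rt, ry), (f3, rx, ry)]"], intro conjI ballI)
    show "set [(f1, rt, rx), (f2, rt, ry), (f3, rx, ry)] \<subseteq> fractions ?m \<times> fractions ?m \<times> fractions ?m"
      using f rt(1) rx(1) ry(1) by simp
    fix p u v assume puv: "p \<in> locus G ?m" "u \<in> tangent G p" "v \<in> tangent G p"
    show "res_form p u v = (\<Sum>(f, g, h)\<leftarrow>[(f1, rt, rx), (f2, rt, ry), (f3, rx, ry)]. frac_eval f p *
              (frac_diff g p u * frac_diff h p v - frac_diff g p v * frac_diff h p u))"
      unfolding main[OF puv] f(2)[OF puv(1)] f(4)[OF puv(1)] f(6)[OF puv(1)] by simp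
  qed
qed

text \<open>As on the affine chart, with the combination of partial derivatives from \<open>infinity_unit\<close>.\<close>

lemma res_form_regular_infinity:
  assumes i: "i \<in> {cS, cT}"
  shows "\<exists>L. set L \<subseteq> fractions (chart i cY) \<times> fractions (chart i cY) \<times> fractions (chart i cY) \<and>
        (\<forall>p\<in>locus G (chart i cY). \<forall>u\<in>tangent G p. \<forall>v\<in>tangent G p.
           res_form p u v = (\<Sum>(f, g, h)\<leftarrow>L. frac_eval f p *
              (frac_diff g p u * frac_diff h p v - frac_diff g p v * frac_diff h p u)))"
proof -
  let ?m = "chart i cY"
  have loc: "p \<in> cone G \<and> p i \<noteq> 0 \<and> p cY \<noteq> 0" if "p \<in> locus G ?m" for p
    using that by (auto simp: locus_iff monval_add)
  have b: "bihomogeneous (n, 0) (mvar i ^ n :: (svar, 'a) mpoly)" for n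
    using bihomogeneous_power[of 1 0 "mvar i :: (svar, 'a) mpoly" n] bihomogeneous_mvar i by auto
  have bt: "bihomogeneous (Suc 0, 0) (mvar (opp i) :: (svar, 'a) mpoly)"
    using bihomogeneous_mvar by (auto simp: opp_def)
  have "\<exists>r\<in>fractions ?m. (\<forall>p :: svar \<Rightarrow> 'a. p i \<noteq> 0 \<longrightarrow> p cY \<noteq> 0 \<longrightarrow> frac_eval r p = p (opp i) / p i) \<and>
    (\<forall>p u. p i \<noteq> 0 \<longrightarrow> p cY \<noteq> 0 \<longrightarrow> frac_diff r p u = (u (opp i) * p i - p (opp i) * u i) / p i ^ 2)"
    using chart_fraction[OF i, of cY 1 0 "mvar (opp i) :: (svar, 'a) mpoly"] by (simp add: bt meval_simps dir_deriv_mult dir_deriv_power)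
  then obtain rt :: "(svar, 'a) mpoly \<times> (svar, 'a) mpoly" where rt: "rt \<in> fractions ?m"
    "\<And>p. p i \<noteq> 0 \<Longrightarrow> p cY \<noteq> 0 \<Longrightarrow> frac_eval rt p = p (opp i) / p i"
    "\<And>p u. p i \<noteq> 0 \<Longrightarrow> p cY \<noteq> 0 \<Longrightarrow> frac_diff rt p u = (u (opp i) * p i - p (opp i) * u i) / p i ^ 2"
    by blast
  have "\<exists>r\<in>fractions ?m. (\<forall>p :: svar \<Rightarrow> 'a. p i \<noteq> 0 \<longrightarrow> p cY \<noteq> 0 \<longrightarrow> frac_eval r p = p i ^ 2 * p cX / p cY) \<and>
    (\<forall>p u. p i \<noteq> 0 \<longrightarrow> p cY \<noteq> 0 \<longrightarrow> frac_diff r p u = ((2 * p i * u i * p cX + p i ^ 2 * u cX) * p cY - p i ^ 2 * p cX * u cY) / p cY ^ 2)"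
    using chart_fraction[OF i, of cY 0 1 "mvar i ^ 2 * mvar cX :: (svar, 'a) mpoly"] by (simp add: bihomogeneous_mult'[OF b bihomogeneous_mvar(3)] meval_simps dir_deriv_mult dir_deriv_power)
  then obtain rx :: "(svar, 'a) mpoly \<times> (svar, 'a) mpoly" where rx: "rx \<in> fractions ?m"
    "\<And>p. p i \<noteq> 0 \<Longrightarrow> p cY \<noteq> 0 \<Longrightarrow> frac_eval rx p = p i ^ 2 * p cX / p cY"
    "\<And>p u. p i \<noteq> 0 \<Longrightarrow> p cY \<noteq> 0 \<Longrightarrow> frac_diff rx p u = ((2 * p i * u i * p cX + p i ^ 2 * u cX) * p cY - p i ^ 2 * p cX * u cY) / p cY ^ 2"
    by blast
  have "\<exists>r\<in>fractions ?m. (\<forall>p :: svar \<Rightarrow> 'a. p i \<noteq> 0 \<longrightarrow> p cY \<noteq> 0 \<longrightarrow> frac_eval r p = p i ^ 6 * p cZ / p cY) \<and>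
    (\<forall>p u. p i \<noteq> 0 \<longrightarrow> p cY \<noteq> 0 \<longrightarrow> frac_diff r p u = ((6 * p i ^ 5 * u i * p cZ + p i ^ 6 * u cZ) * p cY - p i ^ 6 * p cZ * u cY) / p cY ^ 2)"
    using chart_fraction[OF i, of cY 0 1 "mvar i ^ 6 * mvar cZ :: (svar, 'a) mpoly"] by (simp add: bihomogeneous_mult'[OF b bihomogeneous_mvar(5)] meval_simps dir_deriv_mult dir_deriv_power)
  then obtain rz :: "(svar, 'a) mpoly \<times> (svar, 'a) mpoly" where rz: "rz \<in> fractions ?m"
    "\<And>p. p i \<noteq> 0 \<Longrightarrow> p cY \<noteq> 0 \<Longrightarrow> frac_eval rz p = p i ^ 6 * p cZ / p cY"
    "\<And>p u. p i \<noteq> 0 \<Longrightarrow> p cY \<noteq> 0 \<Longrightarrow> frac_diff rz p u = ((6 * p i ^ 5 * u i * p cZ + p i ^ 6 * u cZ) * p cY - p i ^ 6 * p cZ * u cY) / p cY ^ 2"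
    by blast
  define \<tau> \<xi> \<zeta> where "\<tau> = (\<lambda>p :: svar \<Rightarrow> 'a. p (opp i) / p i)"
    and "\<xi> = (\<lambda>p :: svar \<Rightarrow> 'a. p i ^ 2 * p cX / p cY)" and "\<zeta> = (\<lambda>p :: svar \<Rightarrow> 'a. p i ^ 6 * p cZ / p cY)"
  have reg: "regular_on G ?m \<tau>" "regular_on G ?m \<xi>" "regular_on G ?m \<zeta>"
    unfolding regular_on_def \<tau>_def \<xi>_def \<zeta>_def
    by (rule bexI[OF _ rt(1)] bexI[OF _ rx(1)] bexI[OF _ rz(1)]; use rt(2) rx(2) rz(2) loc in \<open>simp add: meval_simps\<close>)+
  define a b where "a = (\<lambda>p. poly (affine_form i A) (\<tau> p))" and "b = (\<lambda>p. poly (affine_form i B) (\<tau> p))"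
  have reg': "regular_on G ?m a" "regular_on G ?m b"
    unfolding a_def b_def by (rule regular_on_poly[OF reg(1)])+
  define c1 c2 where "c1 = (\<lambda>p. 1 - (2 * a p * \<xi> p + 3 * b p * \<zeta> p) * \<zeta> p * (1 / 2))"
    and "c2 = (\<lambda>p. (2 * a p * \<xi> p + 3 * b p * \<zeta> p) * \<xi> p * (1 / 2))"
  have "regular_on G ?m (\<lambda>p. - eps i * c1 p)" "regular_on G ?m (\<lambda>p. - eps i * c2 p)"
    unfolding c1_def c2_def by (intro regular_intros reg reg')+
  then obtain f1 f2 where f: "f1 \<in> fractions ?m" "\<And>p. p \<in> locus G ?m \<Longrightarrow> - eps i * c1 p = frac_eval f1 p"
    "f2 \<in> fractions ?m" "\<And>p. p \<in> locus G ?m \<Longrightarrow> - eps i * c2 p = frac_eval f2 p"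
    unfolding regular_on_def by blast
  let ?W = "\<lambda>g h p u v. frac_diff g p u * frac_diff h p v - frac_diff g p v * frac_diff h p u"
  have main: "res_form p u v = - eps i * c1 p * ?W rt rx p u v + - eps i * c2 p * ?W rt rz p u v"
    if p: "p \<in> locus G ?m" and u: "u \<in> tangent G p" and v: "v \<in> tangent G p" for p u v
  proof -
    note nz = loc[OF p, THEN conjunct2, THEN conjunct1] loc[OF p, THEN conjunct2, THEN conjunct2]
    note cn = loc[OF p, THEN conjunct1]
    define c where "c = res_form p u v"
    have res: "is_residue p u v c"
      unfolding c_def by (rule is_residue_res_form[OF cn u v])
    have d: "frac_diff rt p u = (u (opp i) * p i - p (opp i) * u i) / p i ^ 2"
      "frac_diff rx p u = ((2 * p i * u i * p cX + p i ^ 2 * u cX) * p cY - p i ^ 2 * p cX * u cY) / p cY ^ 2"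
      "frac_diff rz p u = ((6 * p i ^ 5 * u i * p cZ + p i ^ 6 * u cZ) * p cY - p i ^ 6 * p cZ * u cY) / p cY ^ 2" for u
      by (fact rt(3)[OF nz] rx(3)[OF nz] rz(3)[OF nz])+
    note vol = vol_infinity[OF i nz, of u v, folded d]
    note e = infinity_equation[OF cn i nz]
    have "eps i * p cY ^ 2 * ?W rt rx p u v = - c * (p cY ^ 2 * (1 - 2 * a p * \<xi> p * \<zeta> p - 3 * b p * \<zeta> p ^ 2))"
      using res vol(1) e(3) unfolding is_residue_def a_def b_def \<xi>_def \<zeta>_def \<tau>_def by simp
    then have "p cY ^ 2 * (eps i * ?W rt rx p u v) = p cY ^ 2 * (- c * (1 - 2 * a p * \<xi> p * \<zeta> p - 3 * b p * \<zeta> p ^ 2))"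
      by (simp add: ac_simps)
    then have 1: "eps i * ?W rt rx p u v = - c * (1 - 2 * a p * \<xi> p * \<zeta> p - 3 * b p * \<zeta> p ^ 2)"
      using nz by (simp only: mult_cancel_left) simp
    have "- eps i * p cY ^ 2 * ?W rt rz p u v = p i ^ 4 * (- c * grad p cX)"
      using res vol(2) unfolding is_residue_def by simp
    also have "\<dots> = - c * (p i ^ 4 * grad p cX)" by simp
    also have "\<dots> = c * (p cY ^ 2 * (3 * \<xi> p ^ 2 + a p * \<zeta> p ^ 2))"
      unfolding e(2) a_def \<xi>_def \<zeta>_def \<tau>_def by simp
    finally have neg: "- eps i * p cY ^ 2 * ?W rt rz p u v = c * (p cY ^ 2 * (3 * \<xi> p ^ 2 + a p * \<zeta> p ^ 2))" .
    have "p cY ^ 2 * (eps i * ?W rt rz p u v) = - (- eps i * p cY ^ 2 * ?W rt rz p u v)" by (simp add: ac_simps)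
    also have "\<dots> = p cY ^ 2 * (- c * (3 * \<xi> p ^ 2 + a p * \<zeta> p ^ 2))" unfolding neg by (simp add: ac_simps)
    finally have 2: "eps i * ?W rt rz p u v = - c * (3 * \<xi> p ^ 2 + a p * \<zeta> p ^ 2)"
      using nz by (simp only: mult_cancel_left) simp
    have "- eps i * c1 p * ?W rt rx p u v + - eps i * c2 p * ?W rt rz p u v
        = - c1 p * (eps i * ?W rt rx p u v) - c2 p * (eps i * ?W rt rz p u v)"
      by (simp add: ac_simps)
    also have "\<dots> = c * (c1 p * (1 - 2 * a p * \<xi> p * \<zeta> p - 3 * b p * \<zeta> p ^ 2) + c2 p * (3 * \<xi> p ^ 2 + a p * \<zeta> p ^ 2))"
      unfolding 1 2 by (simp add: algebra_simps)
    also have "c1 p * (1 - 2 * a p * \<xi> p * \<zeta> p - 3 * b p * \<zeta> p ^ 2) + c2 p * (3 * \<xi> p ^ 2 + a p * \<zeta> p ^ 2) = 1"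
      using infinity_unit[OF e(1)] unfolding c1_def c2_def a_def b_def \<xi>_def \<zeta>_def \<tau>_def by simp
    finally show ?thesis unfolding c_def by simp
  qed
  show ?thesis
  proof (rule exI[of _ "[(f1, rt, rx), (f2, rt, rz)]"], intro conjI ballI)
    show "set [(f1, rt, rx), (f2, rt, rz)] \<subseteq> fractions ?m \<times> fractions ?m \<times> fractions ?m"
      using f rt(1) rx(1) rz(1) by simp
    fix p u v assume puv: "p \<in> locus G ?m" "u \<in> tangent G p" "v \<in> tangent G p"
    show "res_form p u v = (\<Sum>(f, g, h)\<leftarrow>[(f1, rt, rx), (f2, rt, rz)]. frac_eval f p *
              (frac_diff g p u * frac_diff h p v - frac_diff g p v * frac_diff h p u))"
      unfolding main[OF puv] f(2)[OF puv(1)] f(4)[OF puv(1)] by simp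
  qed
qed

text \<open>If the derivative in the direction \<open>k\<close> does not vanish, the other coordinates are local coordinates of the
  cone, and the two tangent vectors used here complete the Euler fields to a basis of the tangent space.\<close>

lemma res_form_nonzero:
  assumes p: "p \<in> cone G"
  shows "\<exists>u\<in>tangent G p. \<exists>v\<in>tangent G p. res_form p u v \<noteq> 0"
proof (rule ccontr)
  assume neg: "\<not> ?thesis"
  define bas where "bas = (\<lambda>k a. (\<lambda>_ :: svar. 0 :: 'a)(a := 1, k := - grad p a / grad p k))"
  have tan: "bas k a \<in> tangent G p" if "grad p k \<noteq> 0" "a \<noteq> k" for k a
    using that unfolding tangent_iff sum_svar bas_def by (cases a; cases k) simp_all
  have zero: "is_residue p (bas k a) (bas k b) 0" if "grad p k \<noteq> 0" "a \<noteq> k" "b \<noteq> k" for k a b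
    using is_residue_res_form[OF p tan tan, OF that(1,2) that(1,3)] neg tan that by metis
  obtain i where i: "i \<in> {cS, cT}" "p i \<noteq> 0" "p cZ \<noteq> 0 \<or> p cY \<noteq> 0" using p by (rule cone_chart)
  consider "p cZ \<noteq> 0" "grad p cX \<noteq> 0" | "p cZ \<noteq> 0" "grad p cY \<noteq> 0" | "p cZ \<noteq> 0" "grad p (opp i) \<noteq> 0"
    | "p cY \<noteq> 0" "grad p cX \<noteq> 0" | "p cY \<noteq> 0" "grad p cZ \<noteq> 0"
    using smooth_affine[OF p i(1,2)] smooth_infinity[OF p i(1,2)] i(3) by blast
  then show False
  proof cases
    case 1
    then show False
      using zero[of cX cY "opp i"] i
      by (auto simp: is_residue_def minor4_def wedge_def bas_def euler1_def euler2_def opp_def)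
  next
    case 2
    then show False
      using zero[of cY cX "opp i"] i
      by (auto simp: is_residue_def minor4_def wedge_def bas_def euler1_def euler2_def opp_def)
  next
    case 3
    then show False
      using zero[of "opp i" cX cY] i
      by (auto simp: is_residue_def minor4_def wedge_def bas_def euler1_def euler2_def opp_def)
  next
    case 4
    then show False
      using zero[of cX cZ "opp i"] i
      by (auto simp: is_residue_def minor4_def wedge_def bas_def euler1_def euler2_def opp_def)
  next
    case 5
    then show False
      using zero[of cZ cX "opp i"] i
      by (auto simp: is_residue_def minor4_def wedge_def bas_def euler1_def euler2_def opp_def)
  qed
qed

lemma canonical_bundle_trivial_G: "canonical_bundle_trivial G"
proof -
  have "regular_2form G res_form"
    unfolding regular_2form_def charts_eq
    using res_form_regular_affine[of cS] res_form_regular_affine[of cT]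
      res_form_regular_infinity[of cS] res_form_regular_infinity[of cT] by simp
  then show ?thesis
    unfolding canonical_bundle_trivial_def using res_form_nonzero by blast
qed

theorem K3_surface_G: "K3_surface G"
  unfolding K3_surface_def
  using smooth_surface_G irreducible_surface_G canonical_bundle_trivial_G H1_structure_sheaf_vanishes_G by blast

end

section \<open>Singular plane cubics\<close>

definition cubic :: "'k::field \<Rightarrow> 'k \<Rightarrow> (pvar, 'k) mpoly" where
  "cubic a b = mvar pY ^ 2 * mvar pZ -
     (mvar pX ^ 3 + mconst a * mvar pX * mvar pZ ^ 2 + mconst b * mvar pZ ^ 3)"

lemma UNIV_pvar: "(UNIV :: pvar set) = {pX, pY, pZ}"
  using pvar.exhaust by auto

lemma meval_cubic:
  "meval p (cubic a b) = p pY ^ 2 * p pZ - (p pX ^ 3 + a * p pX * p pZ ^ 2 + b * p pZ ^ 3)"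
  by (simp add: cubic_def meval_simps)

lemma mpderiv_cubic:
  "mpderiv pX (cubic a b) = - (3 * mvar pX ^ 2 + mconst a * mvar pZ ^ 2)"
  "mpderiv pY (cubic a b) = 2 * mvar pY * mvar pZ"
  "mpderiv pZ (cubic a b) = mvar pY ^ 2 - 2 * mconst a * mvar pX * mvar pZ - 3 * mconst b * mvar pZ ^ 2"
  unfolding cubic_def power2_eq_square power3_eq_cube
  by (simp_all add: mpderiv_simps algebra_simps)

lemma mpderiv_numeral [simp]: "mpderiv i (numeral n) = 0"
  using mpderiv_mconst[of i "numeral n"] by (simp add: mconst_def)

lemma singular_point_cubic:
  fixes a b :: "'k::field_char_0"
  assumes "singular_point (cubic a b) p"
  shows "p pZ \<noteq> 0" "p pY = 0" "3 * p pX ^ 2 + a * p pZ ^ 2 = 0" "2 * a * p pX + 3 * b * p pZ = 0"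
proof -
  have nz: "\<exists>i. p i \<noteq> 0" and g: "p pY ^ 2 * p pZ - (p pX ^ 3 + a * p pX * p pZ ^ 2 + b * p pZ ^ 3) = 0"
    and dx: "3 * p pX ^ 2 + a * p pZ ^ 2 = 0" and dy: "2 * p pY * p pZ = 0"
    and dz: "p pY ^ 2 - 2 * a * p pX * p pZ - 3 * b * p pZ ^ 2 = 0"
    using assms[unfolded singular_point_def curve_point_def, THEN conjunct2, rule_format, of pX]
      assms[unfolded singular_point_def curve_point_def, THEN conjunct2, rule_format, of pY]
      assms[unfolded singular_point_def curve_point_def, THEN conjunct2, rule_format, of pZ] assms
    unfolding mpderiv_cubic singular_point_def curve_point_def meval_cubic
    by (simp_all add: meval_simps meval_numeral neg_eq_iff_add_eq_0)
  show z: "p pZ \<noteq> 0"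
  proof
    assume "p pZ = 0"
    then have "p i = 0" for i using dx dz by (cases i) auto
    then show False using nz by simp
  qed
  then show "p pY = 0" using dy by simp
  moreover have "p pZ * (2 * a * p pX + 3 * b * p pZ) = p pY ^ 2 - (p pY ^ 2 - 2 * a * p pX * p pZ - 3 * b * p pZ ^ 2)"
    by (simp add: algebra_simps power2_eq_square)
  ultimately have "p pZ * (2 * a * p pX + 3 * b * p pZ) = 0" unfolding dz by simp
  then show "2 * a * p pX + 3 * b * p pZ = 0" using z by simp
  show "3 * p pX ^ 2 + a * p pZ ^ 2 = 0" by (fact dx)
qed

lemma proj_class_eqI:
  fixes p q :: "'v \<Rightarrow> 'k::Fields.field"
  assumes "c \<noteq> 0" "\<And>i. q i = c * p i"
  shows "proj_class q = proj_class p"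
proof (intro equalityI subsetI)
  fix f assume "f \<in> proj_class q"
  then obtain d where "d \<noteq> 0" "f = (\<lambda>i. d * q i)" by (auto simp: proj_class_def)
  then show "f \<in> proj_class p"
    using assms unfolding proj_class_def by (auto intro!: exI[of _ "d * c"] simp: mult.assoc)
next
  fix f assume "f \<in> proj_class p"
  then obtain d where "d \<noteq> 0" "f = (\<lambda>i. d * p i)" by (auto simp: proj_class_def)
  then show "f \<in> proj_class q"
    using assms unfolding proj_class_def by (auto intro!: exI[of _ "d / c"])
qed

text \<open>A cubic with vanishing discriminant that is not a cusp is \<open>y\<^sup>2z = (x - rz)\<^sup>2(x + 2rz)\<close>.\<close>

locale nodal_cubic =
  fixes a b r :: "'k::{alg_closed_field, field_char_0}"
  assumes ar: "a = - 3 * r ^ 2" and br: "b = 2 * r ^ 3" and r: "r \<noteq> 0"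
begin

lemma meval_nodal: "meval p (cubic a b) = p pY ^ 2 * p pZ - (p pX - r * p pZ) ^ 2 * (p pX + 2 * r * p pZ)"
  unfolding meval_cubic ar br by (simp add: algebra_simps power2_eq_square power3_eq_cube)

lemma singular_point_exists: "singular_point (cubic a b) (\<lambda>i. case i of pX \<Rightarrow> r | pY \<Rightarrow> 0 | pZ \<Rightarrow> 1)" (is "singular_point _ ?p")
proof -
  have "meval ?p (mpderiv i (cubic a b)) = 0" for i
    by (cases i) (simp_all add: mpderiv_cubic meval_simps meval_numeral ar br power2_eq_square power3_eq_cube)
  moreover have "meval ?p (cubic a b) = 0" by (simp add: meval_nodal)
  moreover have "?p pZ \<noteq> 0" by simp
  ultimately show ?thesis unfolding singular_point_def curve_point_def by blast
qed

text \<open>With \<open>c = z(p)\<close>, the second order part at the node is \<open>2c(y\<^sup>2 - 3r(x - rz)\<^sup>2)\<close>, which factors over a square root of \<open>3r\<close>.\<close>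

lemma node_cubic:
  assumes "singular_point (cubic a b) p"
  shows "node (cubic a b) p"
proof -
  note s = singular_point_cubic[OF assms]
  define c where "c = p pZ"
  have y: "p pY = 0" and c: "c \<noteq> 0" using s by (auto simp: c_def)
  have "6 * r ^ 2 * (p pX - r * c) = - (2 * a * p pX + 3 * b * c)"
    unfolding ar br by (simp add: algebra_simps power2_eq_square power3_eq_cube)
  then have "6 * r ^ 2 * (p pX - r * c) = 0" using s(4) by (simp add: c_def)
  moreover have "6 * r ^ 2 \<noteq> 0" using r by simp
  ultimately have "p pX - r * c = 0" using mult_eq_0_iff by blast
  then have x: "p pX = r * c" by simp
  obtain \<rho> where \<rho>: "\<rho> ^ 2 = 3 * r" using nth_root_exists[of 2 "3 * r"] by auto
  have \<rho>0: "\<rho> \<noteq> 0" using \<rho> r by auto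
  define l1 l2 where "l1 = (\<lambda>i. case i of pX \<Rightarrow> - 2 * c * \<rho> | pY \<Rightarrow> 2 * c | pZ \<Rightarrow> 2 * c * \<rho> * r)"
    and "l2 = (\<lambda>i. case i of pX \<Rightarrow> \<rho> | pY \<Rightarrow> 1 | pZ \<Rightarrow> - \<rho> * r)"
  have "d = 0 \<and> e = 0" if "\<forall>i. d * l1 i + e * l2 i = 0" for d e
  proof -
    have 1: "d * (- 2 * c * \<rho>) + e * \<rho> = 0" and 2: "d * (2 * c) + e = 0"
      using that[rule_format, of pX] that[rule_format, of pY] by (simp_all add: l1_def l2_def)
    have "\<rho> * (4 * (d * c)) = \<rho> * (d * (2 * c) + e) - (d * (- 2 * c * \<rho>) + e * \<rho>)"
      by (simp add: algebra_simps)
    then have "d = 0" unfolding 1 2 using \<rho>0 c by simp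
    then show ?thesis using 2 by simp
  qed
  moreover have "(\<Sum>i\<in>UNIV. \<Sum>j\<in>UNIV. meval p (mpderiv i (mpderiv j (cubic a b))) * v i * v j)
              = (\<Sum>i\<in>UNIV. l1 i * v i) * (\<Sum>i\<in>UNIV. l2 i * v i)" for v
  proof -
    have "(\<Sum>i\<in>UNIV. \<Sum>j\<in>UNIV. meval p (mpderiv i (mpderiv j (cubic a b))) * v i * v j)
       = - 6 * p pX * v pX ^ 2 + 2 * p pZ * v pY ^ 2 + (- 2 * a * p pX - 6 * b * p pZ) * v pZ ^ 2
         + 4 * p pY * v pY * v pZ - 4 * a * p pZ * v pX * v pZ"
      unfolding UNIV_pvar
      by (simp add: mpderiv_cubic power2_eq_square mpderiv_simps meval_simps meval_numeral algebra_simps)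
    also have "\<dots> = 2 * c * v pY ^ 2 - 2 * c * (3 * r) * (v pX - r * v pZ) ^ 2"
      unfolding x y ar br c_def[symmetric] by (simp add: algebra_simps power2_eq_square power3_eq_cube)
    also have "\<dots> = (\<Sum>i\<in>UNIV. l1 i * v i) * (\<Sum>i\<in>UNIV. l2 i * v i)"
      unfolding \<rho>[symmetric] UNIV_pvar by (simp add: l1_def l2_def algebra_simps power2_eq_square)
    finally show ?thesis .
  qed
  ultimately show ?thesis unfolding node_def using assms by blast
qed

text \<open>The pencil of lines \<open>y = u (x - rz)\<close> through the node parametrizes the curve. On the side of the parameter the
  exceptions are the tangent directions \<open>u\<^sup>2 = 3r\<close>, on the side of the curve the node and the point at infinity.\<close>

lemma rational_cubic: "rational_curve (cubic a b)"
proof -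
  define \<phi> where "\<phi> = (\<lambda>i. case i of pX \<Rightarrow> [:- 2 * r, 0, 1:] | pY \<Rightarrow> [:0, - 3 * r, 0, 1:] | pZ \<Rightarrow> 1)"
  define P Q :: "(pvar, 'k) mpoly" where "P = mvar pY" and "Q = mvar pX - mconst r * mvar pZ"
  have eP: "meval q P = q pY" and eQ: "meval q Q = q pX - r * q pZ" for q
    by (simp_all add: P_def Q_def meval_simps)
  have \<phi>: "poly (\<phi> pX) u = u ^ 2 - 2 * r" "poly (\<phi> pY) u = u * (u ^ 2 - 3 * r)" "poly (\<phi> pZ) u = 1" for u
    by (simp_all add: \<phi>_def algebra_simps power2_eq_square)
  have "\<forall>m\<in>Poly_Mapping.keys P \<union> Poly_Mapping.keys Q. (\<Sum>i\<in>UNIV. Poly_Mapping.lookup m i) = 1"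
  proof
    fix m assume m: "m \<in> Poly_Mapping.keys P \<union> Poly_Mapping.keys Q"
    have "mconst r * mvar pZ = Poly_Mapping.single (Poly_Mapping.single pZ 1) r"
      by (simp add: mconst_def mvar_def mult_single)
    then have "Poly_Mapping.keys Q \<subseteq> {Poly_Mapping.single pX 1, Poly_Mapping.single pZ 1}"
      by (auto simp: Q_def mvar_def in_keys_iff lookup_minus lookup_single when_def split: if_splits)
    moreover have "Poly_Mapping.keys P \<subseteq> {Poly_Mapping.single pY 1}" by (simp add: P_def mvar_def)
    ultimately show "(\<Sum>i\<in>UNIV. Poly_Mapping.lookup m i) = 1"
      using m by (auto simp: UNIV_pvar lookup_single)
  qed
  moreover have "finite {u. \<not> (let q = (\<lambda>i. poly (\<phi> i) u) in
        curve_point (cubic a b) q \<and> meval q Q \<noteq> 0 \<and> meval q P / meval q Q = u)}"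
  proof (rule finite_subset)
    show "finite {u. poly [:- 3 * r, 0, 1:] u = 0}"
      by (rule poly_roots_finite) simp
    show "{u. \<not> (let q = (\<lambda>i. poly (\<phi> i) u) in
        curve_point (cubic a b) q \<and> meval q Q \<noteq> 0 \<and> meval q P / meval q Q = u)} \<subseteq> {u. poly [:- 3 * r, 0, 1:] u = 0}"
    proof (rule subsetI, rule ccontr)
      fix u assume u: "u \<in> {u. \<not> (let q = (\<lambda>i. poly (\<phi> i) u) in
        curve_point (cubic a b) q \<and> meval q Q \<noteq> 0 \<and> meval q P / meval q Q = u)}"
        "u \<notin> {u. poly [:- 3 * r, 0, 1:] u = 0}"
      define q where "q = (\<lambda>i. poly (\<phi> i) u)"
      have nz: "u ^ 2 - 3 * r \<noteq> 0" using u(2) by (simp add: algebra_simps power2_eq_square)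
      have "meval q (cubic a b) = 0"
        unfolding meval_nodal q_def \<phi> by (simp add: algebra_simps power2_eq_square)
      moreover have "q pZ \<noteq> 0" by (simp add: q_def \<phi>)
      moreover have Q: "meval q Q = u ^ 2 - 3 * r" unfolding eQ q_def \<phi> by simp
      moreover have "meval q P / meval q Q = u"
        unfolding Q unfolding eP q_def \<phi> using nz by simp
      moreover have "\<not> (curve_point (cubic a b) q \<and> meval q Q \<noteq> 0 \<and> meval q P / meval q Q = u)"
        using u(1) unfolding q_def by (simp add: Let_def)
      ultimately show False
        using nz unfolding curve_point_def by metis
    qed
  qed
  moreover have "finite {proj_class q | q. curve_point (cubic a b) q \<and>
      \<not> (meval q Q \<noteq> 0 \<and> (\<lambda>i. poly (\<phi> i) (meval q P / meval q Q)) \<in> proj_class q)}"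
  proof (rule finite_subset)
    let ?o = "\<lambda>i. case i of pX \<Rightarrow> 0 | pY \<Rightarrow> 1 | pZ \<Rightarrow> (0 :: 'k)" and ?n = "\<lambda>i. case i of pX \<Rightarrow> r | pY \<Rightarrow> 0 | pZ \<Rightarrow> 1"
    show "finite {proj_class ?o, proj_class ?n}" by simp
    show "{proj_class q | q. curve_point (cubic a b) q \<and>
      \<not> (meval q Q \<noteq> 0 \<and> (\<lambda>i. poly (\<phi> i) (meval q P / meval q Q)) \<in> proj_class q)} \<subseteq> {proj_class ?o, proj_class ?n}"
    proof (rule subsetI)
      fix C assume "C \<in> {proj_class q | q. curve_point (cubic a b) q \<and>
        \<not> (meval q Q \<noteq> 0 \<and> (\<lambda>i. poly (\<phi> i) (meval q P / meval q Q)) \<in> proj_class q)}"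
      then obtain q where C: "C = proj_class q" and q: "\<exists>i. q i \<noteq> 0" "meval q (cubic a b) = 0"
        and bad: "\<not> (meval q Q \<noteq> 0 \<and> (\<lambda>i. poly (\<phi> i) (meval q P / meval q Q)) \<in> proj_class q)"
        unfolding curve_point_def by blast
      have eq: "q pY ^ 2 * q pZ = (q pX - r * q pZ) ^ 2 * (q pX + 2 * r * q pZ)"
        using q(2) unfolding meval_nodal by simp
      have "meval q Q = 0"
      proof (rule ccontr)
        assume nQ: "meval q Q \<noteq> 0"
        have nz: "q pX - r * q pZ \<noteq> 0" using nQ by (simp add: eQ)
        have z: "q pZ \<noteq> 0"
        proof
          assume "q pZ = 0"
          then show False using eq nz by simp
        qed
        define u where "u = meval q P / meval q Q"
        have u: "u = q pY / (q pX - r * q pZ)" by (simp add: u_def eP eQ)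
        have "u ^ 2 * q pZ = q pX + 2 * r * q pZ"
          unfolding u using nz eq by (simp add: power_divide field_simps)
        then have u2: "u ^ 2 = q pX / q pZ + 2 * r" using z by (simp add: field_simps)
        have "poly (\<phi> i) u = 1 / q pZ * q i" for i
        proof (cases i)
          case pX
          then show ?thesis unfolding pX \<phi> u2 by simp
        next
          case pY
          have "u ^ 2 - 3 * r = (q pX - r * q pZ) / q pZ" unfolding u2 using z by (simp add: field_simps)
          then show ?thesis unfolding pY \<phi> using nz z by (simp add: u)
        next
          case pZ
          then show ?thesis unfolding pZ \<phi> using z by simp
        qed
        then have "(\<lambda>i. poly (\<phi> i) u) \<in> proj_class q"
          unfolding proj_class_def using z by (auto intro!: exI[of _ "1 / q pZ"])
        then show False using bad nQ unfolding u_def by blast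
      qed
      then have x: "q pX = r * q pZ" by (simp add: eQ)
      then have yz: "q pY ^ 2 * q pZ = 0" using eq by simp
      show "C \<in> {proj_class ?o, proj_class ?n}"
      proof (cases "q pZ = 0")
        case True
        have y: "q pY \<noteq> 0"
        proof
          assume "q pY = 0"
          then have "q i = 0" for i using True x by (cases i) auto
          then show False using q(1) by simp
        qed
        have e: "q i = q pY * ?o i" for i using True x by (cases i) auto
        have "C = proj_class ?o" unfolding C by (rule proj_class_eqI[OF y e])
        then show ?thesis by simp
      next
        case False
        have e: "q i = q pZ * ?n i" for i using False x yz by (cases i) auto
        have "C = proj_class ?n" unfolding C by (rule proj_class_eqI[OF False e])
        then show ?thesis by simp
      qed
    qed
  qed
  ultimately show ?thesis unfolding rational_curve_def by blast
qed

end

text \<open>The isomorphism of \<open>k[x,y,z]\<close> with \<open>k[z][y][x]\<close>.\<close>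

definition nest :: "(pvar, 'k::field) mpoly \<Rightarrow> 'k poly poly poly" where
  "nest = mev (\<lambda>c. [:[:[:c:]:]:]) (\<lambda>i. case i of pX \<Rightarrow> [:0, 1:] | pY \<Rightarrow> [:[:0, 1:]:] | pZ \<Rightarrow> [:[:[:0, 1:]:]:])"

interpretation nest_hom: coeff_hom "\<lambda>c. [:[:[:c:]:]:]"
  by unfold_locales (auto simp: one_pCons)

lemma meval_nest: "meval p P = poly (poly (poly (nest P) [:[:p pX:]:]) [:p pY:]) (p pZ)"
proof -
  have "poly (poly (poly (nest P) [:[:p pX:]:]) [:p pY:]) (p pZ) =
    mev (\<lambda>c. poly (poly (poly [:[:[:c:]:]:] [:[:p pX:]:]) [:p pY:]) (p pZ))
      (\<lambda>i. poly (poly (poly (case i of pX \<Rightarrow> [:0, 1:] | pY \<Rightarrow> [:[:0, 1:]:] | pZ \<Rightarrow> [:[:[:0, 1:]:]:]) [:[:p pX:]:]) [:p pY:]) (p pZ)) P"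
    unfolding nest_def by (simp only: peval_hom.hom_mev)
  also have "(\<lambda>i. poly (poly (poly (case i of pX \<Rightarrow> [:0, 1:] | pY \<Rightarrow> [:[:0, 1:]:] | pZ \<Rightarrow> [:[:[:0, 1:]:]:]) [:[:p pX:]:]) [:p pY:]) (p pZ)) = p"
    by (rule ext) (simp split: pvar.split)
  finally show ?thesis by (simp add: meval_eq_mev)
qed

lemma nest_cubic:
  fixes a b :: "'k::field"
  shows "nest (cubic a b) = [:[:[:0, 0, 0, - b:], 0, [:0, 1:]:], [:[:0, 0, - a:]:], 0, - 1:]"
  unfolding nest_def cubic_def
  by (simp add: nest_hom.mev_simps power2_eq_square power3_eq_cube one_pCons)

text \<open>As a polynomial in \<open>x\<close> over \<open>k[z][y]\<close> the cubic is monic up to sign, so a proper factorization would give a root \<open>\<rho>\<close>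
  in \<open>k[z][y]\<close>. It would satisfy \<open>\<rho>\<^sup>3 + az\<^sup>2\<rho> = y\<^sup>2z - bz\<^sup>3\<close>, where the degree in \<open>y\<close> of the left side is a multiple of
  three and that of the right side is two.\<close>

lemma irreducible_cubic:
  fixes a b :: "'k::field_char_0"
  shows "irreducible (cubic a b)"
proof (rule irreducibleI)
  let ?g = "nest (cubic a b)"
  have deg: "Polynomial.degree ?g = 3" and lead: "lead_coeff ?g = - 1" and g0: "?g \<noteq> 0"
    by (simp_all add: nest_cubic)
  have mult: "nest (P * Q) = nest P * nest Q" for P Q :: "(pvar, 'k) mpoly"
    unfolding nest_def by (rule nest_hom.mev_mult)
  show "cubic a b \<noteq> 0"
    using g0 by (auto simp: nest_def nest_hom.mev_0)
  show "\<not> cubic a b dvd 1"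
  proof
    assume "cubic a b dvd 1"
    then obtain h where "1 = cubic a b * h" by (rule dvdE)
    then have "1 = ?g * nest h" using mult[of "cubic a b" h] by (simp add: nest_def nest_hom.mev_1)
    then have "Polynomial.degree (?g * nest h) = 0" "nest h \<noteq> 0" by (metis degree_1, auto)
    then show False using g0 deg by (simp add: degree_mult_eq)
  qed
  have unit: "P dvd 1" if PQ: "cubic a b = P * Q" and d: "Polynomial.degree (nest P) \<le> 1" for P Q
  proof -
    have g: "?g = nest P * nest Q" using PQ mult by simp
    define l k where "l = lead_coeff (nest P)" and "k = lead_coeff (nest Q)"
    have lk: "l * k = - 1" using lead unfolding g lead_coeff_mult l_def k_def .
    then have l: "l * (- k) = 1" by simp
    have "Polynomial.degree (l * (- k)) = 0" "l \<noteq> 0" "k \<noteq> 0" using lk l by auto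
    then have "Polynomial.degree l = 0" by (simp add: degree_mult_eq)
    then obtain l' where l': "l = [:l':]" by (meson degree_eq_zeroE)
    have "Polynomial.degree k = 0"
      using \<open>Polynomial.degree (l * (- k)) = 0\<close> \<open>l \<noteq> 0\<close> \<open>k \<noteq> 0\<close> by (simp add: degree_mult_eq)
    then obtain k' where k': "k = [:k':]" by (meson degree_eq_zeroE)
    have "l' * (- k') = 1" using l unfolding l' k' by (simp add: one_pCons mult.commute)
    then have "Polynomial.degree (l' * (- k')) = 0" "l' \<noteq> 0" "k' \<noteq> 0" by auto
    then have "Polynomial.degree l' = 0" by (simp add: degree_mult_eq)
    then obtain c where c: "l = [:[:c:]:]" using l' by (metis degree_eq_zeroE)
    have c0: "c \<noteq> 0" using \<open>l \<noteq> 0\<close> c by auto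
    show "P dvd 1"
    proof (cases "Polynomial.degree (nest P) = 0")
      case True
      then have nP: "nest P = [:[:[:c:]:]:]" using c l_def by (metis degree_eq_zeroE lead_coeff_pCons(2))
      have "P - mconst c = 0"
        by (rule mpoly_zero_if_meval_zero) (simp add: meval_simps meval_nest[of _ P] nP)
      then have "P * mconst (1 / c) = 1"
        using c0 by (simp add: mconst_def mult_single)
      then show ?thesis by (metis dvdI)
    next
      case False
      then have "Polynomial.degree (nest P) = 1" using d by simp
      moreover obtain m q where mq: "nest P = pCons m q" by (rule pCons_cases)
      ultimately have "Polynomial.degree q = 0" "q \<noteq> 0"
        by (auto simp: degree_pCons_eq_if split: if_splits)
      then obtain e where e: "q = [:e:]" "e \<noteq> 0" by (metis degree_eq_zeroE pCons_0_0)
      then have nP: "nest P = [:m, l:]" unfolding l_def mq by simp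
      define \<rho> where "\<rho> = m * k"
      have "poly (nest P) \<rho> = m * (1 + l * k)" unfolding nP \<rho>_def by (simp add: algebra_simps)
      then have "poly ?g \<rho> = 0" unfolding g using lk by simp
      moreover have "poly ?g \<rho> = [:[:0, 0, 0, - b:], 0, [:0, 1:]:] - (\<rho> ^ 3 + [:[:0, 0, a:]:] * \<rho>)"
      proof -
        define h where "h = [:[:0, 0, a:]:]"
        have "[:[:0, 0, - a:]:] = - h" by (simp add: h_def)
        then show ?thesis
          unfolding nest_cubic h_def[symmetric] by (simp add: algebra_simps power3_eq_cube)
      qed
      ultimately have root: "\<rho> ^ 3 + [:[:0, 0, a:]:] * \<rho> = [:[:0, 0, 0, - b:], 0, [:0, 1:]:]"
        by simp
      have rhs: "Polynomial.degree [:[:0, 0, 0, - b:], 0, [:0, 1 :: 'k:]:] = 2" by simp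
      show ?thesis
      proof (cases "Polynomial.degree \<rho> = 0")
        case True
        then obtain s where "\<rho> = [:s:]" by (meson degree_eq_zeroE)
        then have "Polynomial.degree (\<rho> ^ 3 + [:[:0, 0, a:]:] * \<rho>) = 0" by (simp add: power3_eq_cube)
        then show ?thesis unfolding root rhs by simp
      next
        case False
        have "\<rho> \<noteq> 0" using False by auto
        have "Polynomial.degree ([:[:0, 0, a:]:] * \<rho>) \<le> Polynomial.degree \<rho>"
          using degree_mult_le[of "[:[:0, 0, a:]:]" \<rho>] by simp
        also have "\<dots> < 3 * Polynomial.degree \<rho>" using False by simp
        also have "\<dots> = Polynomial.degree (\<rho> ^ 3)" using \<open>\<rho> \<noteq> 0\<close> by (simp add: degree_power_eq)
        finally have "Polynomial.degree (\<rho> ^ 3 + [:[:0, 0, a:]:] * \<rho>) = 3 * Polynomial.degree \<rho>"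
          using \<open>\<rho> \<noteq> 0\<close> by (simp add: degree_add_eq_left degree_power_eq)
        then have "2 = 3 * Polynomial.degree \<rho>" unfolding root rhs .
        then have False by presburger
        then show ?thesis ..
      qed
    qed
  qed
  fix P Q assume PQ: "cubic a b = P * Q"
  have g: "?g = nest P * nest Q" using PQ mult by simp
  then have "nest P \<noteq> 0" "nest Q \<noteq> 0" using g0 by auto
  then have "Polynomial.degree (nest P) + Polynomial.degree (nest Q) = 3"
    using deg unfolding g by (simp add: degree_mult_eq)
  then consider "Polynomial.degree (nest P) \<le> 1" | "Polynomial.degree (nest Q) \<le> 1" by linarith
  then show "P dvd 1 \<or> Q dvd 1"
    using unit[OF PQ] unit[of Q P] PQ by (cases) (auto simp: mult.commute)
qed

lemma (in nodal_cubic) nodal_rational_cubic: "nodal_rational_curve (cubic a b)"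
  unfolding nodal_rational_curve_def
  using irreducible_cubic rational_cubic singular_point_exists node_cubic by blast

text \<open>A double root \<open>r\<close> of the cubic satisfies \<open>3r\<^sup>2 + a = 0\<close> and \<open>2ar + 3b = 0\<close>.\<close>

lemma nodal_cubic_parameter:
  fixes a b :: "'k::{alg_closed_field, field_char_0}"
  assumes "4 * a ^ 3 + 27 * b ^ 2 = 0" "a \<noteq> 0 \<or> b \<noteq> 0"
  shows "nodal_cubic a b (- 3 * b / (2 * a))"
proof -
  have a: "a \<noteq> 0" using assms by auto
  have b: "b \<noteq> 0" using assms a by auto
  have eq: "27 * b ^ 2 = - 4 * a ^ 3" using assms(1) by (simp add: eq_neg_iff_add_eq_0 add.commute)
  show ?thesis
  proof
    have "- 3 * (- 3 * b / (2 * a)) ^ 2 = - (27 * b ^ 2) / (4 * a ^ 2)"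
      by (simp add: power_divide power_mult_distrib)
    also have "\<dots> = a" unfolding eq using a by (simp add: field_simps power2_eq_square power3_eq_cube)
    finally show "a = - 3 * (- 3 * b / (2 * a)) ^ 2" by simp
    have "2 * (- 3 * b / (2 * a)) ^ 3 = - b * (27 * b ^ 2) / (4 * a ^ 3)"
      by (simp add: power_divide power_mult_distrib power2_eq_square power3_eq_cube ac_simps)
    also have "\<dots> = b" unfolding eq using a by simp
    finally show "b = 2 * (- 3 * b / (2 * a)) ^ 3" by simp
    show "- 3 * b / (2 * a) \<noteq> 0" using a b by simp
  qed
qed

lemma singular_cubic_disc:
  fixes a b :: "'k::field_char_0"
  assumes "singular_point (cubic a b) p"
  shows "4 * a ^ 3 + 27 * b ^ 2 = 0"
proof -
  note s = singular_point_cubic[OF assms]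
  have "p pZ ^ 2 * (4 * a ^ 3 + 27 * b ^ 2) = 4 * a ^ 2 * (3 * p pX ^ 2 + a * p pZ ^ 2)
      - 3 * (2 * a * p pX + 3 * b * p pZ) * (2 * a * p pX - 3 * b * p pZ)"
    by (simp add: algebra_simps power2_eq_square power3_eq_cube)
  then show ?thesis using s by simp
qed

section \<open>A discrete valuation above 2\<close>

definition subring_set :: "'k::comm_ring_1 set \<Rightarrow> bool" where
  "subring_set S \<longleftrightarrow> 1 \<in> S \<and> (\<forall>x\<in>S. \<forall>y\<in>S. x - y \<in> S \<and> x * y \<in> S)"

definition coeffs_in :: "'k::comm_ring_1 set \<Rightarrow> 'k poly \<Rightarrow> bool" where
  "coeffs_in S p \<longleftrightarrow> (\<forall>i. coeff p i \<in> S)"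

lemma subring_setD:
  assumes "subring_set S"
  shows "0 \<in> S" "1 \<in> S" "x \<in> S \<Longrightarrow> y \<in> S \<Longrightarrow> x - y \<in> S" "x \<in> S \<Longrightarrow> - x \<in> S"
    "x \<in> S \<Longrightarrow> y \<in> S \<Longrightarrow> x + y \<in> S" "x \<in> S \<Longrightarrow> y \<in> S \<Longrightarrow> x * y \<in> S" "x \<in> S \<Longrightarrow> x ^ n \<in> S"
proof -
  have *: "1 \<in> S" "\<And>x y. x \<in> S \<Longrightarrow> y \<in> S \<Longrightarrow> x - y \<in> S" "\<And>x y. x \<in> S \<Longrightarrow> y \<in> S \<Longrightarrow> x * y \<in> S"
    using assms by (auto simp: subring_set_def)
  then have 0: "0 \<in> S" by (metis diff_self)
  then have m: "- x \<in> S" if "x \<in> S" for x using *(2)[of 0 x] that by simp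
  show "0 \<in> S" "1 \<in> S" "x \<in> S \<Longrightarrow> y \<in> S \<Longrightarrow> x - y \<in> S" "x \<in> S \<Longrightarrow> - x \<in> S" "x \<in> S \<Longrightarrow> y \<in> S \<Longrightarrow> x * y \<in> S"
    using * 0 m by auto
  show "x \<in> S \<Longrightarrow> y \<in> S \<Longrightarrow> x + y \<in> S" using *(2)[of x "- y"] m by simp
  show "x \<in> S \<Longrightarrow> x ^ n \<in> S" using * by (induction n) auto
qed

lemma subring_set_sum: "subring_set S \<Longrightarrow> (\<And>i. i \<in> I \<Longrightarrow> f i \<in> S) \<Longrightarrow> sum f I \<in> S"
  by (induction I rule: infinite_finite_induct) (auto simp: subring_setD)

lemma coeffs_in_arith:
  assumes S: "subring_set S"
  shows "coeffs_in S p \<Longrightarrow> coeffs_in S q \<Longrightarrow> coeffs_in S (p + q)"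
    "coeffs_in S p \<Longrightarrow> coeffs_in S q \<Longrightarrow> coeffs_in S (p - q)"
    "coeffs_in S p \<Longrightarrow> coeffs_in S q \<Longrightarrow> coeffs_in S (p * q)"
    "coeffs_in S p \<Longrightarrow> coeffs_in S (p ^ n)"
    "c \<in> S \<Longrightarrow> coeffs_in S (monom c n)" "c \<in> S \<Longrightarrow> coeffs_in S [:c:]"
proof -
  show mult: "coeffs_in S p \<Longrightarrow> coeffs_in S q \<Longrightarrow> coeffs_in S (p * q)" for p q
    by (auto simp: coeffs_in_def coeff_mult intro!: subring_set_sum[OF S] subring_setD(6)[OF S])
  show "c \<in> S \<Longrightarrow> coeffs_in S (monom c n)" "c \<in> S \<Longrightarrow> coeffs_in S [:c:]" for c n
    by (auto simp: coeffs_in_def coeff_pCons subring_setD[OF S] split: nat.split)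
  then have "coeffs_in S 1" using subring_setD(2)[OF S] by (metis one_pCons)
  then show "coeffs_in S p \<Longrightarrow> coeffs_in S (p ^ n)" by (induction n) (auto intro: mult)
qed (auto simp: coeffs_in_def subring_setD[OF S])

lemma coeffs_in_sum: "subring_set S \<Longrightarrow> (\<And>i. i \<in> I \<Longrightarrow> coeffs_in S (f i)) \<Longrightarrow> coeffs_in S (sum f I)"
  by (auto simp: coeffs_in_def coeff_sum intro!: subring_set_sum)

text \<open>If \<open>1/2\<close> lies both in \<open>S[x]\<close> and in \<open>S[1/x]\<close>, an expression of it by a polynomial in \<open>x\<close> can be shortened:
  the relation for \<open>1/x\<close> rewrites \<open>(1 - 2q\<^sub>0) x\<^sup>n\<close> in terms of lower powers.\<close>

lemma shorten_half:
  fixes S :: "'k::field_char_0 set"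
  assumes S: "subring_set S" and p: "coeffs_in S p" "2 * poly p x = 1"
    and q: "coeffs_in S q" "2 * poly q (inverse x) = 1"
    and deg: "Polynomial.degree q \<le> Polynomial.degree p" "0 < Polynomial.degree p" and x: "x \<noteq> 0"
  shows "\<exists>r. coeffs_in S r \<and> 2 * poly r x = 1 \<and> Polynomial.degree r < Polynomial.degree p"
proof -
  define n q0 where "n = Polynomial.degree p" and "q0 = coeff q 0"
  define p' where "p' = p - monom (coeff p n) n"
  define s where "s = (\<Sum>j\<in>{1..Polynomial.degree q}. monom (coeff q j) (n - j))"
  define r where "r = [:q0:] + [:1 - 2 * q0:] * p' + [:2 * coeff p n:] * s"
  have ev: "x ^ n * poly q (inverse x) = q0 * x ^ n + poly s x"
  proof -
    have "x ^ n * poly q (inverse x) = (\<Sum>j\<le>Polynomial.degree q. coeff q j * (x ^ n * inverse x ^ j))"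
      by (simp add: poly_altdef sum_distrib_left ac_simps)
    also have "\<dots> = (\<Sum>j\<le>Polynomial.degree q. coeff q j * x ^ (n - j))"
      by (rule sum.cong) (use deg x in \<open>auto simp: n_def power_diff field_simps\<close>)
    also have "{..Polynomial.degree q} = insert 0 {1..Polynomial.degree q}" by auto
    finally show ?thesis by (simp add: s_def poly_sum poly_monom q0_def)
  qed
  have xn: "(1 - 2 * q0) * x ^ n = 2 * poly s x"
  proof -
    have "x ^ n = 2 * (x ^ n * poly q (inverse x))" using q(2) by (simp add: ac_simps)
    then show ?thesis unfolding ev by (simp add: algebra_simps)
  qed
  have "2 * poly r x = 2 * q0 + (1 - 2 * q0) * (2 * poly p' x) + 2 * coeff p n * (2 * poly s x)"
    by (simp add: r_def algebra_simps)
  also have "\<dots> = 2 * q0 + (1 - 2 * q0) * (2 * poly p x)"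
    unfolding xn[symmetric] by (simp add: p'_def poly_monom algebra_simps)
  finally have "2 * poly r x = 1" using p(2) by simp
  moreover have "coeffs_in S r"
  proof -
    have two: "2 \<in> S" using subring_setD(5)[OF S subring_setD(2)[OF S] subring_setD(2)[OF S]] by simp
    have c: "coeff p n \<in> S" "q0 \<in> S" using p q by (auto simp: coeffs_in_def q0_def)
    have "1 - 2 * q0 \<in> S" "2 * coeff p n \<in> S"
      using c two subring_setD[OF S] by auto
    moreover have "coeffs_in S p'" unfolding p'_def using p c by (intro coeffs_in_arith[OF S]) auto
    moreover have "coeffs_in S s" unfolding s_def
      by (intro coeffs_in_sum[OF S] coeffs_in_arith(5)[OF S]) (use q in \<open>auto simp: coeffs_in_def\<close>)
    ultimately show ?thesis unfolding r_def using c by (intro coeffs_in_arith[OF S]) auto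
  qed
  moreover have "Polynomial.degree r < n"
  proof -
    have "Polynomial.degree p' < n"
    proof (rule degree_lessI)
      show "p' \<noteq> 0 \<or> 0 < n" using deg by (simp add: n_def)
      show "\<forall>k\<ge>n. coeff p' k = 0" by (auto simp: p'_def n_def coeff_eq_0)
    qed
    moreover have "Polynomial.degree s < n"
    proof -
      have "Polynomial.degree s \<le> n - 1" unfolding s_def
        by (rule degree_sum_le) (auto intro!: order.trans[OF degree_monom_le])
      then show ?thesis using deg by (simp add: n_def)
    qed
    moreover have "Polynomial.degree ([:c:] * t) \<le> Polynomial.degree t" for c :: 'k and t
      by (simp add: degree_smult_le)
    ultimately show ?thesis
      unfolding r_def using deg(2)
      by (intro degree_add_less) (auto simp: n_def intro: le_less_trans)
  qed
  ultimately show ?thesis unfolding n_def by blast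
qed

text \<open>A subring maximal among those not containing \<open>1/2\<close> is a valuation ring: if it contained neither \<open>x\<close> nor \<open>1/x\<close>,
  adjoining either would produce \<open>1/2\<close>, and of two expressions of minimal degree the longer one could be shortened.\<close>

lemma valuation_ring_exists:
  obtains R :: "'k::field_char_0 set" where "subring_set R" "inverse 2 \<notin> R" "\<And>x. x \<noteq> 0 \<Longrightarrow> x \<in> R \<or> inverse x \<in> R"
proof -
  define \<A> where "\<A> = {S :: 'k set. subring_set S \<and> inverse 2 \<notin> S}"
  have "range of_int \<in> \<A>"
  proof -
    have "inverse 2 \<noteq> (of_int n :: 'k)" for n
    proof
      assume "inverse 2 = (of_int n :: 'k)"
      then have "of_int (2 * n) = (1 :: 'k)" by (simp flip: \<open>inverse 2 = (of_int n :: 'k)\<close>)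
      then have "2 * n = 1" by (metis of_int_eq_1_iff)
      then show False by presburger
    qed
    moreover have "subring_set (range of_int :: 'k set)"
      unfolding subring_set_def by (auto intro: range_eqI[of _ _ 1] simp flip: of_int_diff of_int_mult)
    ultimately show ?thesis by (auto simp: \<A>_def)
  qed
  then have ne: "\<A> \<noteq> {}" by blast
  have "\<exists>M\<in>\<A>. \<forall>N\<in>\<A>. M \<subseteq> N \<longrightarrow> N = M"
  proof (rule subset_Zorn_nonempty[OF ne])
    fix C assume C: "C \<noteq> {}" "subset.chain \<A> C"
    then have sub: "\<And>S. S \<in> C \<Longrightarrow> subring_set S \<and> inverse 2 \<notin> S"
      by (auto simp: subset.chain_def \<A>_def)
    have "x - y \<in> \<Union> C \<and> x * y \<in> \<Union> C" if xy: "x \<in> \<Union> C" "y \<in> \<Union> C" for x y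
    proof -
      obtain S T where ST: "S \<in> C" "x \<in> S" "T \<in> C" "y \<in> T" using xy by blast
      then have "S \<subseteq> T \<or> T \<subseteq> S" using C(2) by (auto simp: subset.chain_def)
      then obtain U where U: "U \<in> C" "x \<in> U" "y \<in> U" using ST by blast
      then show ?thesis using sub[OF U(1)] subring_setD(3,6)[of U x y] by blast
    qed
    moreover have "1 \<in> \<Union> C" using C(1) sub subring_setD(2) by blast
    ultimately show "\<Union> C \<in> \<A>" using sub by (auto simp: \<A>_def subring_set_def)
  qed
  then obtain M where M: "subring_set M" "inverse 2 \<notin> M" and max: "\<And>N. N \<in> \<A> \<Longrightarrow> M \<subseteq> N \<Longrightarrow> N = M"
    unfolding \<A>_def by blast
  have adj: "\<exists>p. coeffs_in M p \<and> 2 * poly p x = 1" if x: "x \<notin> M" for x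
  proof -
    let ?X = "{poly p x | p. coeffs_in M p}"
    have X: "subring_set ?X"
      unfolding subring_set_def
    proof (intro conjI ballI)
      show "1 \<in> ?X" using coeffs_in_arith(6)[OF M(1) subring_setD(2)[OF M(1)]] by force
      fix y z assume "y \<in> ?X" "z \<in> ?X"
      then obtain p q where pq: "y = poly p x" "z = poly q x" "coeffs_in M p" "coeffs_in M q" by blast
      show "y - z \<in> ?X"
        using pq coeffs_in_arith(2)[OF M(1) pq(3,4)] by (auto intro!: exI[of _ "p - q"])
      show "y * z \<in> ?X"
        using pq coeffs_in_arith(3)[OF M(1) pq(3,4)] by (auto intro!: exI[of _ "p * q"])
    qed
    have "M \<subseteq> ?X"
    proof
      fix c assume "c \<in> M"
      then show "c \<in> ?X" using coeffs_in_arith(6)[OF M(1)] by (auto intro!: exI[of _ "[:c:]"])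
    qed
    moreover have "x \<in> ?X"
      using coeffs_in_arith(5)[OF M(1) subring_setD(2)[OF M(1)], of 1]
      by (intro CollectI exI[of _ "monom 1 1"]) (simp add: poly_monom)
    ultimately have "?X \<notin> \<A>" using max x by blast
    then have "inverse 2 \<in> ?X" using X by (simp add: \<A>_def)
    then obtain p where "inverse 2 = poly p x" "coeffs_in M p" by blast
    moreover have "2 * inverse 2 = (1 :: 'k)" by simp
    ultimately show ?thesis by (intro exI[of _ p]) (simp only: simp_thms)
  qed
  have "x \<in> M \<or> inverse x \<in> M" if x: "x \<noteq> 0" for x
  proof (rule ccontr)
    assume neg: "\<not> (x \<in> M \<or> inverse x \<in> M)"
    define good where "good = (\<lambda>d y. \<exists>p. coeffs_in M p \<and> 2 * poly p y = 1 \<and> Polynomial.degree p = d)"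
    have ex: "\<exists>d. good d x" "\<exists>d. good d (inverse x)" using adj neg by (auto simp: good_def)
    define n m where "n = (LEAST d. good d x)" and "m = (LEAST d. good d (inverse x))"
    have gn: "good n x" and gm: "good m (inverse x)" unfolding n_def m_def by (rule LeastI_ex[OF ex(1)], rule LeastI_ex[OF ex(2)])
    have ln: "\<not> good d x" if "d < n" for d using that unfolding n_def by (rule not_less_Least)
    have lm: "\<not> good d (inverse x)" if "d < m" for d using that unfolding m_def by (rule not_less_Least)
    have pos: "\<not> good 0 y" for y
    proof
      assume "good 0 y"
      then obtain p where p: "coeffs_in M p" "2 * poly p y = 1" "Polynomial.degree p = 0"
        by (auto simp: good_def)
      then obtain c where c: "p = [:c:]" by (meson degree_eq_zeroE)
      then have "2 * c = 1" using p by simp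
      then have "c = inverse 2" by (metis inverse_unique)
      moreover have "c \<in> M" using p(1) c by (auto simp: coeffs_in_def dest: spec[of _ 0])
      ultimately have "inverse 2 \<in> M" by (simp only:)
      then show False using M(2) by contradiction
    qed
    obtain p where p: "coeffs_in M p" "2 * poly p x = 1" "Polynomial.degree p = n" using gn by (auto simp: good_def)
    obtain q where q: "coeffs_in M q" "2 * poly q (inverse x) = 1" "Polynomial.degree q = m" using gm by (auto simp: good_def)
    have n: "0 < n" and m: "0 < m" using pos gn gm by (metis gr0I)+
    show False
    proof (cases "m \<le> n")
      case True
      then show ?thesis
        using shorten_half[OF M(1) p(1,2) q(1,2)] p(3) q(3) n x ln unfolding good_def by metis
    next
      case False
      then show ?thesis
        using shorten_half[OF M(1) q(1,2), of p] p q m x lm unfolding good_def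
        by (metis inverse_inverse_eq inverse_nonzero_iff_nonzero nat_le_linear)
    qed
  qed
  then show thesis using M that by blast
qed

locale dyadic_ring =
  fixes R :: "'k::field_char_0 set"
  assumes R: "subring_set R" and half: "inverse 2 \<notin> R" and total: "x \<noteq> 0 \<Longrightarrow> x \<in> R \<or> inverse x \<in> R"
begin

lemmas R_arith = subring_setD[OF R]

definition unit :: "'k \<Rightarrow> bool" where
  "unit x \<longleftrightarrow> x \<noteq> 0 \<and> x \<in> R \<and> inverse x \<in> R"

lemma unit_1 [simp]: "unit 1"
  by (simp add: unit_def R_arith)

lemma unit_mult: "unit x \<Longrightarrow> unit y \<Longrightarrow> unit (x * y)"
  by (simp add: unit_def R_arith)

lemma unit_inverse: "unit x \<Longrightarrow> unit (inverse x)"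
  by (simp add: unit_def)

lemma unit_power: "unit x \<Longrightarrow> unit (x ^ n)"
  by (induction n) (auto intro: unit_mult)

lemma in_R_if_power_in_R: "x ^ Suc n \<in> R \<Longrightarrow> x \<in> R"
proof (cases "x = 0 \<or> x \<in> R")
  case False
  assume *: "x ^ Suc n \<in> R"
  have "inverse x \<in> R" using False total[of x] by auto
  then have "inverse x ^ n \<in> R" by (rule R_arith(7))
  then have "x ^ Suc n * inverse x ^ n \<in> R" by (rule R_arith(6)[OF *])
  moreover have "x ^ Suc n * inverse x ^ n = x" using False by (simp add: field_simps)
  ultimately show ?thesis by (simp only:)
qed (auto simp: R_arith)

lemma nonunit_mult: "x \<in> R \<Longrightarrow> \<not> unit x \<Longrightarrow> y \<in> R \<Longrightarrow> \<not> unit (x * y)"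
proof
  assume *: "x \<in> R" "\<not> unit x" "y \<in> R" "unit (x * y)"
  then have "inverse (x * y) \<in> R" "x \<noteq> 0" "y \<noteq> 0" by (auto simp: unit_def)
  then have "y * inverse (x * y) \<in> R" "x \<noteq> 0" "y \<noteq> 0" using *(3) R_arith(6) by blast+
  moreover from this have "y * inverse (x * y) = inverse x" by (simp add: field_simps)
  ultimately have "inverse x \<in> R" by (simp only:)
  then show False using * \<open>x \<noteq> 0\<close> by (simp add: unit_def)
qed

lemma nonunit_add:
  assumes "x \<in> R" "\<not> unit x" "y \<in> R" "\<not> unit y"
  shows "\<not> unit (x + y)"
proof (cases "x = 0 \<or> y = 0")
  case False
  then consider "y / x \<in> R" | "x / y \<in> R" using total[of "x / y"] by (auto simp: field_simps)
  then show ?thesis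
  proof cases
    case 1
    have "x + y = x * (1 + y / x)" using False by (simp add: field_simps)
    then show ?thesis using nonunit_mult[OF assms(1,2), of "1 + y / x"] 1 by (simp add: R_arith)
  next
    case 2
    have "x + y = y * (1 + x / y)" using False by (simp add: field_simps)
    then show ?thesis using nonunit_mult[OF assms(3,4), of "1 + x / y"] 2 by (simp add: R_arith)
  qed
qed (use assms in auto)

lemma nonunit_sum:
  assumes "finite I" "\<And>i. i \<in> I \<Longrightarrow> t i \<in> R \<and> \<not> unit (t i)"
  shows "sum t I \<in> R \<and> \<not> unit (sum t I)"
  using assms
proof (induction I rule: finite_induct)
  case empty
  then show ?case by (simp add: R_arith unit_def)
next
  case (insert i I)
  then show ?case using nonunit_add[of "t i" "sum t I"] R_arith(5)[of "t i" "sum t I"] by auto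
qed

text \<open>Divisibility in a valuation ring is total, so some term divides all others. If all the other quotients were nonunits,
  their sum, which is \<open>-1\<close>, would be a nonunit.\<close>

lemma vanishing_sum_two_terms:
  assumes I: "finite I" "I \<noteq> {}" and nz: "\<And>i. i \<in> I \<Longrightarrow> t i \<noteq> 0" and sum: "sum t I = 0"
  shows "\<exists>i\<in>I. \<exists>j\<in>I. i \<noteq> j \<and> unit (t i / t j)"
proof -
  have "\<exists>k\<in>I. \<forall>i\<in>I. t i / t k \<in> R"
    using I nz
  proof (induction I rule: finite_ne_induct)
    case (singleton k)
    then show ?case by (simp add: R_arith)
  next
    case (insert l I)
    then obtain k where k: "k \<in> I" "\<And>i. i \<in> I \<Longrightarrow> t i / t k \<in> R" by auto
    have nz: "t k \<noteq> 0" "t l \<noteq> 0" using k insert by auto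
    then consider "t l / t k \<in> R" | "t k / t l \<in> R" using total[of "t k / t l"] by (auto simp: field_simps)
    then show ?case
    proof cases
      case 1
      then show ?thesis using k by auto
    next
      case 2
      have "t i / t l \<in> R" if "i \<in> I" for i
      proof -
        have "t i / t l = (t i / t k) * (t k / t l)" using nz by simp
        then show ?thesis using k(2)[OF that] 2 by (metis R_arith(6))
      qed
      then show ?thesis using nz by (auto simp: R_arith)
    qed
  qed
  then obtain k where k: "k \<in> I" "\<And>i. i \<in> I \<Longrightarrow> t i / t k \<in> R" by blast
  show ?thesis
  proof (rule ccontr)
    assume "\<not> ?thesis"
    then have no: "\<not> unit (t i / t k)" if "i \<in> I - {k}" for i using k(1) that by blast
    have "\<not> unit (\<Sum>i\<in>I - {k}. t i / t k)" using no nonunit_sum[of "I - {k}"] I k by auto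
    moreover have "(\<Sum>i\<in>I - {k}. t i / t k) = - 1"
    proof -
      have "t k + sum t (I - {k}) = 0" using sum I k(1) by (metis sum.remove)
      then have "sum t (I - {k}) = - t k" by (simp add: eq_neg_iff_add_eq_0 add.commute)
      then show ?thesis using nz[OF k(1)] by (simp flip: sum_divide_distrib)
    qed
    ultimately show False by (simp add: unit_def R_arith)
  qed
qed

lemma not_unit_2: "\<not> unit 2" and two_in_R: "2 \<in> R"
  using half R_arith(5)[OF R_arith(2) R_arith(2)] by (auto simp: unit_def)

lemma of_int_in_R: "of_int n \<in> R"
proof (induction n)
  case (nonneg n)
  then show ?case by (induction n) (auto intro: R_arith)
next
  case (neg n)
  have "of_nat m \<in> R" for m by (induction m) (auto intro: R_arith)
  from R_arith(4)[OF this[of "Suc n"]] show ?case by simp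
qed

lemma unit_odd: "odd n \<Longrightarrow> unit (of_int n)"
proof (rule ccontr)
  assume n: "odd n" and nu: "\<not> unit (of_int n)"
  obtain k where k: "n = 2 * k + 1" using n by (rule oddE)
  have "\<not> unit (of_int n + 2 * of_int (- k))"
    by (rule nonunit_add[OF of_int_in_R nu R_arith(6)[OF two_in_R of_int_in_R] nonunit_mult[OF two_in_R not_unit_2 of_int_in_R]])
  then show False by (simp add: k)
qed

text \<open>The valuation normalized by the value 1 of 2, described without a value group: some power of \<open>x\<close> agrees with a power of 2
  up to a unit.\<close>

definition has_val :: "'k \<Rightarrow> rat \<Rightarrow> bool" where
  "has_val x q \<longleftrightarrow> x \<noteq> 0 \<and> (\<exists>j>0. \<exists>n. q = of_int n / of_nat j \<and> unit (x ^ j / 2 powi n))"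

lemma two_powi_power: "(2 powi n) ^ j = (2 :: 'k) powi (n * int j)"
  by (simp add: power_int_mult)

lemma has_val_mult:
  assumes "has_val x q" "has_val y r"
  shows "has_val (x * y) (q + r)"
proof -
  obtain j n where 1: "j > 0" "q = of_int n / of_nat j" "unit (x ^ j / 2 powi n)" "x \<noteq> 0"
    using assms(1) by (auto simp: has_val_def)
  obtain k m where 2: "k > 0" "r = of_int m / of_nat k" "unit (y ^ k / 2 powi m)" "y \<noteq> 0"
    using assms(2) by (auto simp: has_val_def)
  have "unit ((x ^ j / 2 powi n) ^ k * (y ^ k / 2 powi m) ^ j)"
    by (intro unit_mult unit_power 1 2)
  also have "(x ^ j / 2 powi n) ^ k * (y ^ k / 2 powi m) ^ j = (x * y) ^ (j * k) / 2 powi (n * int k + m * int j)"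
    by (simp add: power_divide two_powi_power power_int_add power_mult_distrib mult.commute[of j k] flip: power_mult)
  finally have "unit ((x * y) ^ (j * k) / 2 powi (n * int k + m * int j))" .
  moreover have "q + r = of_int (n * int k + m * int j) / of_nat (j * k)"
    using 1 2 by (simp add: field_simps)
  moreover have "j * k > 0" using 1 2 by simp
  moreover have "x * y \<noteq> 0" using 1 2 by simp
  ultimately show ?thesis unfolding has_val_def by blast
qed

lemma has_val_inverse: "has_val x q \<Longrightarrow> has_val (inverse x) (- q)"
proof -
  assume "has_val x q"
  then obtain j n where 1: "j > 0" "q = of_int n / of_nat j" "unit (x ^ j / 2 powi n)" "x \<noteq> 0"
    by (auto simp: has_val_def)
  have "unit (inverse (x ^ j / 2 powi n))" by (rule unit_inverse[OF 1(3)])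
  also have "inverse (x ^ j / 2 powi n) = inverse x ^ j / 2 powi (- n)"
    by (simp add: power_int_minus field_simps)
  finally have "unit (inverse x ^ j / 2 powi (- n))" .
  moreover have "- q = of_int (- n) / of_nat j" using 1 by simp
  ultimately show ?thesis unfolding has_val_def using 1(1,4) by (metis inverse_nonzero_iff_nonzero)
qed

lemma has_val_nonneg:
  assumes "has_val x q" "x \<in> R"
  shows "q \<ge> 0"
proof (rule ccontr)
  assume q: "\<not> q \<ge> 0"
  obtain j n where 1: "j > 0" "q = of_int n / of_nat j" "unit (x ^ j / 2 powi n)" "x \<noteq> 0"
    using assms by (auto simp: has_val_def)
  have n: "n < 0" using q 1 by (auto simp: divide_less_0_iff not_le)
  have "2 powi (- n) = 2 * (2 :: 'k) ^ nat (- n - 1)"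
    using n by (simp add: power_int_def flip: power_Suc) (simp add: nat_diff_distrib)
  then have "x ^ j / 2 powi n = 2 * ((2 :: 'k) ^ nat (- n - 1) * x ^ j)"
    by (simp add: power_int_minus field_simps)
  moreover have "(2 :: 'k) ^ nat (- n - 1) * x ^ j \<in> R" by (intro R_arith two_in_R assms)
  ultimately have "\<not> unit (x ^ j / 2 powi n)" using nonunit_mult[OF two_in_R not_unit_2] by metis
  then show False using 1(3) by simp
qed

lemma has_val_0: "has_val x 0 \<Longrightarrow> x \<in> R"
proof -
  assume "has_val x 0"
  then obtain j n where 1: "j > 0" "0 = (of_int n / of_nat j :: rat)" "unit (x ^ j / 2 powi n)"
    by (auto simp: has_val_def)
  then have "x ^ j \<in> R" by (simp add: unit_def)
  then show "x \<in> R" using in_R_if_power_in_R[of x "j - 1"] 1(1) by simp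
qed

lemma has_val_in_R_iff: "has_val x q \<Longrightarrow> x \<in> R \<longleftrightarrow> q \<ge> 0"
proof
  assume x: "has_val x q" and q: "q \<ge> 0"
  show "x \<in> R"
  proof (rule ccontr)
    assume "x \<notin> R"
    then have "inverse x \<in> R" using total x by (auto simp: has_val_def)
    then have "- q \<ge> 0" using has_val_nonneg[OF has_val_inverse[OF x]] by simp
    then have "q = 0" using q by simp
    then show False using has_val_0 x \<open>x \<notin> R\<close> by simp
  qed
qed (rule has_val_nonneg)

lemma has_val_unique: "has_val x q \<Longrightarrow> has_val x r \<Longrightarrow> q = r"
proof -
  assume x: "has_val x q" "has_val x r"
  then have nz: "x \<noteq> 0" by (simp add: has_val_def)
  have "has_val (x * inverse x) (q + - r)" "has_val (x * inverse x) (r + - q)"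
    by (intro has_val_mult has_val_inverse x)+
  moreover have "x * inverse x \<in> R" using nz R_arith(2) by simp
  ultimately have "q + - r \<ge> 0" "r + - q \<ge> 0"
    using has_val_nonneg by blast+
  then show "q = r" by simp
qed

lemma has_val_add:
  assumes "has_val x q" "has_val y r" "has_val (x + y) s"
  shows "s \<ge> min q r"
proof -
  have *: "s \<ge> q" if x: "has_val x q" and y: "has_val y r" and xy: "has_val (x + y) s" and qr: "q \<le> r" for x y q r s
  proof -
    have nz: "x \<noteq> 0" using x by (simp add: has_val_def)
    have "has_val (y * inverse x) (r + - q)" by (intro has_val_mult has_val_inverse x y)
    then have "y * inverse x \<in> R" using has_val_in_R_iff qr by simp
    then have "1 + y * inverse x \<in> R" by (rule R_arith(5)[OF R_arith(2)])
    moreover have "(x + y) * inverse x = 1 + y * inverse x" using nz by (simp add: field_simps)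
    moreover have "has_val ((x + y) * inverse x) (s + - q)" by (intro has_val_mult has_val_inverse x xy)
    ultimately have "s + - q \<ge> 0" using has_val_nonneg by metis
    then show ?thesis by simp
  qed
  show ?thesis
    using *[OF assms(1,2,3)] *[OF assms(2,1)] assms(3) by (cases "q \<le> r") (auto simp: add.commute)
qed

lemma has_val_of_int: "n \<noteq> 0 \<Longrightarrow> \<exists>k :: int. has_val (of_int n) (of_int k)"
proof -
  assume n: "n \<noteq> 0"
  obtain m where mk: "n = 2 ^ multiplicity 2 n * m" "odd m"
    using n multiplicity_decompose'[of n "2 :: int"] by auto
  define k where "k = multiplicity 2 n"
  note mk = mk[folded k_def]
  have "unit (of_int n ^ 1 / 2 powi (int k))"
    using unit_odd[OF mk(2)] by (simp add: mk(1))
  then have "has_val (of_int n) (of_int (int k))"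
    unfolding has_val_def using n by (intro conjI exI[of _ 1] exI[of _ "int k"]) auto
  then show ?thesis by blast
qed

lemma has_val_of_rat: "q \<noteq> 0 \<Longrightarrow> \<exists>k :: int. has_val (of_rat q) (of_int k)"
proof -
  assume q: "q \<noteq> 0"
  obtain a b where ab: "q = of_int a / of_int b" "b \<noteq> 0"
    by (cases q) (auto simp: Fract_of_int_quotient)
  then have a: "a \<noteq> 0" using q by auto
  obtain k l :: int where kl: "has_val (of_int a) (of_int k)" "has_val (of_int b) (of_int l)"
    using has_val_of_int a ab by metis
  have "has_val (of_int a * inverse (of_int b)) (of_int k + - of_int l)"
    by (intro has_val_mult has_val_inverse kl)
  moreover have "of_int a * inverse (of_int b) = (of_rat q :: 'k)"
    by (simp add: ab of_rat_divide) (simp add: divide_inverse)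
  ultimately have "has_val (of_rat q) (of_int (k - l))" by simp
  then show ?thesis by blast
qed

text \<open>In a vanishing polynomial expression two terms have the same value, which determines the value of \<open>x\<close> from those of
  two coefficients.\<close>

lemma has_val_root:
  assumes sum: "(\<Sum>i\<le>n. c i * x ^ i) = 0" and nz: "\<exists>i\<le>n. c i \<noteq> 0" and x: "x \<noteq> 0"
    and val: "\<And>i. i \<le> n \<Longrightarrow> c i \<noteq> 0 \<Longrightarrow> \<exists>q\<in>Q. has_val (c i) q"
  shows "\<exists>j q r. 0 < j \<and> j \<le> n \<and> q \<in> Q \<and> r \<in> Q \<and> has_val x ((q - r) / of_nat j)"
proof -
  let ?I = "{i. i \<le> n \<and> c i \<noteq> 0}"
  have "sum (\<lambda>i. c i * x ^ i) ?I = 0"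
    using sum by (subst sum.mono_neutral_left[of "{..n}"]) auto
  then obtain i j where ij: "i \<in> ?I" "j \<in> ?I" "i \<noteq> j" "unit (c i * x ^ i / (c j * x ^ j))"
    using vanishing_sum_two_terms[of ?I "\<lambda>i. c i * x ^ i"] nz x by fastforce
  have *: ?thesis if ij: "i \<in> ?I" "j \<in> ?I" "j < i" and u: "unit (c i * x ^ i / (c j * x ^ j))" for i j
  proof -
    obtain q r where q: "q \<in> Q" "has_val (c i) q" and r: "r \<in> Q" "has_val (c j) r" using val[of i] val[of j] ij by auto
    define d where "d = i - j"
    have d: "0 < d" "d \<le> n" using ij by (auto simp: d_def)
    have "has_val (c j * inverse (c i)) (r + - q)" by (intro has_val_mult has_val_inverse q r)
    then obtain l m where lm: "l > 0" "r + - q = of_int m / of_nat l" "unit ((c j * inverse (c i)) ^ l / 2 powi m)"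
      by (auto simp: has_val_def)
    have "x ^ i = x ^ d * x ^ j" using ij by (simp add: d_def flip: power_add)
    then have "c i * x ^ i / (c j * x ^ j) = x ^ d / (c j * inverse (c i))"
      using x ij by (simp add: field_simps)
    then have "unit ((x ^ d / (c j * inverse (c i))) ^ l * ((c j * inverse (c i)) ^ l / 2 powi m))"
      using u lm by (intro unit_mult unit_power) auto
    also have "(x ^ d / (c j * inverse (c i))) ^ l * ((c j * inverse (c i)) ^ l / 2 powi m) = x ^ (d * l) / 2 powi m"
      using ij by (simp add: power_divide power_mult)
    finally have "has_val x (of_int m / of_nat (d * l))"
      unfolding has_val_def using x d lm(1) by (metis nat_0_less_mult_iff)
    also have "of_int m / of_nat (d * l) = (r - q) / of_nat d" using lm by simp
    finally show ?thesis using d q(1) r(1) by blast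
  qed
  show ?thesis
  proof (cases "j < i")
    case True
    then show ?thesis using * ij by blast
  next
    case False
    have "unit (c j * x ^ j / (c i * x ^ i))" using unit_inverse[OF ij(4)] by simp
    then show ?thesis using *[of j i] ij False by auto
  qed
qed

end

lemma number_field_relation:
  assumes "number_field TYPE('f::field_char_0)"
  obtains d where "\<And>x :: 'f. \<exists>c :: nat \<Rightarrow> rat. (\<exists>i\<le>d. c i \<noteq> 0) \<and> (\<Sum>i\<le>d. of_rat (c i) * x ^ i) = 0"
proof -
  interpret vector_space "\<lambda>(q::rat) (x::'f). of_rat q * x"
    by unfold_locales (simp_all add: algebra_simps of_rat_add of_rat_mult)
  obtain B :: "'f set" where B: "finite B" "span B = UNIV"
    using assms by (auto simp: number_field_def)
  have "\<exists>c :: nat \<Rightarrow> rat. (\<exists>i\<le>card B. c i \<noteq> 0) \<and> (\<Sum>i\<le>card B. of_rat (c i) * x ^ i) = 0" for x :: 'f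
  proof (cases "inj_on (\<lambda>i. x ^ i) {..card B}")
    case True
    let ?S = "(\<lambda>i. x ^ i) ` {..card B}"
    have "card ?S = Suc (card B)" using True by (simp add: card_image)
    then have "dependent ?S" using independent_span_bound[OF B(1), of ?S] B(2) by auto
    then obtain u where u: "\<exists>y\<in>?S. u y \<noteq> 0" "(\<Sum>y\<in>?S. of_rat (u y) * y) = 0"
      by (auto simp: dependent_finite)
    then show ?thesis
      by (intro exI[of _ "\<lambda>i. u (x ^ i)"]) (auto simp: sum.reindex[OF True])
  next
    case False
    then obtain i j where ij: "i \<le> card B" "j \<le> card B" "i \<noteq> j" "x ^ i = x ^ j" by (auto simp: inj_on_def)
    let ?c = "\<lambda>k. if k = i then 1 else if k = j then - 1 else (0 :: rat)"
    have "(\<Sum>k\<le>card B. of_rat (?c k) * x ^ k) = (\<Sum>k\<le>card B. (if k = i then x ^ k else 0) - (if k = j then x ^ k else 0))"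
      by (rule sum.cong) (use ij in auto)
    also have "\<dots> = 0" using ij by (simp add: sum_subtractf)
    finally show ?thesis using ij(1) by (intro exI[of _ ?c]) auto
  qed
  then show thesis by (rule that)
qed

lemma to_ac_of_rat: "to_ac (of_rat q) = of_rat q"
  by (cases q) (simp add: of_rat_rat)

locale dyadic_valuation =
  fixes v :: "'f::field_char_0 alg_closure \<Rightarrow> rat" and \<pi> :: 'f
  assumes v_mult: "x \<noteq> 0 \<Longrightarrow> y \<noteq> 0 \<Longrightarrow> v (x * y) = v x + v y"
    and v_add: "x \<noteq> 0 \<Longrightarrow> y \<noteq> 0 \<Longrightarrow> x + y \<noteq> 0 \<Longrightarrow> min (v x) (v y) \<le> v (x + y)"
    and v_base: "c \<noteq> 0 \<Longrightarrow> v (to_ac c) \<in> \<int>"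
    and pi_nonzero: "\<pi> \<noteq> 0" and v_pi: "v (to_ac \<pi>) = 1" and v_2: "1 \<le> v 2"

text \<open>Values of rational numbers are integers. An element of \<open>F\<close> satisfies a polynomial relation over \<open>\<rat>\<close> of
  degree at most \<open>d\<close>, so its value is a multiple of \<open>1/d!\<close>. The value group of \<open>F\<close> is therefore discrete, and
  dividing by its least positive element normalizes the valuation.\<close>

theorem dyadic_valuation_exists:
  assumes "number_field TYPE('f::field_char_0)"
  obtains v :: "'f::field_char_0 alg_closure \<Rightarrow> rat" and \<pi> where "dyadic_valuation v \<pi>"
proof -
  obtain R :: "'f alg_closure set" where R: "subring_set R" "inverse 2 \<notin> R" "\<And>x. x \<noteq> 0 \<Longrightarrow> x \<in> R \<or> inverse x \<in> R"
    using valuation_ring_exists by metis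
  interpret dyadic_ring R by unfold_locales (use R in auto)
  obtain d where d: "\<And>x :: 'f. \<exists>c :: nat \<Rightarrow> rat. (\<exists>i\<le>d. c i \<noteq> 0) \<and> (\<Sum>i\<le>d. of_rat (c i) * x ^ i) = 0"
    using number_field_relation[OF assms] by metis
  define N :: rat where "N = fact d"
  have N: "N > 0" by (simp add: N_def)
  have valF: "\<exists>m :: int. has_val (to_ac x) (of_int m / N)" if x: "x \<noteq> 0" for x
  proof -
    obtain c where c: "\<exists>i\<le>d. c i \<noteq> 0" "(\<Sum>i\<le>d. of_rat (c i) * x ^ i) = 0" using d by blast
    have "(\<Sum>i\<le>d. of_rat (c i) * to_ac x ^ i) = 0"
      using arg_cong[OF c(2), of to_ac] by (simp add: to_ac_sum to_ac_of_rat)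
    then obtain j q r where j: "0 < j" "j \<le> d" "q \<in> \<int>" "r \<in> \<int>" "has_val (to_ac x) ((q - r) / of_nat j)"
      using has_val_root[where n = d and c = "\<lambda>i. of_rat (c i)" and x = "to_ac x" and Q = \<int>] c(1) x has_val_of_rat
      by (metis (no_types, lifting) Ints_of_int of_rat_eq_0_iff to_ac_eq_0_iff)
    obtain m :: int where m: "q - r = of_int m" using j(3,4) by (metis Ints_diff Ints_cases)
    have "j dvd fact d" using j by (simp add: dvd_fact)
    then obtain k where k: "fact d = j * k" by blast
    then have "k \<noteq> 0" by (metis fact_nonzero mult_0_right)
    have "N = of_nat j * of_nat k" using k unfolding N_def by (metis of_nat_fact of_nat_mult)
    then have "(q - r) / of_nat j = of_int (m * int k) / N" using \<open>k \<noteq> 0\<close> j(1) by (simp add: m)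
    then show ?thesis using j(5) by metis
  qed
  have valK: "\<exists>q. has_val x q" if x: "x \<noteq> 0" for x
  proof -
    obtain p :: "'f poly" where p: "p \<noteq> 0" "poly (map_poly to_ac p) x = 0"
      using alg_closure_algebraic by blast
    let ?P = "map_poly to_ac p"
    have "(\<Sum>i\<le>Polynomial.degree ?P. coeff ?P i * x ^ i) = 0"
      using p(2) by (simp add: poly_altdef)
    moreover have "\<exists>i\<le>Polynomial.degree ?P. coeff ?P i \<noteq> 0"
      using p(1) by (intro exI[of _ "Polynomial.degree ?P"]) (auto simp: coeff_map_poly degree_map_poly)
    moreover have "\<exists>q\<in>UNIV. has_val (coeff ?P i) q" if "coeff ?P i \<noteq> 0" for i
      using valF that by (auto simp: coeff_map_poly)
    ultimately show ?thesis using has_val_root[where c = "coeff ?P" and x = x and Q = UNIV] x by blast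
  qed
  define w where "w x = (THE q. has_val x q)" for x
  have w: "w x = q" if "has_val x q" for x q
    unfolding w_def using that has_val_unique by blast
  have hw: "has_val x (w x)" if "x \<noteq> 0" for x using valK[OF that] w by metis
  have power: "has_val (x ^ n) (of_nat n * q)" if "has_val x q" for x q n
  proof (induction n)
    case 0
    show ?case unfolding has_val_def
      by (rule conjI, simp, rule exI[of _ 1], rule conjI, simp, rule exI[of _ 0], simp)
  next
    case (Suc n)
    then show ?case using has_val_mult[OF that Suc] by (simp add: algebra_simps)
  qed
  have powi: "has_val (x powi k) (of_int k * q)" if "has_val x q" for x q k
  proof (cases "k \<ge> 0")
    case True
    then show ?thesis using power[OF that, of "nat k"] by (simp add: power_int_def)
  next
    case False
    then show ?thesis using power[OF has_val_inverse[OF that], of "nat (- k)"] by (simp add: power_int_def)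
  qed
  have w2: "has_val 2 1"
    unfolding has_val_def
    by (rule conjI, simp, rule exI[of _ 1], rule conjI, simp, rule exI[of _ 1], simp)
  define M where "M n \<longleftrightarrow> n > 0 \<and> (\<exists>c :: 'f. c \<noteq> 0 \<and> has_val (to_ac c) (of_nat n / N))" for n :: nat
  have "M (fact d)"
    unfolding M_def using w2 by (auto intro!: exI[of _ 2] simp: N_def)
  define n0 where "n0 = (LEAST n. M n)"
  have "M n0" unfolding n0_def by (rule LeastI[of M, OF \<open>M (fact d)\<close>])
  then obtain \<pi> :: 'f where n0: "n0 > 0" and \<pi>: "\<pi> \<noteq> 0" "has_val (to_ac \<pi>) (of_nat n0 / N)"
    by (auto simp: M_def)
  have mult: "\<exists>k :: int. w (to_ac c) = of_int k * (of_nat n0 / N)" if c: "c \<noteq> 0" for c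
  proof -
    obtain m :: int where m: "has_val (to_ac c) (of_int m / N)" using valF[OF c] by blast
    define k r where "k = m div int n0" and "r = m mod int n0"
    have mkr: "m = k * int n0 + r" by (simp add: k_def r_def)
    have r: "0 \<le> r" "r < int n0" using n0 by (auto simp: r_def)
    have "has_val (to_ac c * to_ac \<pi> powi (- k)) (of_int m / N + of_int (- k) * (of_nat n0 / N))"
      by (intro has_val_mult m powi \<pi>)
    also have "of_int m / N + of_int (- k) * (of_nat n0 / N) = of_int r / N"
      using n0 by (simp add: mkr algebra_simps add_divide_distrib)
    also have "to_ac c * to_ac \<pi> powi (- k) = to_ac (c * \<pi> powi (- k))"
      by (simp add: power_int_def)
    finally have val: "has_val (to_ac (c * \<pi> powi (- k))) (of_int r / N)" .
    have "r = 0"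
    proof (rule ccontr)
      assume "r \<noteq> 0"
      then have "M (nat r)" unfolding M_def using val r c \<pi>(1)
        by (intro conjI exI[of _ "c * \<pi> powi (- k)"]) auto
      then have "n0 \<le> nat r" unfolding n0_def by (rule Least_le)
      then show False using r by linarith
    qed
    then have "of_int m / N = of_int k * (of_nat n0 / N)" by (simp add: mkr)
    then show ?thesis using w[OF m] by metis
  qed
  define v where "v x = w x * (N / of_nat n0)" for x
  have pos: "N / of_nat n0 > 0" using N n0 by simp
  have v_base: "v (to_ac c) \<in> \<int>" if "c \<noteq> 0" for c
    using mult[OF that] n0 N by (auto simp: v_def)
  have "dyadic_valuation v \<pi>"
  proof
    fix x y :: "'f alg_closure" assume xy: "x \<noteq> 0" "y \<noteq> 0"
    show "v (x * y) = v x + v y"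
      using w[OF has_val_mult[OF hw[OF xy(1)] hw[OF xy(2)]]] by (simp add: v_def algebra_simps add_divide_distrib)
    assume s: "x + y \<noteq> 0"
    have "min (w x) (w y) \<le> w (x + y)" by (rule has_val_add[OF hw hw hw]) (use xy s in auto)
    then show "min (v x) (v y) \<le> v (x + y)"
      unfolding v_def using mult_right_mono[OF _ less_imp_le[OF pos]] pos
      by (metis min_mult_distrib_right less_imp_le)
  next
    show "v (to_ac \<pi>) = 1" using w[OF \<pi>(2)] N n0 by (simp add: v_def)
    have "v 2 > 0" using w[OF w2] pos by (simp add: v_def)
    moreover have "v 2 \<in> \<int>" using v_base[of 2] by simp
    ultimately show "1 \<le> v 2" by (auto elim!: Ints_cases)
  qed (use \<pi> v_base in auto)
  then show thesis by (rule that)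
qed

section \<open>Wildly ramified polynomials\<close>

context dyadic_valuation
begin

definition ge :: "rat \<Rightarrow> 'f alg_closure \<Rightarrow> bool" where
  "ge r x \<longleftrightarrow> x = 0 \<or> r \<le> v x"

definition gt :: "rat \<Rightarrow> 'f alg_closure \<Rightarrow> bool" where
  "gt r x \<longleftrightarrow> x = 0 \<or> r < v x"

lemma v_1: "v 1 = 0"
  using v_mult[of 1 1] by simp

lemma v_minus_1: "v (- 1) = 0"
  using v_mult[of "- 1" "- 1"] v_1 by simp

lemma v_uminus: "v (- x) = v x"
proof (cases "x = 0")
  case False
  then show ?thesis using v_mult[of "- 1" x] v_minus_1 by simp
qed simp

lemma v_power: "x \<noteq> 0 \<Longrightarrow> v (x ^ n) = of_nat n * v x"
  by (induction n) (auto simp: v_1 v_mult algebra_simps)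

lemma ge_add: "ge r x \<Longrightarrow> ge r y \<Longrightarrow> ge r (x + y)"
  using v_add[of x y] by (fastforce simp: ge_def)

lemma gt_add: "gt r x \<Longrightarrow> gt r y \<Longrightarrow> gt r (x + y)"
  using v_add[of x y] by (fastforce simp: gt_def)

lemma ge_uminus: "ge r (- x) \<longleftrightarrow> ge r x"
  by (simp add: ge_def v_uminus)

lemma ge_diff: "ge r x \<Longrightarrow> ge r y \<Longrightarrow> ge r (x - y)"
  using ge_add[of r x "- y"] by (simp add: ge_uminus)

lemma ge_mult: "ge r x \<Longrightarrow> ge s y \<Longrightarrow> ge (r + s) (x * y)"
  by (cases "x = 0 \<or> y = 0") (auto simp: ge_def v_mult)

lemma ge_power: "ge r x \<Longrightarrow> ge (of_nat n * r) (x ^ n)"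
proof (induction n)
  case 0
  show ?case by (simp add: ge_def v_1)
next
  case (Suc n)
  then show ?case using ge_mult[of r x "of_nat n * r" "x ^ n"] by (simp add: algebra_simps)
qed

lemma ge_mono: "ge r x \<Longrightarrow> s \<le> r \<Longrightarrow> ge s x"
  by (auto simp: ge_def)

lemma ge_imp_gt: "ge r x \<Longrightarrow> s < r \<Longrightarrow> gt s x"
  by (auto simp: ge_def gt_def)

lemma ge_0 [simp]: "ge r 0" and gt_0 [simp]: "gt r 0"
  by (simp_all add: ge_def gt_def)

lemma ge_sum: "(\<And>i. i \<in> I \<Longrightarrow> ge r (f i)) \<Longrightarrow> ge r (sum f I)"
  by (induction I rule: infinite_finite_induct) (auto intro: ge_add)

lemma gt_sum: "(\<And>i. i \<in> I \<Longrightarrow> gt r (f i)) \<Longrightarrow> gt r (sum f I)"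
  by (induction I rule: infinite_finite_induct) (auto intro: gt_add)

lemma v_dominant:
  assumes "x \<noteq> 0" "gt (v x) y"
  shows "x + y \<noteq> 0 \<and> v (x + y) = v x"
proof (cases "y = 0")
  case False
  then have y: "v x < v y" using assms by (simp add: gt_def)
  have nz: "x + y \<noteq> 0"
  proof
    assume "x + y = 0"
    then have "y = - x" by (simp add: eq_neg_iff_add_eq_0 add.commute)
    then show False using y v_uminus by simp
  qed
  have "v x \<le> v (x + y)" using v_add[OF assms(1) False nz] y by simp
  moreover have "min (v (x + y)) (v (- y)) \<le> v ((x + y) + - y)"
    by (rule v_add) (use nz False assms in auto)
  ultimately show ?thesis using nz y by (simp add: v_uminus min_def split: if_splits)
qed (use assms in auto)

text \<open>The term of least value dominates.\<close>

lemma sum_distinct_values: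
  assumes I: "finite I" "\<exists>i\<in>I. t i \<noteq> 0"
    and dist: "\<And>i j. i \<in> I \<Longrightarrow> j \<in> I \<Longrightarrow> i \<noteq> j \<Longrightarrow> t i \<noteq> 0 \<Longrightarrow> t j \<noteq> 0 \<Longrightarrow> v (t i) \<noteq> v (t j)"
  shows "\<exists>k\<in>I. t k \<noteq> 0 \<and> sum t I \<noteq> 0 \<and> v (sum t I) = v (t k)"
proof -
  let ?J = "{i\<in>I. t i \<noteq> 0}"
  have "finite ?J" "?J \<noteq> {}" using I by auto
  then obtain k where k: "k \<in> ?J" "\<And>i. i \<in> ?J \<Longrightarrow> v (t k) \<le> v (t i)"
    using ex_min_if_finite[of "(\<lambda>i. v (t i)) ` ?J"] by (auto simp: not_less)
  have "gt (v (t k)) (sum t (I - {k}))"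
  proof (rule gt_sum)
    fix i assume i: "i \<in> I - {k}"
    show "gt (v (t k)) (t i)"
    proof (cases "t i = 0")
      case False
      then have "v (t k) \<le> v (t i)" "v (t k) \<noteq> v (t i)" using k i dist[of k i] by auto
      then show ?thesis by (simp add: gt_def)
    qed simp
  qed
  moreover have "sum t I = t k + sum t (I - {k})" using I(1) k(1) by (simp add: sum.remove)
  ultimately show ?thesis using v_dominant[of "t k"] k(1) by auto
qed

lemma ge_of_nat: "ge 0 (of_nat n)"
  by (induction n) (auto intro: ge_add simp: ge_def[of 0 1] v_1)

text \<open>An Eisenstein polynomial whose linear coefficient has value exactly 1 as well; that coefficient determines the value of
  the derivative at a root.\<close>

definition eisenstein24 :: "'f poly \<Rightarrow> bool" where
  "eisenstein24 D \<longleftrightarrow> Polynomial.degree D = 24 \<and> v (to_ac (coeff D 24)) = 0 \<and>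
     (\<forall>i<24. ge 1 (to_ac (coeff D i))) \<and> (\<forall>i<2. coeff D i \<noteq> 0 \<and> v (to_ac (coeff D i)) = 1)"

abbreviation lift :: "'f poly \<Rightarrow> 'f alg_closure poly" where
  "lift \<equiv> map_poly to_ac"

lemma lift_pderiv: "lift (pderiv p) = pderiv (lift p)"
  by (rule poly_eqI) (simp add: coeff_map_poly coeff_pderiv)

context
  fixes D :: "'f poly" and \<alpha> :: "'f alg_closure"
  assumes D: "eisenstein24 D" and root: "poly (lift D) \<alpha> = 0"
begin

private abbreviation "d i \<equiv> to_ac (coeff D i)"

lemma d_props: "Polynomial.degree D = 24" "v (d 24) = 0" "d 24 \<noteq> 0" "i < 24 \<Longrightarrow> ge 1 (d i)"
  "d 0 \<noteq> 0" "v (d 0) = 1" "d 1 \<noteq> 0" "v (d 1) = 1"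
proof -
  show deg: "Polynomial.degree D = 24" and "v (d 24) = 0" "i < 24 \<Longrightarrow> ge 1 (d i)"
    using D by (auto simp: eisenstein24_def)
  have "\<forall>i<2. coeff D i \<noteq> 0 \<and> v (d i) = 1" using D by (simp add: eisenstein24_def)
  from this[rule_format, of 0] this[rule_format, of 1] show "d 0 \<noteq> 0" "v (d 0) = 1" "d 1 \<noteq> 0" "v (d 1) = 1" by auto
  have "D \<noteq> 0" using deg by auto
  then have "lead_coeff D \<noteq> 0" by simp
  then show "d 24 \<noteq> 0" using deg by simp
qed

lemma poly_lift_D: "poly (lift D) x = (\<Sum>i\<le>24. d i * x ^ i)"
  by (simp add: poly_altdef degree_map_poly coeff_map_poly d_props)

lemma root_nonzero: "\<alpha> \<noteq> 0"
proof
  assume "\<alpha> = 0"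
  then have "d 0 = 0" using root by (simp add: poly_0_coeff_0 coeff_map_poly)
  then show False using d_props by simp
qed

lemma v_root: "v \<alpha> = 1 / 24"
proof -
  have split: "(\<Sum>i\<le>24. d i * \<alpha> ^ i) = d 24 * \<alpha> ^ 24 + (\<Sum>i<24. d i * \<alpha> ^ i)"
    by (simp add: lessThan_Suc_atMost[symmetric] numeral_eq_Suc add.commute)
  have v24: "v (d 24 * \<alpha> ^ 24) = 24 * v \<alpha>"
    using d_props root_nonzero by (simp add: v_mult v_power)
  have pos: "v \<alpha> > 0"
  proof (rule ccontr)
    assume neg: "\<not> v \<alpha> > 0"
    have "gt (v (d 24 * \<alpha> ^ 24)) (\<Sum>i<24. d i * \<alpha> ^ i)"
    proof (rule gt_sum)
      fix i assume i: "i \<in> {..<24 :: nat}"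
      have "24 * v \<alpha> \<le> of_nat i * v \<alpha>" using neg i by (intro mult_right_mono_neg) auto
      then have "24 * v \<alpha> < 1 + of_nat i * v \<alpha>" by simp
      moreover have "ge (1 + of_nat i * v \<alpha>) (d i * \<alpha> ^ i)"
        by (intro ge_mult ge_power d_props) (use i in \<open>auto simp: ge_def\<close>)
      ultimately show "gt (v (d 24 * \<alpha> ^ 24)) (d i * \<alpha> ^ i)" unfolding v24 by (rule ge_imp_gt[rotated])
    qed
    from v_dominant[OF _ this] have "(\<Sum>i\<le>24. d i * \<alpha> ^ i) \<noteq> 0"
      unfolding split using d_props root_nonzero by simp
    then show False using root unfolding poly_lift_D by simp
  qed
  have "gt 1 (\<Sum>i\<in>{1..<24}. d i * \<alpha> ^ i)"
  proof (rule gt_sum)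
    fix i assume i: "i \<in> {1..<24 :: nat}"
    have "ge (1 + of_nat i * v \<alpha>) (d i * \<alpha> ^ i)"
      by (intro ge_mult ge_power d_props) (use i in \<open>auto simp: ge_def\<close>)
    then show "gt 1 (d i * \<alpha> ^ i)" by (rule ge_imp_gt) (use i pos in auto)
  qed
  from v_dominant[of "d 0", unfolded d_props(6), OF d_props(5) this]
  have "v (d 0 + (\<Sum>i\<in>{1..<24}. d i * \<alpha> ^ i)) = 1" by simp
  moreover have "{..<24} = insert 0 {1..<24 :: nat}" by auto
  then have "(\<Sum>i<24. d i * \<alpha> ^ i) = d 0 + (\<Sum>i\<in>{1..<24}. d i * \<alpha> ^ i)" by simp
  moreover have "d 24 * \<alpha> ^ 24 = - (\<Sum>i<24. d i * \<alpha> ^ i)"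
    using root unfolding poly_lift_D split by (simp add: eq_neg_iff_add_eq_0)
  ultimately have "24 * v \<alpha> = 1" using v24 v_uminus by metis
  then show ?thesis by simp
qed

text \<open>The powers \<open>1, \<alpha>, \<dots>, \<alpha>\<^bsup>23\<^esup>\<close> have different valuations modulo the integers.\<close>

lemma v_combination:
  assumes "\<exists>i<24. c i \<noteq> 0"
  shows "(\<Sum>i<24. to_ac (c i) * \<alpha> ^ i) \<noteq> 0 \<and> (\<exists>k :: int. v (\<Sum>i<24. to_ac (c i) * \<alpha> ^ i) = of_int k / 24)"
proof -
  have val: "\<exists>m :: int. v (to_ac (c i) * \<alpha> ^ i) = of_int (24 * m + int i) / 24" if ci: "c i \<noteq> 0" for i
  proof -
    obtain m where m: "v (to_ac (c i)) = of_int m" using v_base[OF ci] by (auto elim: Ints_cases)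
    have "v (to_ac (c i) * \<alpha> ^ i) = v (to_ac (c i)) + of_nat i * v \<alpha>"
      using ci root_nonzero v_mult v_power by simp
    also have "\<dots> = of_int (24 * m + int i) / 24" unfolding m v_root by (simp add: add_divide_distrib)
    finally show ?thesis by blast
  qed
  have "\<exists>k\<in>{..<24}. to_ac (c k) * \<alpha> ^ k \<noteq> 0 \<and> (\<Sum>i<24. to_ac (c i) * \<alpha> ^ i) \<noteq> 0 \<and>
      v (\<Sum>i<24. to_ac (c i) * \<alpha> ^ i) = v (to_ac (c k) * \<alpha> ^ k)"
  proof (rule sum_distinct_values)
    show "\<exists>i\<in>{..<24}. to_ac (c i) * \<alpha> ^ i \<noteq> 0" using assms root_nonzero by auto
    fix i j :: nat assume ij: "i \<in> {..<24}" "j \<in> {..<24}" "i \<noteq> j" "to_ac (c i) * \<alpha> ^ i \<noteq> 0" "to_ac (c j) * \<alpha> ^ j \<noteq> 0"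
    obtain m n :: int where "v (to_ac (c i) * \<alpha> ^ i) = of_int (24 * m + int i) / 24"
      "v (to_ac (c j) * \<alpha> ^ j) = of_int (24 * n + int j) / 24" using val[of i] val[of j] ij by auto
    moreover have "24 * m + int i \<noteq> 24 * n + int j"
    proof
      assume "24 * m + int i = 24 * n + int j"
      then have "(24 * m + int i) mod 24 = (24 * n + int j) mod 24" by (simp only:)
      then show False using ij(1-3) by simp
    qed
    ultimately show "v (to_ac (c i) * \<alpha> ^ i) \<noteq> v (to_ac (c j) * \<alpha> ^ j)"
      by (metis divide_cancel_right of_int_eq_iff zero_neq_numeral)
  qed simp
  then obtain k where k: "to_ac (c k) * \<alpha> ^ k \<noteq> 0" "(\<Sum>i<24. to_ac (c i) * \<alpha> ^ i) \<noteq> 0"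
    "v (\<Sum>i<24. to_ac (c i) * \<alpha> ^ i) = v (to_ac (c k) * \<alpha> ^ k)" by blast
  then have "c k \<noteq> 0" by auto
  then show ?thesis using val[of k] k by metis
qed

text \<open>The terms other than the linear coefficient contain a positive power of \<open>\<alpha>\<close>, and a coefficient of value at least 1 or the
  factor 24 from differentiation.\<close>

lemma v_derivative: "poly (lift (pderiv D)) \<alpha> \<noteq> 0 \<and> v (poly (lift (pderiv D)) \<alpha>) = 1"
proof -
  have deg: "Polynomial.degree (pderiv D) = 23" by (simp add: degree_pderiv d_props)
  have "poly (lift (pderiv D)) \<alpha> = (\<Sum>i\<le>23. of_nat (Suc i) * d (Suc i) * \<alpha> ^ i)"
    by (simp add: poly_altdef degree_map_poly deg coeff_map_poly coeff_pderiv)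
  also have "{..23} = insert 0 {1..23 :: nat}" by auto
  finally have eq: "poly (lift (pderiv D)) \<alpha> = d 1 + (\<Sum>i\<in>{1..23}. of_nat (Suc i) * d (Suc i) * \<alpha> ^ i)"
    by simp
  have "gt (v (d 1)) (\<Sum>i\<in>{1..23}. of_nat (Suc i) * d (Suc i) * \<alpha> ^ i)"
  proof (rule gt_sum)
    fix i assume i: "i \<in> {1..23 :: nat}"
    have "ge 1 (of_nat (Suc i) * d (Suc i))"
    proof (cases "i = 23")
      case True
      have "ge 1 2" using v_2 by (simp add: ge_def)
      moreover have "ge 0 (of_nat 12)" by (rule ge_of_nat)
      moreover have "ge 0 (d 24)" using d_props by (simp add: ge_def)
      ultimately have "ge (1 + 0 + 0) (2 * of_nat 12 * d 24)" by (intro ge_mult)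
      then show ?thesis using True by simp
    next
      case False
      then have "ge (0 + 1) (of_nat (Suc i) * d (Suc i))" using i by (intro ge_mult ge_of_nat d_props) auto
      then show ?thesis by simp
    qed
    moreover have "ge (of_nat i * v \<alpha>) (\<alpha> ^ i)" by (rule ge_power) (simp add: ge_def)
    ultimately have "ge (1 + of_nat i * v \<alpha>) (of_nat (Suc i) * d (Suc i) * \<alpha> ^ i)" by (rule ge_mult)
    then show "gt (v (d 1)) (of_nat (Suc i) * d (Suc i) * \<alpha> ^ i)"
      unfolding d_props(8) by (rule ge_imp_gt) (use i in \<open>simp add: v_root\<close>)
  qed
  from v_dominant[OF d_props(7) this, unfolded d_props(8)] show ?thesis unfolding eq .
qed

text \<open>A closer root would make the linear term dominate in the expansion of \<open>D(\<alpha> + \<delta>) - D(\<alpha>)\<close>. The terms of degree 2 to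
  23 have a coefficient divisible by \<open>\<pi>\<close> and, besides \<open>\<delta>\<close>, a further factor of positive value. The term of
  degree 24 is a unit times \<open>y\<^sup>3 - z\<^sup>3\<close> with \<open>y = (\<alpha> + \<delta>)\<^sup>8\<close> and \<open>z = \<alpha>\<^sup>8\<close>: here \<open>y\<^sup>2 + yz + z\<^sup>2\<close> has value at least
  \<open>2/3\<close>, and \<open>y - z\<close> has value above \<open>1/3 + v(\<delta>)\<close>, as it is \<open>\<delta>\<^sup>8\<close> up to a multiple of \<open>2\<delta>\<close>.\<close>

lemma roots_not_close:
  assumes root2: "poly (lift D) (\<alpha> + \<delta>) = 0" and \<delta>: "\<delta> \<noteq> 0"
  shows "v \<delta> < 2 / 24"
proof (rule ccontr)
  assume "\<not> v \<delta> < 2 / 24"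
  then have v\<delta>: "2 / 24 \<le> v \<delta>" by simp
  have gea: "ge (1 / 24) \<alpha>" using v_root by (simp add: ge_def)
  have ged: "ge (v \<delta>) \<delta>" "ge (1 / 24) \<delta>" using v\<delta> by (auto simp: ge_def)
  have gead: "ge (1 / 24) (\<alpha> + \<delta>)" by (rule ge_add[OF gea ged(2)])
  have mid: "gt (1 + v \<delta>) (d i * ((\<alpha> + \<delta>) ^ i - \<alpha> ^ i))" if i: "2 \<le> i" "i < 24" for i
  proof -
    have "(\<alpha> + \<delta>) ^ i - \<alpha> ^ i = \<delta> * (\<Sum>j<i. \<alpha> ^ (i - Suc j) * (\<alpha> + \<delta>) ^ j)"
      using power_diff_sumr2[of "\<alpha> + \<delta>" i \<alpha>] by simp
    moreover have "ge (1 / 24) (\<Sum>j<i. \<alpha> ^ (i - Suc j) * (\<alpha> + \<delta>) ^ j)"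
    proof (rule ge_sum)
      fix j assume j: "j \<in> {..<i}"
      have "ge (of_nat (i - Suc j) * (1 / 24) + of_nat j * (1 / 24)) (\<alpha> ^ (i - Suc j) * (\<alpha> + \<delta>) ^ j)"
        by (intro ge_mult ge_power gead gea)
      moreover have "of_nat (i - Suc j) * (1 / 24) + of_nat j * (1 / 24) = (of_nat (i - 1) / 24 :: rat)"
      proof -
        have "of_nat (i - 1) = (of_nat (i - Suc j) + of_nat j :: rat)"
          using j by (simp flip: of_nat_add)
        then show ?thesis by (simp add: add_divide_distrib)
      qed
      ultimately show "ge (1 / 24) (\<alpha> ^ (i - Suc j) * (\<alpha> + \<delta>) ^ j)"
        using i(1) by (elim ge_mono) (simp add: divide_right_mono of_nat_diff)
    qed
    ultimately have "ge (1 + (v \<delta> + 1 / 24)) (d i * ((\<alpha> + \<delta>) ^ i - \<alpha> ^ i))"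
      using i ged d_props by (simp only:) (intro ge_mult)
    then show ?thesis by (rule ge_imp_gt) simp
  qed
  have top: "gt (1 + v \<delta>) (d 24 * ((\<alpha> + \<delta>) ^ 24 - \<alpha> ^ 24))"
  proof -
    define y z where "y = (\<alpha> + \<delta>) ^ 8" and "z = \<alpha> ^ 8"
    define h where "h = 4 * \<alpha> ^ 7 + 14 * \<alpha> ^ 6 * \<delta> + 28 * \<alpha> ^ 5 * \<delta> ^ 2 + 35 * \<alpha> ^ 4 * \<delta> ^ 3
        + 28 * \<alpha> ^ 3 * \<delta> ^ 4 + 14 * \<alpha> ^ 2 * \<delta> ^ 5 + 4 * \<alpha> * \<delta> ^ 6"
    have yz: "y - z = \<delta> ^ 8 + 2 * (\<delta> * h)"
      unfolding y_def z_def h_def by (simp add: eval_nat_numeral algebra_simps)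
    have monom_ge: "ge 0 (of_nat n * \<alpha> ^ k * \<delta> ^ l)" for n k l
    proof -
      have "ge (0 + of_nat k * (1 / 24) + of_nat l * (1 / 24)) (of_nat n * \<alpha> ^ k * \<delta> ^ l)"
        by (intro ge_mult ge_power ge_of_nat gea ged)
      then show ?thesis by (rule ge_mono) simp
    qed
    have "ge 0 h"
      unfolding h_def using monom_ge[of 4 7 0] monom_ge[of 14 6 1] monom_ge[of 28 5 2] monom_ge[of 35 4 3] monom_ge[of 28 3 4]
        monom_ge[of 14 2 5] monom_ge[of 4 1 6]
      by (intro ge_add) simp_all
    then have "ge (1 + (v \<delta> + 0)) (2 * (\<delta> * h))"
      using v_2 ged by (intro ge_mult) (auto simp: ge_def)
    then have 1: "gt (1 / 3 + v \<delta>) (2 * (\<delta> * h))" by (rule ge_imp_gt) simp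
    have "ge (of_nat 8 * v \<delta>) (\<delta> ^ 8)" by (rule ge_power[OF ged(1)])
    then have "gt (1 / 3 + v \<delta>) (\<delta> ^ 8)" by (rule ge_imp_gt) (use v\<delta> in simp)
    then have y1: "gt (1 / 3 + v \<delta>) (y - z)" unfolding yz using 1 by (rule gt_add)
    have "ge (of_nat 8 * (1 / 24)) y" "ge (of_nat 8 * (1 / 24)) z"
      unfolding y_def z_def by (rule ge_power[OF gead], rule ge_power[OF gea])
    then have g: "ge (1 / 3) y" "ge (1 / 3) z" by simp_all
    note ge_mult[OF g(1) g(1)] ge_mult[OF g(1) g(2)] ge_mult[OF g(2) g(2)]
    then have y2: "ge (2 / 3) (y * y + y * z + z * z)" by (intro ge_add) simp_all
    have "(\<alpha> + \<delta>) ^ 24 - \<alpha> ^ 24 = (y - z) * (y * y + y * z + z * z)"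
    proof -
      have "(\<alpha> + \<delta>) ^ 24 = y ^ 3" "\<alpha> ^ 24 = z ^ 3" unfolding y_def z_def by (simp_all flip: power_mult)
      then show ?thesis by (simp add: power3_eq_cube algebra_simps)
    qed
    moreover have "gt (1 + v \<delta>) ((y - z) * (y * y + y * z + z * z))"
      using y1 y2 by (cases "y - z = 0 \<or> y * y + y * z + z * z = 0") (auto simp: gt_def ge_def v_mult)
    ultimately show ?thesis using d_props(2,3)
      by (cases "(y - z) * (y * y + y * z + z * z) = 0") (simp_all add: gt_def v_mult[of "d 24"])
  qed
  have "(\<Sum>i\<le>24. d i * ((\<alpha> + \<delta>) ^ i - \<alpha> ^ i)) = 0"
    using root root2 unfolding poly_lift_D by (simp add: right_diff_distrib sum_subtractf)
  moreover have "{..24} = insert 0 (insert 1 {2..24 :: nat})" by auto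
  ultimately have "d 1 * \<delta> + (\<Sum>i\<in>{2..24}. d i * ((\<alpha> + \<delta>) ^ i - \<alpha> ^ i)) = 0" by simp
  moreover have "gt (v (d 1 * \<delta>)) (\<Sum>i\<in>{2..24}. d i * ((\<alpha> + \<delta>) ^ i - \<alpha> ^ i))"
  proof (rule gt_sum)
    fix i assume "i \<in> {2..24 :: nat}"
    then consider "2 \<le> i" "i < 24" | "i = 24" by fastforce
    then show "gt (v (d 1 * \<delta>)) (d i * ((\<alpha> + \<delta>) ^ i - \<alpha> ^ i))"
      using mid top d_props \<delta> by cases (simp_all add: v_mult)
  qed
  ultimately show False using v_dominant[of "d 1 * \<delta>"] d_props \<delta> by auto
qed

end

end

section \<open>The residue fields\<close>

lemma generate_field_type_algebra:
  fixes S :: "'k::Fields.field set"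
  shows "1 \<in> generate_field ring_of_type_algebra S" "h \<in> S \<Longrightarrow> h \<in> generate_field ring_of_type_algebra S"
    "x \<in> generate_field ring_of_type_algebra S \<Longrightarrow> y \<in> generate_field ring_of_type_algebra S \<Longrightarrow>
      x + y \<in> generate_field ring_of_type_algebra S \<and> x * y \<in> generate_field ring_of_type_algebra S"
    "\<lbrakk>\<And>h. h \<in> S \<Longrightarrow> h \<in> E; 1 \<in> E; \<And>x. x \<in> E \<Longrightarrow> - x \<in> E; \<And>x. x \<in> E \<Longrightarrow> x \<noteq> 0 \<Longrightarrow> inverse x \<in> E;
      \<And>x y. x \<in> E \<Longrightarrow> y \<in> E \<Longrightarrow> x + y \<in> E; \<And>x y. x \<in> E \<Longrightarrow> y \<in> E \<Longrightarrow> x * y \<in> E\<rbrakk> \<Longrightarrow>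
      generate_field ring_of_type_algebra S \<subseteq> E"
proof -
  let ?R = "ring_of_type_algebra :: 'k ring"
  interpret field ?R by (rule field_from_type_algebra)
  have ops: "one ?R = 1" "ring.zero ?R = 0" "monoid.mult ?R x y = x * y" "ring.add ?R x y = x + y" "carrier ?R = UNIV" for x y
    by (simp_all add: ring_of_type_algebra_def)
  have neg: "a_inv ?R x = - x" for x
    by (rule minus_equality) (simp_all add: ops)
  have inv: "m_inv ?R x = inverse x" if "x \<noteq> 0" for x
    by (rule comm_inv_char) (use that in \<open>simp_all add: ops\<close>)
  show "1 \<in> generate_field ?R S" using generate_field.one[of ?R S] by (simp add: ops)
  show "h \<in> S \<Longrightarrow> h \<in> generate_field ?R S" by (rule generate_field.incl)
  show "x + y \<in> generate_field ?R S \<and> x * y \<in> generate_field ?R S"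
    if "x \<in> generate_field ?R S" "y \<in> generate_field ?R S" for x y
    using generate_field.eng_add[OF that] generate_field.eng_mult[OF that] by (simp add: ops)
  assume E: "\<And>h. h \<in> S \<Longrightarrow> h \<in> E" "1 \<in> E" "\<And>x. x \<in> E \<Longrightarrow> - x \<in> E" "\<And>x. x \<in> E \<Longrightarrow> x \<noteq> 0 \<Longrightarrow> inverse x \<in> E"
      "\<And>x y. x \<in> E \<Longrightarrow> y \<in> E \<Longrightarrow> x + y \<in> E" "\<And>x y. x \<in> E \<Longrightarrow> y \<in> E \<Longrightarrow> x * y \<in> E"
  show "generate_field ?R S \<subseteq> E"
  proof
    fix x assume "x \<in> generate_field ?R S"
    then show "x \<in> E"
      by induction (use E in \<open>auto simp: ops neg inv\<close>)
  qed
qed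

lemma lift_hom:
  fixes p q :: "'f::Fields.field poly"
  shows "map_poly to_ac (p + q) = map_poly to_ac p + map_poly to_ac q"
    "map_poly to_ac (p * q) = map_poly to_ac p * map_poly to_ac q"
    "map_poly to_ac (p - q) = map_poly to_ac p - map_poly to_ac q"
    "map_poly to_ac [:c:] = [:to_ac c:]" "map_poly to_ac (monom c n) = monom (to_ac c) n"
  by (rule poly_eqI; simp add: coeff_map_poly coeff_mult to_ac_sum coeff_pCons split: nat.split)+

lemma lift_pcompose:
  fixes p q :: "'f::Fields.field poly"
  shows "map_poly to_ac (pcompose p q) = pcompose (map_poly to_ac p) (map_poly to_ac q)"
  by (induction p) (simp_all add: pcompose_pCons lift_hom map_poly_pCons)

text \<open>The relation of an annihilating polynomial having nonzero constant term expresses the inverse.\<close>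

lemma inverse_in_polynomials:
  fixes x :: "'f::Fields.field alg_closure"
  assumes "x \<noteq> 0"
  shows "\<exists>q. inverse x = poly (map_poly to_ac q) x"
proof -
  obtain p :: "'f poly" where p: "p \<noteq> 0" "poly (map_poly to_ac p) x = 0" using alg_closure_algebraic by blast
  have "\<exists>n r. p = monom 1 n * r \<and> coeff r 0 \<noteq> 0"
    using p(1)
  proof (induction p)
    case (pCons a p)
    show ?case
    proof (cases "a = 0")
      case True
      then obtain n r where "p = monom 1 n * r" "coeff r 0 \<noteq> 0" using pCons by auto
      then have "pCons a p = monom 1 (Suc n) * r" using True by (simp add: monom_Suc)
      then show ?thesis using \<open>coeff r 0 \<noteq> 0\<close> by blast
    next
      case False
      then show ?thesis by (intro exI[of _ 0] exI[of _ "pCons a p"]) (simp add: monom_0 flip: one_pCons)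
    qed
  qed simp
  then obtain n r where nr: "p = monom 1 n * r" "coeff r 0 \<noteq> 0" by blast
  have "poly (map_poly to_ac r) x = 0"
    using p(2) assms unfolding nr(1) lift_hom by (simp add: poly_monom)
  moreover obtain r0 r' where r: "r = pCons r0 r'" by (rule pCons_cases)
  ultimately have eq: "to_ac r0 + x * poly (map_poly to_ac r') x = 0" by (simp add: map_poly_pCons)
  have r0: "r0 \<noteq> 0" using nr(2) r by simp
  from eq have xy: "x * poly (map_poly to_ac r') x = - to_ac r0"
    by (simp add: eq_neg_iff_add_eq_0 add.commute)
  have "x * (poly (map_poly to_ac r') x * to_ac (- 1 / r0)) = (x * poly (map_poly to_ac r') x) * to_ac (- 1 / r0)"
    by (simp only: mult.assoc)
  also have "\<dots> = 1" unfolding xy using r0 by simp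
  finally have "x * (poly (map_poly to_ac r') x * to_ac (- 1 / r0)) = 1" .
  then have "inverse x = poly (map_poly to_ac (r' * [:- 1 / r0:])) x"
    unfolding lift_hom by (metis inverse_unique poly_const_conv poly_mult)
  then show ?thesis by blast
qed

text \<open>Polynomial expressions are closed under inverses, since every element is algebraic.\<close>

lemma adjoin_simple:
  fixes \<alpha> :: "'f::Fields.field alg_closure"
  assumes "\<alpha> \<noteq> 0"
  shows "adjoin {1 / \<alpha>, \<alpha>} = range (\<lambda>p. poly (map_poly to_ac p) \<alpha>)"
proof
  let ?E = "range (\<lambda>p. poly (map_poly to_ac p) \<alpha>)"
  let ?S = "range to_ac \<union> {1 / \<alpha>, \<alpha>}"
  show "adjoin {1 / \<alpha>, \<alpha>} \<subseteq> ?E"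
    unfolding adjoin_def
  proof (rule generate_field_type_algebra(4))
    have c: "to_ac c \<in> ?E" for c using lift_hom(4)[of c] by (intro range_eqI[of _ _ "[:c:]"]) simp
    then show "1 \<in> ?E" by (metis to_ac_1)
    fix h assume "h \<in> ?S"
    then consider c where "h = to_ac c" | "h = inverse \<alpha>" | "h = \<alpha>" by (auto simp: field_simps)
    then show "h \<in> ?E"
    proof cases
      case 3
      then show ?thesis by (intro range_eqI[of _ _ "monom 1 1"]) (simp add: lift_hom poly_monom)
    qed (use c inverse_in_polynomials[OF assms] in auto)
  next
    fix x assume "x \<in> ?E"
    then obtain p where p: "x = poly (map_poly to_ac p) \<alpha>" by blast
    then show "- x \<in> ?E" by (intro range_eqI[of _ _ "[:- 1:] * p"]) (simp add: lift_hom del: mult_pCons_left)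
    assume "x \<noteq> 0"
    then obtain q where "inverse x = poly (map_poly to_ac q) x" using inverse_in_polynomials by blast
    then show "inverse x \<in> ?E"
      using p by (intro range_eqI[of _ _ "pcompose q p"]) (simp add: lift_pcompose poly_pcompose)
  next
    fix x y assume "x \<in> ?E" "y \<in> ?E"
    then obtain p q where "x = poly (map_poly to_ac p) \<alpha>" "y = poly (map_poly to_ac q) \<alpha>" by blast
    then have "x + y = poly (map_poly to_ac (p + q)) \<alpha>" "x * y = poly (map_poly to_ac (p * q)) \<alpha>"
      by (simp_all add: lift_hom)
    then show "x + y \<in> ?E" "x * y \<in> ?E" by blast+
  qed
  show "?E \<subseteq> adjoin {1 / \<alpha>, \<alpha>}"
  proof
    fix x assume "x \<in> ?E"
    then obtain p where "x = poly (map_poly to_ac p) \<alpha>" by blast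
    moreover have "poly (map_poly to_ac p) \<alpha> \<in> adjoin {1 / \<alpha>, \<alpha>}"
    proof (induction p)
      case 0
      have "to_ac 0 \<in> adjoin {1 / \<alpha>, \<alpha>}"
        unfolding adjoin_def by (rule generate_field_type_algebra(2)) blast
      then show ?case by simp
    next
      case (pCons a p)
      have "to_ac a \<in> adjoin {1 / \<alpha>, \<alpha>}" "\<alpha> \<in> adjoin {1 / \<alpha>, \<alpha>}"
        unfolding adjoin_def by (rule generate_field_type_algebra(2), blast)+
      moreover have "x + y \<in> adjoin {1 / \<alpha>, \<alpha>} \<and> x * y \<in> adjoin {1 / \<alpha>, \<alpha>}"
        if "x \<in> adjoin {1 / \<alpha>, \<alpha>}" "y \<in> adjoin {1 / \<alpha>, \<alpha>}" for x y
        using that unfolding adjoin_def by (rule generate_field_type_algebra(3))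
      ultimately have "to_ac a + \<alpha> * poly (map_poly to_ac p) \<alpha> \<in> adjoin {1 / \<alpha>, \<alpha>}"
        using pCons(2) by blast
      then show ?case by (simp add: map_poly_pCons)
    qed
    ultimately show "x \<in> adjoin {1 / \<alpha>, \<alpha>}" by simp
  qed
qed

context dyadic_valuation
begin

context
  fixes D :: "'f poly" and \<alpha> :: "'f alg_closure"
  assumes D: "eisenstein24 D" and root: "poly (lift D) \<alpha> = 0"
begin

lemma low_degree_value:
  assumes "p \<noteq> 0" "Polynomial.degree p < 24"
  shows "poly (lift p) \<alpha> \<noteq> 0 \<and> (\<exists>k :: int. v (poly (lift p) \<alpha>) = of_int k / 24)"
proof -
  have "poly (lift p) \<alpha> = (\<Sum>i\<le>Polynomial.degree p. to_ac (coeff p i) * \<alpha> ^ i)"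
    by (simp add: poly_altdef degree_map_poly coeff_map_poly)
  also have "\<dots> = (\<Sum>i<24. to_ac (coeff p i) * \<alpha> ^ i)"
    by (rule sum.mono_neutral_left) (use assms in \<open>auto simp: coeff_eq_0\<close>)
  finally have "poly (lift p) \<alpha> = (\<Sum>i<24. to_ac (coeff p i) * \<alpha> ^ i)" .
  moreover have "\<exists>i<24. coeff p i \<noteq> 0"
    using assms by (intro exI[of _ "Polynomial.degree p"]) simp
  ultimately show ?thesis using v_combination[OF D root] by simp
qed

lemma degree_D: "Polynomial.degree D = 24"
  using D by (simp add: eisenstein24_def)

lemma irreducible_D: "irreducible D"
proof (rule irreducibleI)
  show "D \<noteq> 0" using degree_D by auto
  then show "\<not> D dvd 1" using degree_D by (simp add: is_unit_iff_degree)
  fix p q assume pq: "D = p * q"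
  then have nz: "p \<noteq> 0" "q \<noteq> 0" using \<open>D \<noteq> 0\<close> by auto
  then have deg: "Polynomial.degree p + Polynomial.degree q = 24" using degree_D pq by (simp add: degree_mult_eq)
  have "poly (lift p) \<alpha> = 0 \<or> poly (lift q) \<alpha> = 0" using root unfolding pq lift_hom by simp
  then have "Polynomial.degree p \<ge> 24 \<or> Polynomial.degree q \<ge> 24" using low_degree_value nz by force
  then show "p dvd 1 \<or> q dvd 1" using deg nz by (auto simp: is_unit_iff_degree)
qed

lemma remainder: "poly (lift p) \<alpha> = poly (lift (p mod D)) \<alpha>"
proof -
  have "p = p div D * D + p mod D" by simp
  then have "lift p = lift (p div D) * lift D + lift (p mod D)" by (metis lift_hom(1,2))
  then show ?thesis using root by simp
qed

lemma degree_remainder: "p mod D \<noteq> 0 \<Longrightarrow> Polynomial.degree (p mod D) < 24"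
  using degree_mod_less[of D p] degree_D by fastforce

lemma v_residue_field:
  assumes "x \<in> adjoin {1 / \<alpha>, \<alpha>}" "x \<noteq> 0"
  shows "\<exists>k :: int. v x = of_int k / 24"
proof -
  obtain p where "x = poly (lift p) \<alpha>"
    using assms adjoin_simple[OF root_nonzero[OF D root]] by blast
  then have x: "x = poly (lift (p mod D)) \<alpha>" using remainder by simp
  then have "p mod D \<noteq> 0" using assms(2) by auto
  then show ?thesis using low_degree_value[OF _ degree_remainder] x by simp
qed

lemma ext_degree_residue_field: "ext_degree (adjoin {1 / \<alpha>, \<alpha>}) = 24"
proof -
  interpret vs: vector_space "\<lambda>(c::'f) (x::'f alg_closure). to_ac c * x"
    by unfold_locales (simp_all add: algebra_simps)
  let ?B = "(\<lambda>i. \<alpha> ^ i) ` {..<24 :: nat}"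
  have rel: "\<forall>i<24. c i = 0" if "(\<Sum>i<24. to_ac (c i) * \<alpha> ^ i) = 0" for c
    using v_combination[OF D root, of c] that by blast
  have inj: "inj_on (\<lambda>i. \<alpha> ^ i) {..<24 :: nat}"
  proof (rule inj_onI, rule ccontr)
    fix i j :: nat assume ij: "i \<in> {..<24}" "j \<in> {..<24}" "\<alpha> ^ i = \<alpha> ^ j" "i \<noteq> j"
    let ?c = "\<lambda>k. if k = i then 1 else if k = j then - 1 else (0 :: 'f)"
    have "(\<Sum>k<24. to_ac (?c k) * \<alpha> ^ k) = (\<Sum>k<24. (if k = i then \<alpha> ^ k else 0) - (if k = j then \<alpha> ^ k else 0))"
      by (rule sum.cong) (use ij in auto)
    also have "\<dots> = 0" using ij by (simp add: sum_subtractf)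
    finally have "\<forall>k<24. ?c k = 0" by (rule rel)
    then show False using ij(1) by auto
  qed
  have indep: "vs.independent ?B"
  proof (rule vs.independent_if_scalars_zero)
    fix f x assume f: "(\<Sum>x\<in>?B. to_ac (f x) * x) = 0" and x: "x \<in> ?B"
    then have "(\<Sum>i<24. to_ac (f (\<alpha> ^ i)) * \<alpha> ^ i) = 0" by (simp add: sum.reindex[OF inj])
    then have "\<forall>i<24. f (\<alpha> ^ i) = 0" by (rule rel)
    then show "f x = 0" using x by auto
  qed simp
  have "adjoin {1 / \<alpha>, \<alpha>} = vs.span ?B"
  proof (intro equalityI subsetI)
    fix x assume "x \<in> adjoin {1 / \<alpha>, \<alpha>}"
    then obtain p where "x = poly (lift p) \<alpha>"
      using adjoin_simple[OF root_nonzero[OF D root]] by blast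
    then have "x = poly (lift (p mod D)) \<alpha>" using remainder by simp
    also have "\<dots> = (\<Sum>i\<le>Polynomial.degree (p mod D). to_ac (coeff (p mod D) i) * \<alpha> ^ i)"
      by (simp add: poly_altdef degree_map_poly coeff_map_poly)
    also have "\<dots> \<in> vs.span ?B"
    proof (intro vs.span_sum vs.span_scale vs.span_base)
      fix i assume "i \<in> {..Polynomial.degree (p mod D)}"
      moreover have "Polynomial.degree (p mod D) < 24"
        using degree_remainder by (cases "p mod D = 0") auto
      ultimately show "\<alpha> ^ i \<in> ?B" by auto
    qed
    finally show "x \<in> vs.span ?B" .
  next
    fix x assume "x \<in> vs.span ?B"
    then obtain u where "x = (\<Sum>b\<in>?B. to_ac (u b) * b)" by (auto simp: vs.span_finite)
    then have "x = (\<Sum>i<24. to_ac (u (\<alpha> ^ i)) * \<alpha> ^ i)" by (simp add: sum.reindex[OF inj])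
    also have "\<dots> = poly (lift (\<Sum>i<24. monom (u (\<alpha> ^ i)) i)) \<alpha>"
    proof -
      have "lift (\<Sum>i\<in>I. monom (u (\<alpha> ^ i)) i) = (\<Sum>i\<in>I. monom (to_ac (u (\<alpha> ^ i))) i)" for I :: "nat set"
        by (induction I rule: infinite_finite_induct) (simp_all add: lift_hom)
      then show ?thesis by (simp add: poly_sum poly_monom)
    qed
    finally show "x \<in> adjoin {1 / \<alpha>, \<alpha>}"
      unfolding adjoin_simple[OF root_nonzero[OF D root]] by blast
  qed
  then have "vs.dim (adjoin {1 / \<alpha>, \<alpha>}) = card ?B"
    using vs.dim_span_eq_card_independent[OF indep] by (simp only:)
  then show ?thesis by (simp add: ext_degree_def card_image[OF inj])
qed

text \<open>If the field contained all 24 roots, each of the 23 differences between \<open>\<alpha>\<close> and another root would have value exactly \<open>1/24\<close>, and the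
  derivative at \<open>\<alpha>\<close>, a unit times their product, would have value \<open>23/24\<close> instead of \<open>1\<close>.\<close>

lemma not_galois_residue_field: "\<not> galois_ext (adjoin {1 / \<alpha>, \<alpha>})"
proof
  let ?E = "adjoin {1 / \<alpha>, \<alpha>}"
  assume "galois_ext ?E"
  have \<alpha>E: "\<alpha> \<in> ?E"
    unfolding adjoin_def by (rule generate_field_type_algebra(2)) blast
  then obtain S where S: "finite S" "S \<subseteq> ?E" "lift D = smult (to_ac (lead_coeff D)) (\<Prod>r\<in>S. [:- r, 1:])"
    using \<open>galois_ext ?E\<close> irreducible_D root unfolding galois_ext_def by blast
  define l where "l = to_ac (lead_coeff D)"
  have l: "l \<noteq> 0" "v l = 0"
    using d_props[OF D root] degree_D by (simp_all add: l_def)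
  have eval: "poly (lift D) x = l * (\<Prod>r\<in>S. x - r)" for x
    unfolding S(3) l_def by (simp add: poly_prod)
  have \<alpha>S: "\<alpha> \<in> S" using root S(1) l(1) unfolding eval by auto
  have "Polynomial.degree (lift D) = card S"
    unfolding S(3) using l(1) by (simp add: l_def degree_prod_sum_eq)
  then have card: "card S = 24" using degree_D by (simp add: degree_map_poly)
  have dist: "\<alpha> - r \<noteq> 0 \<and> v (\<alpha> - r) = 1 / 24" if r: "r \<in> S - {\<alpha>}" for r
  proof -
    have nz: "r - \<alpha> \<noteq> 0" using r by auto
    have rr: "poly (lift D) r = 0" using r S(1) by (auto simp: eval)
    have "v r = 1 / 24" by (rule v_root[OF D rr])
    then have "ge (1 / 24) (r - \<alpha>)" using v_root[OF D root] by (intro ge_diff) (simp_all add: ge_def)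
    then have low: "1 / 24 \<le> v (r - \<alpha>)" using nz by (simp add: ge_def)
    have up: "v (r - \<alpha>) < 2 / 24"
      by (rule roots_not_close[OF D root]) (use rr nz in auto)
    obtain p q where pq: "\<alpha> = poly (lift p) \<alpha>" "r = poly (lift q) \<alpha>"
      using \<alpha>E r S(2) adjoin_simple[OF root_nonzero[OF D root]] by blast
    then have "r - \<alpha> = poly (lift (q - p)) \<alpha>" by (simp add: lift_hom)
    then have "r - \<alpha> \<in> ?E" unfolding adjoin_simple[OF root_nonzero[OF D root]] by blast
    then obtain k :: int where k: "v (r - \<alpha>) = of_int k / 24" using v_residue_field nz by blast
    then have "k = 1" using low up by (simp add: divide_le_cancel divide_less_cancel)
    then show ?thesis using k nz v_uminus[of "r - \<alpha>"] by simp
  qed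
  let ?q = "smult l (\<Prod>r\<in>S - {\<alpha>}. [:- r, 1:])"
  have "lift D = [:- \<alpha>, 1:] * ?q"
    unfolding S(3) l_def[symmetric] using S(1) \<alpha>S by (subst prod.remove[of _ \<alpha>]) (simp_all add: mult_smult_right)
  then have "poly (pderiv (lift D)) \<alpha> = poly ?q \<alpha>"
    by (simp only: pderiv_mult poly_add poly_mult) (simp add: pderiv_pCons)
  then have q: "poly (lift (pderiv D)) \<alpha> = l * (\<Prod>r\<in>S - {\<alpha>}. \<alpha> - r)"
    by (simp add: lift_pderiv poly_prod)
  have "(\<Prod>r\<in>I. \<alpha> - r) \<noteq> 0 \<and> v (\<Prod>r\<in>I. \<alpha> - r) = of_nat (card I) / 24" if "finite I" "I \<subseteq> S - {\<alpha>}" for I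
    using that
  proof (induction I rule: finite_induct)
    case (insert r I)
    then show ?case using dist[of r] by (auto simp: v_mult add_divide_distrib)
  qed (simp add: v_1)
  from this[of "S - {\<alpha>}"] have "v (poly (lift (pderiv D)) \<alpha>) = 23 / 24"
    unfolding q using l S(1) \<alpha>S card by (simp add: v_mult)
  then show False using v_derivative[OF D root] by simp
qed

end

end

section \<open>The singular fibers\<close>

lemma card_simple_roots:
  fixes p :: "'k::alg_closed_field poly"
  assumes "p \<noteq> 0" "\<And>x. poly p x = 0 \<Longrightarrow> poly (pderiv p) x \<noteq> 0"
  shows "card {x. poly p x = 0} = Polynomial.degree p"
  using assms
proof (induction "Polynomial.degree p" arbitrary: p)
  case 0
  then obtain c where "p = [:c:]" by (metis degree_eq_zeroE)
  then show ?case using 0 by auto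
next
  case (Suc n)
  obtain r where r: "poly p r = 0" using alg_closed_imp_poly_has_root[of p] Suc(2) by auto
  then obtain q where q: "p = [:- r, 1:] * q" by (metis poly_eq_0_iff_dvd dvdE)
  have q0: "q \<noteq> 0" using q Suc(3) by auto
  have d: "Polynomial.degree p = Suc (Polynomial.degree q)" using q0 unfolding q by (subst degree_mult_eq) auto
  have der: "poly (pderiv p) x = poly q x + (x - r) * poly (pderiv q) x" for x
    unfolding q pderiv_mult by (simp add: pderiv_pCons algebra_simps)
  have qr: "poly q r \<noteq> 0" using Suc(4)[OF r] der[of r] by simp
  have "card {x. poly q x = 0} = Polynomial.degree q"
  proof (rule Suc(1))
    fix x assume x: "poly q x = 0"
    then have "poly p x = 0" by (simp add: q)
    then show "poly (pderiv q) x \<noteq> 0" using Suc(4)[of x] der[of x] x by auto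
  qed (use d Suc(2) q0 in auto)
  moreover have "{x. poly p x = 0} = insert r {x. poly q x = 0}" by (auto simp: q)
  ultimately show ?case using qr q0 poly_roots_finite[of q] d by simp
qed

text \<open>A double root \<open>x\<close> of the reversed polynomial would give the double root \<open>1/x\<close>.\<close>

lemma reflect_simple_roots:
  fixes p :: "'k::Fields.field poly"
  assumes simple: "\<And>x. poly p x = 0 \<Longrightarrow> poly (pderiv p) x \<noteq> 0" and p0: "coeff p 0 \<noteq> 0"
    and x: "poly (reflect_poly p) x = 0"
  shows "poly (pderiv (reflect_poly p)) x \<noteq> 0"
proof
  assume der: "poly (pderiv (reflect_poly p)) x = 0"
  have "p \<noteq> 0" using p0 by auto
  then have x0: "x \<noteq> 0" using x by auto
  obtain q where q: "reflect_poly p = [:- x, 1:] * q" using x by (metis poly_eq_0_iff_dvd dvdE)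
  have "poly q x = 0" using der unfolding q pderiv_mult by (simp add: pderiv_pCons)
  then obtain s where s: "q = [:- x, 1:] * s" by (metis poly_eq_0_iff_dvd dvdE)
  have "p = reflect_poly (reflect_poly p)" using p0 by simp
  also have "\<dots> = reflect_poly [:- x, 1:] * (reflect_poly [:- x, 1:] * reflect_poly s)"
    unfolding q s by (simp only: reflect_poly_mult)
  also have "reflect_poly [:- x, 1:] = [:1, - x:]" using x0 by (simp add: reflect_poly_def)
  finally have p: "p = [:1, - x:] * ([:1, - x:] * reflect_poly s)" .
  have "poly p (1 / x) = 0" unfolding p using x0 by simp
  moreover have "poly (pderiv p) (1 / x) = 0" unfolding p pderiv_mult using x0 by simp
  ultimately show False using simple by blast
qed

context weierstrass_forms
begin

lemma fiber_eq: "fiber A B a b = cubic (meval (st_point a b) A) (meval (st_point a b) B)"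
  by (simp add: fiber_def cubic_def)

lemma disc_value:
  assumes "i \<in> {cS, cT}" "st_point a b i \<noteq> 0"
  shows "4 * meval (st_point a b) A ^ 3 + 27 * meval (st_point a b) B ^ 2 =
    st_point a b i ^ 24 * poly (disc i) (st_point a b (opp i) / st_point a b i)"
  unfolding meval_affine_form[where p = "st_point a b", OF A_section assms]
    meval_affine_form[where p = "st_point a b", OF B_section assms]
  by (simp add: disc_def power_mult_distrib distrib_left flip: power_mult)

lemma disc_reflect:
  assumes "Polynomial.degree (disc cS) = 24"
  shows "disc cT = reflect_poly (disc cS)"
proof -
  have "poly (disc cT) x = poly (reflect_poly (disc cS)) x" if "x \<in> - {0}" for x
  proof -
    have "poly (disc cT) x = x ^ 24 * poly (disc cS) (1 / x)"
      using disc_value[of cS x 1] disc_value[of cT x 1] that by (simp add: st_point_def opp_def)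
    then show ?thesis using that assms by (simp add: poly_reflect_poly_nz inverse_eq_divide)
  qed
  then have "- {0} \<subseteq> {x. poly (disc cT - reflect_poly (disc cS)) x = 0}" by auto
  moreover have "infinite (- {0 :: 'k})"
    using infinite_UNIV_char_0[where 'a = 'k] by (simp add: Compl_eq_Diff_UNIV)
  ultimately have "disc cT - reflect_poly (disc cS) = 0" by (metis finite_subset poly_roots_finite)
  then show ?thesis by simp
qed

text \<open>All 24 singular fibers lie over the chart \<open>s \<noteq> 0\<close> and away from \<open>t = 0\<close> as soon as the extreme
  coefficients of the discriminant do not vanish.\<close>

context
  assumes deg: "Polynomial.degree (disc cS) = 24" and c0: "coeff (disc cS) 0 \<noteq> 0"
    and simple: "\<And>x. poly (disc cS) x = 0 \<Longrightarrow> poly (pderiv (disc cS)) x \<noteq> 0"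
begin

lemma smooth_weierstrass: "smooth_weierstrass A B"
proof unfold_locales
  fix i x assume "i \<in> {cS, cT}" "poly (disc i) x = 0"
  then show "poly (pderiv (disc i)) x \<noteq> 0"
    using simple reflect_simple_roots[OF simple c0] disc_reflect[OF deg] by auto
qed

text \<open>If both coefficients vanished at a zero of the discriminant, that zero would not be simple.\<close>

lemma nodal_fiber:
  assumes "a \<noteq> 0" "poly (disc cS) (b / a) = 0"
  obtains r where "nodal_cubic (meval (st_point a b) A) (meval (st_point a b) B) r"
proof -
  have a: "st_point a b cS \<noteq> 0" using assms by (simp add: st_point_def)
  have "meval (st_point a b) A \<noteq> 0 \<or> meval (st_point a b) B \<noteq> 0"
  proof (rule ccontr)
    assume "\<not> ?thesis"
    then have "poly (affine_form cS A) (b / a) = 0" "poly (affine_form cS B) (b / a) = 0"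
      using meval_affine_form[where p = "st_point a b" and i = cS, OF A_section _ a]
        meval_affine_form[where p = "st_point a b" and i = cS, OF B_section _ a] assms(1)
      by (auto simp: st_point_def opp_def)
    then have "poly (pderiv (disc cS)) (b / a) = 0"
      unfolding disc_def by (simp add: pderiv_add pderiv_mult pderiv_power pderiv_smult numeral_poly pderiv_pCons)
    then show False using simple assms(2) by blast
  qed
  moreover have "4 * meval (st_point a b) A ^ 3 + 27 * meval (st_point a b) B ^ 2 = 0"
    using disc_value[of cS a b] assms by (simp add: st_point_def opp_def)
  ultimately show thesis using nodal_cubic_parameter that by blast
qed

lemma singular_fiber_at_iff: "singular_fiber_at A B a b \<longleftrightarrow> a \<noteq> 0 \<and> poly (disc cS) (b / a) = 0"
proof
  assume s: "singular_fiber_at A B a b"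
  then have ab: "a \<noteq> 0 \<or> b \<noteq> 0" and z: "4 * meval (st_point a b) A ^ 3 + 27 * meval (st_point a b) B ^ 2 = 0"
    using singular_cubic_disc by (auto simp: singular_fiber_at_def fiber_eq)
  have "a \<noteq> 0"
  proof
    assume "a = 0"
    then have "poly (disc cT) 0 = 0" using disc_value[of cT a b] z ab by (simp add: st_point_def opp_def)
    then have "lead_coeff (disc cS) = 0" unfolding disc_reflect[OF deg] by simp
    then have "disc cS = 0" by (simp only: leading_coeff_0_iff)
    then show False using deg by simp
  qed
  then show "a \<noteq> 0 \<and> poly (disc cS) (b / a) = 0"
    using disc_value[of cS a b] z by (simp add: st_point_def opp_def)
next
  assume "a \<noteq> 0 \<and> poly (disc cS) (b / a) = 0"
  then have a: "a \<noteq> 0" and z: "poly (disc cS) (b / a) = 0" by auto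
  obtain r where "nodal_cubic (meval (st_point a b) A) (meval (st_point a b) B) r"
    by (rule nodal_fiber[OF a z])
  from nodal_cubic.singular_point_exists[OF this] show "singular_fiber_at A B a b"
    unfolding singular_fiber_at_def fiber_eq using a by blast
qed

lemma card_singular_fiber_points: "card (singular_fiber_points A B) = 24"
proof -
  let ?f = "\<lambda>x. proj_class (st_point 1 x) :: (svar \<Rightarrow> 'k) set"
  have "singular_fiber_points A B = ?f ` {x. poly (disc cS) x = 0}"
  proof (intro equalityI subsetI)
    fix C assume "C \<in> singular_fiber_points A B"
    then obtain a b where C: "C = proj_class (st_point a b)" and ab: "a \<noteq> 0" "poly (disc cS) (b / a) = 0"
      by (auto simp: singular_fiber_points_def singular_fiber_at_iff)
    have "C = ?f (b / a)"
      unfolding C by (rule proj_class_eqI[OF ab(1)]) (use ab in \<open>auto simp: st_point_def\<close>)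
    then show "C \<in> ?f ` {x. poly (disc cS) x = 0}" using ab by blast
  next
    fix C assume "C \<in> ?f ` {x. poly (disc cS) x = 0}"
    then show "C \<in> singular_fiber_points A B"
      unfolding singular_fiber_points_def singular_fiber_at_iff by force
  qed
  moreover have "inj ?f"
  proof (rule injI)
    fix x y assume "?f x = ?f y"
    moreover have "st_point 1 x \<in> ?f x" by (auto simp: proj_class_def intro: exI[of _ 1])
    ultimately obtain c where c: "st_point 1 x = (\<lambda>i. c * st_point 1 y i)" by (auto simp: proj_class_def)
    then have "st_point 1 x cS = c * st_point 1 y cS" "st_point 1 x cT = c * st_point 1 y cT" by metis+
    then show "x = y" by (simp add: st_point_def)
  qed
  moreover have "disc cS \<noteq> 0" using deg by auto
  ultimately show ?thesis
    using card_simple_roots[of "disc cS"] simple deg by (simp add: card_image inj_on_def)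
qed

end

end

section \<open>Binary forms and their coefficients\<close>

abbreviation st_mon :: "nat \<Rightarrow> nat \<Rightarrow> svar \<Rightarrow>\<^sub>0 nat" where
  "st_mon n i \<equiv> Poly_Mapping.single cS (n - i) + Poly_Mapping.single cT i"

lemma section_key:
  assumes "A \<in> sections n" "m \<in> Poly_Mapping.keys A"
  shows "m = st_mon n (Poly_Mapping.lookup m cT)" "Poly_Mapping.lookup m cT \<le> n"
  using sections_keys[OF assms] by (auto intro!: svar_exponents_eqI simp: lookup_add lookup_single)

lemma affine_form_coeffs:
  fixes A :: "(svar, 'k::Fields.field) mpoly"
  assumes "A \<in> sections n"
  shows "affine_form cS A = (\<Sum>i\<le>n. monom (form_coeff n A i) i)"
proof -
  have inj: "inj_on (st_mon n) {..n}"
  proof (rule inj_onI)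
    fix i j assume "st_mon n i = st_mon n j"
    then have "Poly_Mapping.lookup (st_mon n i) cT = Poly_Mapping.lookup (st_mon n j) cT" by simp
    then show "i = j" by (simp add: lookup_add lookup_single)
  qed
  have one: "monval ((\<lambda>_. 1)(cT := 1)) m = (1 :: 'k)" for m by (simp add: monval_def)
  have "affine_form cS A = (\<Sum>m\<in>Poly_Mapping.keys A. monom (Poly_Mapping.lookup A m) (Poly_Mapping.lookup m cT))"
    unfolding affine_form_def line_monomials by (simp add: opp_def one)
  also have "\<dots> = (\<Sum>m\<in>st_mon n ` {..n}. monom (Poly_Mapping.lookup A m) (Poly_Mapping.lookup m cT))"
    by (rule sum.mono_neutral_left) (use section_key[OF assms] in \<open>auto simp: in_keys_iff\<close>)
  also have "\<dots> = (\<Sum>i\<le>n. monom (form_coeff n A i) i)"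
    by (simp add: sum.reindex[OF inj] form_coeff_def lookup_add lookup_single)
  finally show ?thesis .
qed

lemma degree_affine_form:
  fixes A :: "(svar, 'k::Fields.field) mpoly"
  assumes "A \<in> sections n"
  shows "Polynomial.degree (affine_form cS A) \<le> n"
  unfolding affine_form_coeffs[OF assms] by (rule degree_sum_le) (auto intro: order.trans[OF degree_monom_le])

lemma base_change_section: "A \<in> sections n \<Longrightarrow> base_change A \<in> sections n"
proof -
  have "Poly_Mapping.keys (base_change A) \<subseteq> Poly_Mapping.keys A"
    by (auto simp: base_change_def in_keys_iff map.rep_eq when_def)
  then show "A \<in> sections n \<Longrightarrow> base_change A \<in> sections n" unfolding sections_def by blast
qed

lemma affine_form_base_change:
  assumes "A \<in> sections n"
  shows "affine_form cS (base_change A) = map_poly to_ac (affine_form cS A)"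
proof -
  have "form_coeff n (base_change A) i = to_ac (form_coeff n A i)" for i
    by (simp add: form_coeff_def base_change_def map.rep_eq when_def)
  moreover have "map_poly to_ac (\<Sum>i\<in>I. monom (c i) i) = (\<Sum>i\<in>I. monom (to_ac (c i)) i)" for c :: "nat \<Rightarrow> 'a" and I
    by (induction I rule: infinite_finite_induct) (simp_all add: lift_hom)
  ultimately show ?thesis
    unfolding affine_form_coeffs[OF assms] affine_form_coeffs[OF base_change_section[OF assms]] by simp
qed

definition form_of :: "nat \<Rightarrow> (nat \<Rightarrow> 'a::comm_monoid_add) \<Rightarrow> (svar, 'a) mpoly" where
  "form_of n c = (\<Sum>i\<le>n. Poly_Mapping.single (st_mon n i) (c i))"

lemma form_coeff_form_of: "i \<le> n \<Longrightarrow> form_coeff n (form_of n c) i = c i"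
proof -
  assume i: "i \<le> n"
  have "st_mon n j = st_mon n i \<longleftrightarrow> j = i" for j
  proof
    assume "st_mon n j = st_mon n i"
    then have "Poly_Mapping.lookup (st_mon n j) cT = Poly_Mapping.lookup (st_mon n i) cT" by simp
    then show "j = i" by (simp add: lookup_add lookup_single)
  qed simp
  then show ?thesis using i by (simp add: form_coeff_def form_of_def lookup_sum lookup_single when_def)
qed

lemma form_of_section: "form_of n c \<in> sections n"
  unfolding sections_def
proof (rule CollectI, rule ballI)
  fix m assume "m \<in> Poly_Mapping.keys (form_of n c)"
  then have "Poly_Mapping.lookup (form_of n c) m \<noteq> 0" by (simp add: in_keys_iff)
  then have "\<exists>i\<le>n. m = st_mon n i"
    unfolding form_of_def lookup_sum by (metis (no_types, lifting) atMost_iff lookup_single_not_eq sum.neutral)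
  then obtain i where i: "i \<le> n" "m = st_mon n i" by blast
  have "Poly_Mapping.keys m \<subseteq> {cS, cT}"
    unfolding i(2) by (rule order.trans[OF keys_add]) auto
  then show "Poly_Mapping.keys m \<subseteq> {cS, cT} \<and> Poly_Mapping.lookup m cS + Poly_Mapping.lookup m cT = n"
    using i by (simp add: lookup_add lookup_single)
qed

lemma meval_cong_mvars:
  assumes "\<And>i. i \<in> mvars P \<Longrightarrow> p i = q i"
  shows "meval p P = meval q P"
proof -
  have "\<forall>m\<in>Poly_Mapping.keys P. \<forall>i\<in>Poly_Mapping.keys m. p i = q i" using assms by (auto simp: mvars_def)
  then show ?thesis unfolding meval_def by simp
qed

section \<open>A dense family of wildly ramified discriminants\<close>

context dyadic_valuation
begin

definition "integral = {c :: 'f. ge 0 (to_ac c)}"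

lemma subring_integral: "subring_set integral"
  unfolding subring_set_def integral_def
  using ge_diff[of 0] ge_mult[of 0 _ 0] by (auto simp: ge_def[of 0 1] v_1)

lemma of_nat_integral: "of_nat n \<in> integral"
  using ge_of_nat by (simp add: integral_def)

lemma numeral_integral: "numeral n \<in> integral"
  using of_nat_integral[of "numeral n"] by simp

lemma pi_integral: "\<pi> \<in> integral"
  using v_pi by (simp add: integral_def ge_def)

lemma v_27: "v 27 = 0"
proof -
  have "ge (1 + 0) (2 * of_nat 13)" using v_2 by (intro ge_mult ge_of_nat) (simp add: ge_def)
  then have "gt 0 (26 :: 'f alg_closure)" using ge_imp_gt[of 1 26 0] by simp
  then show ?thesis using v_dominant[of 1 26] by (simp add: v_1)
qed

text \<open>Modulo \<open>\<pi>\<^sup>2\<close> the polynomial \<open>(-3 + \<pi>(1 + x))\<^sup>3 + 27(1 + x\<^bsup>12\<^esup>)\<^sup>2\<close> is \<open>27x\<^bsup>24\<^esup> + 54x\<^bsup>12\<^esup> + 27\<pi>(1 + x)\<close>: the constants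
  \<open>-3\<close> and \<open>1\<close> are those of a singular fiber. The coefficient 54 is divisible by \<open>\<pi>\<close>, and 27 is a unit.\<close>

lemma eisenstein_disc:
  fixes fA fB a1 b1 :: "'f poly"
  assumes int: "coeffs_in integral a1" "coeffs_in integral b1"
    and deg: "Polynomial.degree fA \<le> 8" "Polynomial.degree fB \<le> 12"
    and fA: "[:4:] * fA = [:- 3:] + [:\<pi>:] * [:1, 1:] + [:\<pi> ^ 2:] * a1"
    and fB: "[:4:] * fB = 1 + monom 1 12 + [:\<pi> ^ 2:] * b1"
  shows "eisenstein24 ([:16:] * (4 * fA ^ 3 + 27 * fB ^ 2))"
proof -
  let ?D = "[:16:] * (4 * fA ^ 3 + 27 * fB ^ 2)"
  define P0 where "P0 = [:27:] * monom 1 24 + [:54:] * monom 1 12 + [:27 * \<pi>:] * [:1, 1:]"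
  define h where "h = [:1, 1:] + [:\<pi>:] * a1"
  define q where "q = [:27:] * a1 - [:9:] * h ^ 2 + [:\<pi>:] * h ^ 3
     + [:27:] * ([:2:] * ((1 + monom 1 12) * b1) + [:\<pi> ^ 2:] * b1 ^ 2)"
  have "?D = ([:4:] * fA) ^ 3 + [:27:] * ([:4:] * fB) ^ 2"
    by (simp add: numeral_poly power2_eq_square power3_eq_cube algebra_simps)
  also have "\<dots> = P0 + [:\<pi> ^ 2:] * q"
  proof -
    define u m w where "u = [:\<pi>:]" and "m = (monom 1 12 :: 'f poly)" and "w = ([:1, 1:] :: 'f poly)"
    have c: "[:\<pi> ^ 2:] = u * u" "[:- 3:] = (- 3 :: 'f poly)" "[:27:] = (27 :: 'f poly)" "[:54:] = (54 :: 'f poly)"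
      "[:9:] = (9 :: 'f poly)" "[:2:] = (2 :: 'f poly)" "[:27 * \<pi>:] = 27 * u" "monom 1 24 = m * m"
      by (simp_all add: u_def m_def numeral_poly power2_eq_square mult_monom)
    show ?thesis
      unfolding fA fB P0_def q_def h_def c u_def[symmetric] m_def[symmetric] w_def[symmetric]
      by (simp only: power2_eq_square power3_eq_cube) (simp add: algebra_simps)
  qed
  finally have D: "?D = P0 + [:\<pi> ^ 2:] * q" .
  have one: "coeffs_in integral [:1, 1:]"
    unfolding coeffs_in_def using subring_setD[OF subring_integral] by (auto simp: coeff_pCons split: nat.split)
  have c1: "coeffs_in integral 1"
    unfolding coeffs_in_def using subring_setD[OF subring_integral] by (auto simp: coeff_1)
  have q: "coeffs_in integral q"
    unfolding q_def h_def
    by (intro coeffs_in_arith[OF subring_integral] numeral_integral pi_integral int one c1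
        subring_setD(2,7)[OF subring_integral])
  have co: "coeff ?D i = coeff P0 i + \<pi> ^ 2 * coeff q i" for i
    unfolding D by simp
  have vpi2: "ge 2 (to_ac (\<pi> ^ 2 * coeff q i))" for i
  proof -
    have "ge (of_nat 2 * 1 + 0) (to_ac \<pi> ^ 2 * to_ac (coeff q i))"
      using v_pi q by (intro ge_mult ge_power) (auto simp: ge_def coeffs_in_def integral_def)
    then show ?thesis by simp
  qed
  have P0: "coeff P0 i = (if i = 24 then 27 else if i = 12 then 54 else if i < 2 then 27 * \<pi> else 0)" for i
    unfolding P0_def by (auto simp: coeff_pCons split: nat.split)
  have deg24: "Polynomial.degree ?D \<le> 24"
  proof -
    have "Polynomial.degree (4 * fA ^ 3) \<le> 24"
      using degree_mult_le[of "4 :: 'f poly" "fA ^ 3"] degree_power_le[of fA 3] deg(1) by simp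
    moreover have "Polynomial.degree (27 * fB ^ 2) \<le> 24"
      using degree_mult_le[of "27 :: 'f poly" "fB ^ 2"] degree_power_le[of fB 2] deg(2) by simp
    ultimately have "Polynomial.degree (4 * fA ^ 3 + 27 * fB ^ 2) \<le> 24" by (rule degree_add_le)
    then show ?thesis by simp
  qed
  have "gt (v 27) (to_ac (\<pi> ^ 2 * coeff q 24))" unfolding v_27 by (rule ge_imp_gt[OF vpi2]) simp
  from v_dominant[OF _ this] have top: "to_ac (coeff ?D 24) \<noteq> 0 \<and> v (to_ac (coeff ?D 24)) = 0"
    unfolding co P0 by (simp add: v_27)
  then have "coeff ?D 24 \<noteq> 0" by (metis to_ac_0)
  then have "Polynomial.degree ?D = 24" using deg24 le_degree[of ?D 24] by simp
  moreover have low: "coeff ?D i \<noteq> 0 \<and> v (to_ac (coeff ?D i)) = 1" if "i < 2" for i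
  proof -
    have v27pi: "v (to_ac (27 * \<pi>)) = 1" using pi_nonzero by (simp add: v_mult v_27 v_pi)
    have "gt (v (to_ac (27 * \<pi>))) (to_ac (\<pi> ^ 2 * coeff q i))"
      unfolding v27pi by (rule ge_imp_gt[OF vpi2]) simp
    from v_dominant[OF _ this] have "to_ac (coeff ?D i) \<noteq> 0 \<and> v (to_ac (coeff ?D i)) = 1"
      unfolding co P0 using that pi_nonzero v27pi by simp
    then show ?thesis by (metis to_ac_0)
  qed
  moreover have "ge 1 (to_ac (coeff ?D i))" if "i < 24" for i
  proof (cases "i < 2")
    case True
    then show ?thesis using low by (simp add: ge_def)
  next
    case False
    have "ge (1 + 0) (2 * of_nat 27)" using v_2 by (intro ge_mult ge_of_nat) (simp add: ge_def)
    then have "ge 1 (to_ac (coeff P0 i))" unfolding P0 using False that by simp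
    moreover have "ge 1 (to_ac (\<pi> ^ 2 * coeff q i))" by (rule ge_mono[OF vpi2]) simp
    ultimately show ?thesis unfolding co to_ac_add by (rule ge_add)
  qed
  ultimately show ?thesis unfolding eisenstein24_def using top by blast
qed

definition cA :: "nat \<Rightarrow> 'f" where
  "cA i = (if i = 0 then - 3 + \<pi> else if i = 1 then \<pi> else 0)"

definition cB :: "nat \<Rightarrow> 'f" where
  "cB i = (if i = 0 \<or> i = 12 then 1 else 0)"

text \<open>The factor 4 gives the discriminant coefficients that are units at 2, as \<open>16(4A\<^sup>3 + 27B\<^sup>2) = (4A)\<^sup>3 + 27(4B)\<^sup>2\<close>. Letting the free part of each
  coefficient run through the natural numbers is enough for density and keeps it integral.\<close>

definition family :: "((svar, 'f) mpoly \<times> (svar, 'f) mpoly) set" where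
  "family = {(A, B). (A, B) \<in> V \<and> (\<forall>i\<le>8. \<exists>n :: nat. 4 * form_coeff 8 A i = cA i + \<pi> ^ 2 * of_nat n)
     \<and> (\<forall>i\<le>12. \<exists>n :: nat. 4 * form_coeff 12 B i = cB i + \<pi> ^ 2 * of_nat n)}"

text \<open>The coefficients of the members range independently over infinite sets.\<close>

lemma zariski_dense_family: "zariski_dense_in_V family"
  unfolding zariski_dense_in_V_def
proof (intro allI impI, elim conjE)
  fix \<Phi> :: "(nat + nat, 'f) mpoly"
  let ?W = "Inl ` {..8} \<union> Inr ` {..12} :: (nat + nat) set"
  assume vars: "mvars \<Phi> \<subseteq> ?W" and van: "\<forall>AB\<in>family. meval (V_coordinates AB) \<Phi> = 0"
  let ?c = "case_sum cA cB"
  let ?S = "\<lambda>j. range (\<lambda>n :: nat. (?c j + \<pi> ^ 2 * of_nat n) / 4)"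
  show "\<Phi> = 0"
  proof (rule mpoly_zero_if_meval_zero, rule meval_zero_on_grid[of ?W ?S])
    show "infinite (?S j)" for j
    proof (rule range_inj_infinite)
      show "inj (\<lambda>n :: nat. (?c j + \<pi> ^ 2 * of_nat n) / 4)"
        using pi_nonzero by (auto simp: inj_def)
    qed
    fix p assume p: "\<And>j. j \<in> ?W \<Longrightarrow> p j \<in> ?S j"
    let ?A = "form_of 8 (\<lambda>i. p (Inl i))" and ?B = "form_of 12 (\<lambda>i. p (Inr i))"
    have "\<exists>n :: nat. 4 * form_coeff 8 ?A i = cA i + \<pi> ^ 2 * of_nat n" if "i \<le> 8" for i
      using p[of "Inl i"] that by (auto simp: form_coeff_form_of mult.commute)
    moreover have "\<exists>n :: nat. 4 * form_coeff 12 ?B i = cB i + \<pi> ^ 2 * of_nat n" if "i \<le> 12" for i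
      using p[of "Inr i"] that by (auto simp: form_coeff_form_of mult.commute)
    ultimately have "(?A, ?B) \<in> family" by (simp add: family_def V_def form_of_section)
    then have "meval (V_coordinates (?A, ?B)) \<Phi> = 0" using van by blast
    moreover have "meval (V_coordinates (?A, ?B)) \<Phi> = meval p \<Phi>"
    proof (rule meval_cong_mvars)
      fix j assume "j \<in> mvars \<Phi>"
      then have "j \<in> ?W" using vars by blast
      then show "V_coordinates (?A, ?B) j = p j" by (auto simp: V_coordinates_def form_coeff_form_of)
    qed
    ultimately show "meval p \<Phi> = 0" by simp
  qed simp
qed

lemma family_eisenstein:
  assumes "(A, B) \<in> family"
  shows "A \<in> sections 8" "B \<in> sections 12"
    "eisenstein24 ([:16:] * (4 * affine_form cS A ^ 3 + 27 * affine_form cS B ^ 2))"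
proof -
  show A: "A \<in> sections 8" and B: "B \<in> sections 12" using assms by (auto simp: family_def V_def)
  have "\<forall>i. \<exists>n :: nat. i \<le> 8 \<longrightarrow> 4 * form_coeff 8 A i = cA i + \<pi> ^ 2 * of_nat n"
    "\<forall>i. \<exists>n :: nat. i \<le> 12 \<longrightarrow> 4 * form_coeff 12 B i = cB i + \<pi> ^ 2 * of_nat n"
    using assms by (auto simp: family_def)
  then obtain nA nB :: "nat \<Rightarrow> nat" where
    n: "\<And>i. i \<le> 8 \<Longrightarrow> 4 * form_coeff 8 A i = cA i + \<pi> ^ 2 * of_nat (nA i)"
      "\<And>i. i \<le> 12 \<Longrightarrow> 4 * form_coeff 12 B i = cB i + \<pi> ^ 2 * of_nat (nB i)"
    by metis
  define a1 b1 :: "'f poly" where "a1 = (\<Sum>i\<le>8. monom (of_nat (nA i)) i)" and "b1 = (\<Sum>i\<le>12. monom (of_nat (nB i)) i)"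
  have *: "coeff (\<Sum>i\<le>m. monom (c i) i) j = (if j \<le> m then c j else 0)" for m j and c :: "nat \<Rightarrow> 'f"
    by (simp add: coeff_sum)
  show "eisenstein24 ([:16:] * (4 * affine_form cS A ^ 3 + 27 * affine_form cS B ^ 2))"
  proof (rule eisenstein_disc)
    show "coeffs_in integral a1" "coeffs_in integral b1"
      unfolding a1_def b1_def
      by (intro coeffs_in_sum[OF subring_integral] coeffs_in_arith(5)[OF subring_integral] of_nat_integral)+
    show "Polynomial.degree (affine_form cS A) \<le> 8" "Polynomial.degree (affine_form cS B) \<le> 12"
      by (intro degree_affine_form A B)+
    show "[:4:] * affine_form cS A = [:- 3:] + [:\<pi>:] * [:1, 1:] + [:\<pi> ^ 2:] * a1"
    proof (rule poly_eqI)
      fix j show "coeff ([:4:] * affine_form cS A) j = coeff ([:- 3:] + [:\<pi>:] * [:1, 1:] + [:\<pi> ^ 2:] * a1) j"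
        using n(1)[of j] unfolding affine_form_coeffs[OF A] a1_def
        by (simp add: * cA_def coeff_pCons split: nat.split)
    qed
    show "[:4:] * affine_form cS B = 1 + monom 1 12 + [:\<pi> ^ 2:] * b1"
    proof (rule poly_eqI)
      fix j show "coeff ([:4:] * affine_form cS B) j = coeff (1 + monom 1 12 + [:\<pi> ^ 2:] * b1) j"
        using n(2)[of j] unfolding affine_form_coeffs[OF B] b1_def
        by (auto simp: * cB_def)
    qed
  qed
qed

lemma family_fibers:
  assumes AB: "(A, B) \<in> family"
  defines "A' \<equiv> base_change A" and "B' \<equiv> base_change B"
  shows "elliptic_K3 A' B'" "card (singular_fiber_points A' B') = 24"
    "singular_fiber_at A' B' a b \<Longrightarrow> nodal_rational_curve (fiber A' B' a b) \<and>
       ext_degree (residue_field a b) = 24 \<and> \<not> galois_ext (residue_field a b)"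
proof -
  note s = family_eisenstein[OF AB]
  let ?D = "[:16:] * (4 * affine_form cS A ^ 3 + 27 * affine_form cS B ^ 2)"
  interpret weierstrass_forms A' B'
    by unfold_locales (simp_all add: A'_def B'_def base_change_section s)
  have liftD: "lift ?D = [:16:] * disc cS"
  proof -
    have n: "lift (numeral m) = numeral m" for m
      using lift_hom(4)[of "numeral m"] by (simp add: numeral_poly)
    show ?thesis
      unfolding disc_def
      unfolding A'_def B'_def affine_form_base_change[OF s(1)] affine_form_base_change[OF s(2)]
        power2_eq_square power3_eq_cube lift_hom n by simp
  qed
  have root: "poly (lift ?D) x = 0 \<longleftrightarrow> poly (disc cS) x = 0" for x
    unfolding liftD by simp
  have "Polynomial.degree ([:16:] * disc cS) = 24"
    unfolding liftD[symmetric] using s(3) unfolding eisenstein24_def by (simp add: degree_map_poly del: mult_pCons_left)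
  then have deg: "Polynomial.degree (disc cS) = 24" by simp
  have "coeff ([:16:] * disc cS) 0 \<noteq> 0"
    unfolding liftD[symmetric] using s(3) unfolding eisenstein24_def by (simp add: coeff_map_poly del: mult_pCons_left)
  then have c0: "coeff (disc cS) 0 \<noteq> 0" by simp
  have simple: "poly (pderiv (disc cS)) x \<noteq> 0" if "poly (disc cS) x = 0" for x
  proof -
    have "poly (lift (pderiv ?D)) x \<noteq> 0" using v_derivative[OF s(3), of x] that root by blast
    then show ?thesis unfolding lift_pderiv liftD by (simp add: pderiv_smult)
  qed
  interpret smooth_weierstrass A' B' by (rule smooth_weierstrass[OF deg c0 simple])
  show card: "card (singular_fiber_points A' B') = 24"
    by (rule card_singular_fiber_points[OF deg c0 simple])
  then have "finite (singular_fiber_points A' B')" by (metis card.infinite zero_neq_numeral)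
  then show "elliptic_K3 A' B'" unfolding elliptic_K3_def using K3_surface_G by blast
  assume "singular_fiber_at A' B' a b"
  then have ab: "a \<noteq> 0" "poly (disc cS) (b / a) = 0"
    using singular_fiber_at_iff[OF deg c0 simple] by auto
  obtain r where "nodal_cubic (meval (st_point a b) A') (meval (st_point a b) B') r"
    using nodal_fiber[OF deg c0 simple ab] by blast
  then have "nodal_rational_curve (fiber A' B' a b)"
    unfolding fiber_eq by (rule nodal_cubic.nodal_rational_cubic)
  moreover have rt: "poly (lift ?D) (b / a) = 0" using ab(2) root by blast
  have "residue_field a b = adjoin {1 / (b / a), b / a}" by (simp add: residue_field_def)
  ultimately show "nodal_rational_curve (fiber A' B' a b) \<and>
       ext_degree (residue_field a b) = 24 \<and> \<not> galois_ext (residue_field a b)"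
    using ext_degree_residue_field[OF s(3) rt] not_galois_residue_field[OF s(3) rt] by simp
qed

end

theorem corollary1p5:
  assumes "number_field TYPE('f::field_char_0)"
  shows "\<exists>T :: ((svar, 'f) mpoly \<times> (svar, 'f) mpoly) set.
    T \<subseteq> V \<and> zariski_dense_in_V T \<and>
    (\<forall>(A, B)\<in>T.
       let A' = base_change A; B' = base_change B in
       elliptic_K3 A' B' \<and>
       card (singular_fiber_points A' B') = 24 \<and>
       (\<forall>a b. singular_fiber_at A' B' a b \<longrightarrow>
          nodal_rational_curve (fiber A' B' a b) \<and>
          ext_degree (residue_field a b) = 24 \<and>
          \<not> galois_ext (residue_field a b)))"
proof -
  obtain v :: "'f alg_closure \<Rightarrow> rat" and \<pi> where "dyadic_valuation v \<pi>"
    using dyadic_valuation_exists[OF assms] by metis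
  then interpret dyadic_valuation v \<pi> .
  show ?thesis
  proof (rule exI[of _ family], intro conjI)
    show "family \<subseteq> V" by (auto simp: family_def)
  qed (use zariski_dense_family family_fibers in \<open>auto simp: Let_def\<close>)
qed

end
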